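(* Let $\phi_{AB}$ be a spin-1 (Maxwell) field on the Minkowski spacetime with F-gauge components $\phi_0,\phi_1,\phi_2$ admitting the expansion given in the context and satisfying the regularity condition $E^\ast_{p,m}=I^\ast_{p,m}=0$. For each integer $n\ge1$ there is a numerical coefficient $Q^-(n)$, depending only on $n$, such that the electromagnetic Newman–Penrose constants $\bar F^{n-1}_m$ at $\mathscr I^-$ are given by $$\bar F_m^{n-1}=Q^-(n)\,D_{n+1,n,m},\qquad |m|\le n,$$ where $D_{n+1,n,m}$ is determined by the initial data $a_{0,n+1;n,m}(0)$ and $a_{2,n+1;n,m}(0)$ as specified in the context.
   Context: Geometry. $(\mathcal M,g)$ is the conformal extension of Minkowski space with coordinates $\tau\in[-1,1]$, $\rho\ge0$ and points of $\mathbb S^2$, with $g=d\tau^2-\rho^{-2}(1-\tau^2)d\rho^2+2\rho^{-1}\tau\,d\tau\,d\rho-\sigma=\Theta^2\tilde\eta$, where $\Theta=\rho(1-\tau^2)$, $\sigma$ is the unit round metric and $\tilde\eta=d\tilde t^2-d\tilde\rho^2-\tilde\rho^2\sigma$ is the Minkowski metric, with $\tilde t=\tau/(\rho(1-\tau^2))$, $\tilde\rho=1/(\rho(1-\tau^2))$. $\mathscr I^\pm=\{\tau=\pm1\}$. The F-frame is $e_{00'}=\tfrac{\sqrt2}{2}((1-\tau)\partial_\tau+\rho\partial_\rho)$, $e_{11'}=\tfrac{\sqrt2}{2}((1+\tau)\partial_\tau-\rho\partial_\rho)$, $e_{01'}=\tfrac{\sqrt2}{2}\partial_+$, $e_{10'}=\tfrac{\sqrt2}{2}\partial_-$,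 with $\partial_+=\overline{\partial_-}$ a complex null frame on $\mathbb S^2$, $\sigma^{-1}=\tfrac12(\partial_+\otimes\partial_-+\partial_-\otimes\partial_+)$. Harmonics. $Y_{s;\ell,m}$ are the $L^2(\mathbb S^2)$-orthonormal spin-weighted spherical harmonics, with $\eth Y_{s;\ell,m}=\sqrt{(\ell-s)(\ell+s+1)}\,Y_{s+1;\ell,m}$, $\bar\eth Y_{s;\ell,m}=-\sqrt{(\ell+s)(\ell-s+1)}\,Y_{s-1;\ell,m}$. Field. The Maxwell equations $\nabla_{A'}{}^{A}\phi_{AB}=0$ on $(\mathcal M,g)$, for the components $\phi_0,\phi_1,\phi_2$ (spin weights $1,0,-1$) in the spin dyad adapted to the F-frame, read $(1+\tau)\partial_\tau\phi_0-\rho\partial_\rho\phi_0+\eth\phi_1=-\phi_0$, $\partial_\tau\phi_1+\tfrac12(\eth\phi_2+\bar\eth\phi_0)=0$, $(1-\tau)\partial_\tau\phi_2+\rho\partial_\rho\phi_2+\bar\eth\phi_1=\phi_2$, $\tau\partial_\tau\phi_1-\rho\partial_\rho\phi_1+\tfrac12(\eth\phi_2-\bar\eth\phi_0)=0$. The fields are smooth in $(\tau,\rho)$ and have expansions near $\rho=0$ $$\phi_n=\sum_{p\ge|1-n|}\ \sum_{\ell=|1-n|}^{p}\ \sum_{m=-\ell}^{\ell}\frac1{p!}\,a_{n,p;\ell,m}(\tau)\,Y_{1-n;\ell,m}\,\rho^p,\qquad n=0,1,2,$$ convergent together with all termwise derivatives, locally uniformly for $|\tau|\le1$, $0\le\rho<\rho_0$.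 Regularity condition. For $\ell=p$ one has $a_{0,p;p,m}=(\tfrac{1-\tau}{2})^{p+1}(\tfrac{1+\tau}{2})^{p-1}\big(E_{p,m}+E^\ast_{p,m}\int_0^\tau\frac{ds}{(1+s)^p(1-s)^{p+2}}\big)$ and $a_{2,p;p,m}=(\tfrac{1+\tau}{2})^{p+1}(\tfrac{1-\tau}{2})^{p-1}\big(I_{p,m}+I^\ast_{p,m}\int_0^\tau\frac{ds}{(1-s)^p(1+s)^{p+2}}\big)$ with constants $E,E^\ast,I,I^\ast$; the condition is $E^\ast_{p,m}=I^\ast_{p,m}=0$ for all $p\ge 1$, $|m|\le p$. Constants $D$. For $1\le\ell<p$ put $Q^1_{p,\ell}(\tau)=(\tfrac{1-\tau}{2})^{p+1}P_{\ell-1}^{(p+1,-p+1)}(\tau)$, $Q^3_{p,\ell}(\tau)=(\tfrac{1+\tau}{2})^{p-1}P_{\ell+1}^{(-p-1,p-1)}(\tau)$, where $P_k^{(\alpha,\beta)}(x)=\sum_{s=0}^k\binom{k+\alpha}{k-s}\binom{k+\beta}{s}\left(\tfrac{x-1}{2}\right)^s\left(\tfrac{x+1}{2}\right)^{k-s}$ are Jacobi polynomials (generalized binomial coefficients), and $$X_{p,\ell}(\tau)=\begin{pmatrix}Q^1_{p,\ell}(\tau)&(-1)^{\ell+1}Q^3_{p,\ell}(\tau)\\(-1)^{\ell+1}Q^3_{p,\ell}(-\tau)&Q^1_{p,\ell}(-\tau)\end{pmatrix}.$$ Then $(C_{p,\ell,m},D_{p,\ell,m})^{T}:=X_{p,\ell}(0)^{-1}(a_{0,p;\ell,m}(0),a_{2,p;\ell,m}(0))^{T}$.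 NP constants at $\mathscr I^-$ (the bar is not complex conjugation). Let $\phi_2'=\frac{4}{\rho(1-\tau)^2}\phi_0$ and $\tilde\phi_2=\tilde\rho^{-3}\phi_2'$ (the component of the physical Maxwell spinor in the dyad associated with the NP frame at $\mathscr I^-$). At fixed advanced time $\tilde v=\tilde t+\tilde\rho=1/(\rho(1-\tau))$ and fixed angles, as $\tilde\rho\to\infty$, $\tilde\phi_2=\sum_{k=0}^N\tilde\phi_2^k\,\tilde\rho^{-3-k}+o(\tilde\rho^{-3-N})$ for every $N$, with $\tilde\phi_2^k$ independent of $\tilde\rho$. For $n\ge0$, $|m|\le n+1$, $\bar F^n_m=\int_{\mathcal C}\overline{Y_{1;n+1,m}}\,\tilde\phi_2^{n+1}\,dS$, where $\mathcal C\cong\mathbb S^2$ is a cut $\{\tau=-1,\rho=\rho_\star\}$ of $\mathscr I^-$ with $0<\rho_\star<\rho_0$, and $dS$ is the area element of $\sigma$; the value is independent of the cut. *)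

theory Defs
  imports "HOL-Analysis.Analysis" "HOL-Library.Landau_Symbols"
begin

subsection \<open>Spin-weighted functions on the sphere\<close>

text \<open>
  A spin-weighted function is represented by its component in the standard frame of the polar
  chart, as a function of the angles \<open>\<theta>\<close> in \<open>(0, \<pi>)\<close> and \<open>\<alpha>\<close> (the azimuth). The frame is
  \<open>\<partial>\<^sub>\<plusminus> = -(\<partial>\<^sub>\<theta> \<plusminus> \<i> csc \<theta> \<partial>\<^sub>\<alpha>)\<close>, for which \<open>\<sigma>\<inverse> = (\<partial>\<^sub>+ \<otimes> \<partial>\<^sub>- + \<partial>\<^sub>- \<otimes> \<partial>\<^sub>+) / 2\<close>;
  on spin weight \<open>s\<close> the operators below are
  \<open>-(sin \<theta>)\<^sup>s (\<partial>\<^sub>\<theta> + \<i> csc \<theta> \<partial>\<^sub>\<alpha>) (sin \<theta>)\<^sup>-\<^sup>s\<close> and \<open>-(sin \<theta>)\<^sup>-\<^sup>s (\<partial>\<^sub>\<theta> - \<i> csc \<theta> \<partial>\<^sub>\<alpha>) (sin \<theta>)\<^sup>s\<close>.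
\<close>

type_synonym sphere_fun = "real \<Rightarrow> real \<Rightarrow> complex"

definition eth :: "int \<Rightarrow> sphere_fun \<Rightarrow> sphere_fun" where
  "eth s f \<theta> \<alpha> =
     - (vector_derivative (\<lambda>x. f x \<alpha>) (at \<theta>)
        + \<i> / of_real (sin \<theta>) * vector_derivative (\<lambda>y. f \<theta> y) (at \<alpha>)
        - of_int s * of_real (cot \<theta>) * f \<theta> \<alpha>)"

definition eth_bar :: "int \<Rightarrow> sphere_fun \<Rightarrow> sphere_fun" where
  "eth_bar s f \<theta> \<alpha> =
     - (vector_derivative (\<lambda>x. f x \<alpha>) (at \<theta>)
        - \<i> / of_real (sin \<theta>) * vector_derivative (\<lambda>y. f \<theta> y) (at \<alpha>)
        + of_int s * of_real (cot \<theta>) * f \<theta> \<alpha>)"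

text \<open>
  Iterated angular derivatives of a function of spin weight \<open>s\<close>: \<open>True\<close> stands for \<open>eth\<close> (which
  raises the spin weight by one), \<open>False\<close> for \<open>eth_bar\<close> (which lowers it); the head of the list
  is applied first.
\<close>

primrec ang_deriv :: "bool list \<Rightarrow> int \<Rightarrow> sphere_fun \<Rightarrow> sphere_fun" where
  "ang_deriv [] s f = f"
| "ang_deriv (b # w) s f =
     (if b then ang_deriv w (s + 1) (eth s f) else ang_deriv w (s - 1) (eth_bar s f))"

text \<open>
  The orthonormal spin-weighted spherical harmonics, by the formula of Goldberg et al. (1967),
  with the powers of \<open>cot (\<theta>/2)\<close> and \<open>sin (\<theta>/2)\<close> multiplied out. The range of \<open>r\<close> is the set where
  both binomial coefficients are nonzero, and there all arguments of \<open>nat\<close> are nonnegative. The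
  phases are those for which
  \<open>eth Y\<^sub>s = sqrt ((l - s) (l + s + 1)) Y\<^sub>s\<^sub>+\<^sub>1\<close> and \<open>eth_bar Y\<^sub>s = - sqrt ((l + s) (l - s + 1)) Y\<^sub>s\<^sub>-\<^sub>1\<close>.
\<close>

definition Y :: "int \<Rightarrow> nat \<Rightarrow> int \<Rightarrow> sphere_fun" where
  "Y s l m \<theta> \<alpha> =
     of_real ((-1) powi m
       * sqrt ((2 * real l + 1) * fact (nat (int l + m)) * fact (nat (int l - m))
               / (4 * pi * fact (nat (int l + s)) * fact (nat (int l - s))))
       * (\<Sum>r\<in>{max 0 (m - s)..min (int l - s) (int l + m)}.
            (-1) ^ nat (int l - r - s)
            * real (nat (int l - s) choose nat r) * real (nat (int l + s) choose nat (r + s - m))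
            * cos (\<theta> / 2) ^ nat (2 * r + s - m) * sin (\<theta> / 2) ^ nat (2 * int l - 2 * r - s + m)))
     * cis (of_int m * \<alpha>)"

definition sphere_integral :: "sphere_fun \<Rightarrow> complex" where
  "sphere_integral f =
     (LINT x:{0<..<pi} \<times> {0<..<2 * pi}|lborel. of_real (sin (fst x)) * f (fst x) (snd x))"


subsection \<open>Maxwell fields in the F-gauge\<close>

text \<open>
  A field \<open>\<phi>\<close> gives its components \<open>\<phi> n \<tau> \<rho> \<theta> \<alpha>\<close> for \<open>n = 0, 1, 2\<close>, of spin weight \<open>1 - n\<close>, on
  \<open>-1 \<le> \<tau> \<le> 1\<close>, \<open>0 \<le> \<rho>\<close>; derivatives on the boundary are one-sided.
\<close>

type_synonym field = "nat \<Rightarrow> real \<Rightarrow> real \<Rightarrow> sphere_fun"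

definition d_tau :: "(real \<Rightarrow> real \<Rightarrow> complex) \<Rightarrow> real \<Rightarrow> real \<Rightarrow> complex" where
  "d_tau f \<tau> \<rho> = vector_derivative (\<lambda>t. f t \<rho>) (at \<tau> within {-1..1})"

definition d_rho :: "(real \<Rightarrow> real \<Rightarrow> complex) \<Rightarrow> real \<Rightarrow> real \<Rightarrow> complex" where
  "d_rho f \<tau> \<rho> = vector_derivative (\<lambda>r. f \<tau> r) (at \<rho> within {0..})"

definition smooth_tau_rho :: "(real \<Rightarrow> real \<Rightarrow> complex) \<Rightarrow> bool" where
  "smooth_tau_rho f \<longleftrightarrow>
     (\<forall>i j. let g = (d_tau ^^ i) ((d_rho ^^ j) f) in
        continuous_on ({-1..1} \<times> {0..}) (\<lambda>(\<tau>, \<rho>). g \<tau> \<rho>) \<and>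
        (\<forall>\<tau>\<in>{-1..1}. \<forall>\<rho>\<ge>0.
           (\<lambda>t. g t \<rho>) differentiable (at \<tau> within {-1..1}) \<and>
           (\<lambda>r. g \<tau> r) differentiable (at \<rho> within {0..})))"

definition smooth_field :: "field \<Rightarrow> bool" where
  "smooth_field \<phi> \<longleftrightarrow>
     (\<forall>n\<le>2. \<forall>\<theta>\<in>{0<..<pi}. \<forall>\<alpha>. smooth_tau_rho (\<lambda>\<tau> \<rho>. \<phi> n \<tau> \<rho> \<theta> \<alpha>))"

text \<open>
  The first conjunct only makes the angular derivatives in the equations meaningful.
\<close>

definition maxwell :: "field \<Rightarrow> bool" where
  "maxwell \<phi> \<longleftrightarrow>
     (\<forall>\<tau>\<in>{-1..1}. \<forall>\<rho>\<ge>0. \<forall>\<theta>\<in>{0<..<pi}. \<forall>\<alpha>.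
        let \<phi>\<^sub>0 = \<phi> 0 \<tau> \<rho> \<theta> \<alpha>; \<phi>\<^sub>2 = \<phi> 2 \<tau> \<rho> \<theta> \<alpha>;
            D\<^sub>\<tau> = (\<lambda>n. d_tau (\<lambda>t r. \<phi> n t r \<theta> \<alpha>) \<tau> \<rho>);
            D\<^sub>\<rho> = (\<lambda>n. d_rho (\<lambda>t r. \<phi> n t r \<theta> \<alpha>) \<tau> \<rho>);
            \<tau>' = complex_of_real \<tau>; \<rho>' = complex_of_real \<rho>
        in
          (\<forall>n\<le>2. (\<lambda>x. \<phi> n \<tau> \<rho> x \<alpha>) differentiable (at \<theta>) \<and>
                  (\<lambda>y. \<phi> n \<tau> \<rho> \<theta> y) differentiable (at \<alpha>)) \<and>
          (1 + \<tau>') * D\<^sub>\<tau> 0 - \<rho>' * D\<^sub>\<rho> 0 + eth 0 (\<phi> 1 \<tau> \<rho>) \<theta> \<alpha> = - \<phi>\<^sub>0 \<and>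
          D\<^sub>\<tau> 1 + 1/2 * (eth (-1) (\<phi> 2 \<tau> \<rho>) \<theta> \<alpha> + eth_bar 1 (\<phi> 0 \<tau> \<rho>) \<theta> \<alpha>) = 0 \<and>
          (1 - \<tau>') * D\<^sub>\<tau> 2 + \<rho>' * D\<^sub>\<rho> 2 + eth_bar 0 (\<phi> 1 \<tau> \<rho>) \<theta> \<alpha> = \<phi>\<^sub>2 \<and>
          \<tau>' * D\<^sub>\<tau> 1 - \<rho>' * D\<^sub>\<rho> 1
            + 1/2 * (eth (-1) (\<phi> 2 \<tau> \<rho>) \<theta> \<alpha> - eth_bar 1 (\<phi> 0 \<tau> \<rho>) \<theta> \<alpha>) = 0)"


subsection \<open>Expansion at spatial infinity\<close>

text \<open>\<open>a n p l m\<close> is the coefficient of \<open>Y (1 - n) l m\<close> times \<open>\<rho>\<^sup>p / p!\<close> in the component \<open>\<phi> n\<close>.\<close>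

type_synonym coeffs = "nat \<Rightarrow> nat \<Rightarrow> nat \<Rightarrow> int \<Rightarrow> real \<Rightarrow> complex"

definition d1_tau :: "(real \<Rightarrow> complex) \<Rightarrow> real \<Rightarrow> complex" where
  "d1_tau f \<tau> = vector_derivative f (at \<tau> within {-1..1})"

definition spin :: "nat \<Rightarrow> int" where
  "spin n = 1 - int n"

text \<open>
  The order \<open>\<rho>\<^sup>p\<close> part of the expansion of \<open>\<phi> n\<close>, differentiated \<open>i\<close> times in \<open>\<tau>\<close>, \<open>j\<close> times in \<open>\<rho>\<close>
  and along \<open>w\<close> in the angles. It vanishes for \<open>p < \<bar>1 - n\<bar>\<close>, the range of \<open>l\<close> being empty.
\<close>

definition expansion_term ::
    "coeffs \<Rightarrow> nat \<Rightarrow> nat \<Rightarrow> nat \<Rightarrow> bool list \<Rightarrow> nat \<Rightarrow> real \<Rightarrow> real \<Rightarrow> sphere_fun" where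
  "expansion_term a n i j w p \<tau> \<rho> \<theta> \<alpha> =
     (\<Sum>l\<in>{nat \<bar>spin n\<bar>..p}. \<Sum>m\<in>{- int l..int l}.
        1 / fact p * (d1_tau ^^ i) (a n p l m) \<tau>
        * ang_deriv w (spin n) (Y (spin n) l m) \<theta> \<alpha>
        * of_real ((deriv ^^ j) (\<lambda>r. r ^ p) \<rho>))"

definition has_expansion :: "field \<Rightarrow> real \<Rightarrow> coeffs \<Rightarrow> bool" where
  "has_expansion \<phi> \<rho>\<^sub>0 a \<longleftrightarrow>
     (\<forall>n\<le>2. \<forall>p. \<forall>l\<in>{nat \<bar>spin n\<bar>..p}. \<forall>m\<in>{- int l..int l}. \<forall>i.
        (d1_tau ^^ i) (a n p l m) differentiable_on {-1..1}) \<and>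
     (\<forall>n\<le>2. \<forall>i j w. \<forall>R<\<rho>\<^sub>0.
        uniformly_convergent_on ({-1..1} \<times> {0..R} \<times> {0<..<pi} \<times> UNIV)
          (\<lambda>N (\<tau>, \<rho>, \<theta>, \<alpha>). \<Sum>p<N. expansion_term a n i j w p \<tau> \<rho> \<theta> \<alpha>)) \<and>
     (\<forall>n\<le>2. \<forall>\<tau>\<in>{-1..1}. \<forall>\<rho>\<in>{0..<\<rho>\<^sub>0}. \<forall>\<theta>\<in>{0<..<pi}. \<forall>\<alpha>.
        (\<lambda>p. expansion_term a n 0 0 [] p \<tau> \<rho> \<theta> \<alpha>) sums \<phi> n \<tau> \<rho> \<theta> \<alpha>)"

text \<open>
  The form of the coefficients with \<open>l = p\<close>. The interval integral is oriented, so that negative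
  \<open>\<tau>\<close> are covered; it diverges at \<open>\<tau> = \<plusminus>1\<close>, whence the open interval.
\<close>

definition top_form ::
    "coeffs \<Rightarrow> nat \<Rightarrow> int \<Rightarrow> complex \<Rightarrow> complex \<Rightarrow> complex \<Rightarrow> complex \<Rightarrow> bool" where
  "top_form a p m E E' I I' \<longleftrightarrow>
     (\<forall>\<tau>\<in>{-1<..<1}.
        a 0 p p m \<tau> = of_real (((1 - \<tau>) / 2) ^ (p + 1) * ((1 + \<tau>) / 2) ^ (p - 1))
          * (E + E' * of_real (LBINT s=ereal 0..ereal \<tau>. 1 / ((1 + s) ^ p * (1 - s) ^ (p + 2)))) \<and>
        a 2 p p m \<tau> = of_real (((1 + \<tau>) / 2) ^ (p + 1) * ((1 - \<tau>) / 2) ^ (p - 1))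
          * (I + I' * of_real (LBINT s=ereal 0..ereal \<tau>. 1 / ((1 - s) ^ p * (1 + s) ^ (p + 2)))))"

definition regularity_condition :: "coeffs \<Rightarrow> bool" where
  "regularity_condition a \<longleftrightarrow>
     (\<forall>p\<ge>1. \<forall>m. \<bar>m\<bar> \<le> int p \<longrightarrow>
        (\<exists>E E' I I'. top_form a p m E E' I I' \<and> E' = 0 \<and> I' = 0))"


subsection \<open>The constants of the modes with \<open>l < p\<close>\<close>

definition jacobi :: "nat \<Rightarrow> real \<Rightarrow> real \<Rightarrow> real \<Rightarrow> real" where
  "jacobi k \<alpha> \<beta> x =
     (\<Sum>s=0..k. ((real k + \<alpha>) gchoose (k - s)) * ((real k + \<beta>) gchoose s)
        * ((x - 1) / 2) ^ s * ((x + 1) / 2) ^ (k - s))"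

definition Q1 :: "nat \<Rightarrow> nat \<Rightarrow> real \<Rightarrow> real" where
  "Q1 p l \<tau> = ((1 - \<tau>) / 2) ^ (p + 1) * jacobi (l - 1) (real p + 1) (- real p + 1) \<tau>"

definition Q3 :: "nat \<Rightarrow> nat \<Rightarrow> real \<Rightarrow> real" where
  "Q3 p l \<tau> = ((1 + \<tau>) / 2) ^ (p - 1) * jacobi (l + 1) (- real p - 1) (real p - 1) \<tau>"

definition X_matrix :: "nat \<Rightarrow> nat \<Rightarrow> real \<Rightarrow> complex^2^2" where
  "X_matrix p l \<tau> =
     vector [vector [of_real (Q1 p l \<tau>), of_real ((-1) ^ (l + 1) * Q3 p l \<tau>)],
             vector [of_real ((-1) ^ (l + 1) * Q3 p l (- \<tau>)), of_real (Q1 p l (- \<tau>))]]"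

definition CD_vector :: "coeffs \<Rightarrow> nat \<Rightarrow> nat \<Rightarrow> int \<Rightarrow> complex^2" where
  "CD_vector a p l m = matrix_inv (X_matrix p l 0) *v vector [a 0 p l m 0, a 2 p l m 0]"

definition D_const :: "coeffs \<Rightarrow> nat \<Rightarrow> nat \<Rightarrow> int \<Rightarrow> complex" where
  "D_const a p l m = CD_vector a p l m $ 2"


subsection \<open>Newman--Penrose constants at past null infinity\<close>

definition phys_radius :: "real \<Rightarrow> real \<Rightarrow> real" where
  "phys_radius \<tau> \<rho> = 1 / (\<rho> * (1 - \<tau>\<^sup>2))"

definition phys_time :: "real \<Rightarrow> real \<Rightarrow> real" where
  "phys_time \<tau> \<rho> = \<tau> / (\<rho> * (1 - \<tau>\<^sup>2))"

definition adv_time :: "real \<Rightarrow> real \<Rightarrow> real" where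
  "adv_time \<tau> \<rho> = phys_time \<tau> \<rho> + phys_radius \<tau> \<rho>"

text \<open>The coordinates \<open>(\<tau>, \<rho>)\<close> of the point with advanced time \<open>v\<close> and physical radius \<open>r\<close>.\<close>

definition tau_of :: "real \<Rightarrow> real \<Rightarrow> real" where
  "tau_of v r = v / r - 1"

definition rho_of :: "real \<Rightarrow> real \<Rightarrow> real" where
  "rho_of v r = 1 / (v * (1 - tau_of v r))"

lemma adv_time_eq:
  assumes "\<bar>\<tau>\<bar> < 1" "\<rho> > 0"
  shows "adv_time \<tau> \<rho> = 1 / (\<rho> * (1 - \<tau>))"
proof -
  have "adv_time \<tau> \<rho> = (1 + \<tau>) / (\<rho> * ((1 - \<tau>) * (1 + \<tau>)))"
    by (simp add: adv_time_def phys_time_def phys_radius_def add_divide_distrib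
        power2_eq_square algebra_simps)
  with assms show ?thesis by auto
qed

lemma phys_radius_inverse:
  assumes "v > 0" "r > v / 2"
  shows "phys_radius (tau_of v r) (rho_of v r) = r"
  using assms unfolding phys_radius_def tau_of_def rho_of_def
  by (simp add: field_simps power2_eq_square)

lemma adv_time_inverse:
  assumes "v > 0" "r > v / 2"
  shows "adv_time (tau_of v r) (rho_of v r) = v"
proof -
  have r: "r > 0" using assms by linarith
  have "\<bar>tau_of v r\<bar> < 1" using assms r by (simp add: tau_of_def abs_less_iff field_simps)
  moreover from this have "rho_of v r > 0" using assms by (simp add: rho_of_def)
  ultimately show ?thesis
    using adv_time_eq assms by (simp add: rho_of_def)
qed

definition phi2_prime :: "field \<Rightarrow> real \<Rightarrow> real \<Rightarrow> sphere_fun" where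
  "phi2_prime \<phi> \<tau> \<rho> \<theta> \<alpha> = of_real (4 / (\<rho> * (1 - \<tau>)\<^sup>2)) * \<phi> 0 \<tau> \<rho> \<theta> \<alpha>"

definition phi2_phys :: "field \<Rightarrow> real \<Rightarrow> real \<Rightarrow> sphere_fun" where
  "phi2_phys \<phi> \<tau> \<rho> \<theta> \<alpha> = of_real (1 / phys_radius \<tau> \<rho> ^ 3) * phi2_prime \<phi> \<tau> \<rho> \<theta> \<alpha>"

text \<open>
  The coefficients of the asymptotic expansion of \<open>phi2_phys\<close> along a generator of an ingoing
  light cone, that is, at fixed advanced time \<open>v\<close> and angles, as the physical radius \<open>r\<close> tends to
  infinity.
\<close>

definition is_radial_expansion ::
    "field \<Rightarrow> real \<Rightarrow> real \<Rightarrow> real \<Rightarrow> (nat \<Rightarrow> complex) \<Rightarrow> bool" where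
  "is_radial_expansion \<phi> v \<theta> \<alpha> c \<longleftrightarrow>
     (\<forall>N. (\<lambda>r. phi2_phys \<phi> (tau_of v r) (rho_of v r) \<theta> \<alpha>
               - (\<Sum>k\<le>N. c k / of_real (r ^ (3 + k))))
          \<in> o[at_top](\<lambda>r. complex_of_real (1 / r ^ (3 + N))))"

definition phi2_coeff :: "field \<Rightarrow> nat \<Rightarrow> real \<Rightarrow> sphere_fun" where
  "phi2_coeff \<phi> k v \<theta> \<alpha> = (THE c. is_radial_expansion \<phi> v \<theta> \<alpha> c) k"

text \<open>
  The constant computed on the cut \<open>\<tau> = -1\<close>, \<open>\<rho> = \<rho>\<^sub>s\<close>, where \<open>v = 1 / (\<rho>\<^sub>s (1 - \<tau>))\<close>.
\<close>

definition NP_const :: "field \<Rightarrow> real \<Rightarrow> nat \<Rightarrow> int \<Rightarrow> complex" where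
  "NP_const \<phi> \<rho>\<^sub>s n m =
     sphere_integral (\<lambda>\<theta> \<alpha>.
       cnj (Y 1 (n + 1) m \<theta> \<alpha>) * phi2_coeff \<phi> (n + 1) (1 / (2 * \<rho>\<^sub>s)) \<theta> \<alpha>)"

end

theory Submission
  imports Defs "HOL-Computational_Algebra.Formal_Power_Series"
begin

text \<open>
  Write \<open>x\<close> for \<open>\<tau>\<close>. Projecting the Maxwell equations on the harmonics gives, for each \<open>p \<ge> l \<ge> 1\<close>, a linear
  system for \<open>a\<^sub>0, a\<^sub>1, a\<^sub>2\<close> from which \<open>a\<^sub>1\<close> and \<open>a\<^sub>2\<close> can be eliminated; then \<open>y = (1 - x)\<^sup>-\<^sup>p\<^sup>-\<^sup>1 a\<^sub>0\<close> solves a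
  Jacobi equation, and comparing its Taylor coefficients at \<open>x = -1\<close> gives \<open>(l + 1 - p) y\<^sub>l = 0\<close>.

  Along the ray of advanced time \<open>v\<close> one has \<open>\<rho> = 1 / (v (1 - x))\<close> and \<open>x + 1 = v / r\<close>, so that the coefficients
  of the expansion of the physical component in \<open>1 / r\<close> are Taylor coefficients at \<open>x = -1\<close> of
  \<open>\<phi>\<^sub>0 / (1 - x)\<close>. The projection of the \<open>n\<close>-th one on the mode \<open>l = n\<close> is a sum over \<open>p\<close> of multiples of
  the coefficients \<open>y\<^sub>n\<close>, of which only the one with \<open>p = n + 1\<close> survives. In that case the system is solved by
  \<open>a\<^sub>0 = D + (C - D) q\<close>, where \<open>q\<close> is a partial sum of the binomial expansion of
  \<open>((1 + x) / 2 + (1 - x) / 2)\<^sup>2\<^sup>n\<^sup>+\<^sup>1\<close>. The summand \<open>(C - D) q\<close> contributes to \<open>y\<close> a polynomial of degree less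
  than \<open>n\<close>, whence \<open>y\<^sub>n\<close> is a multiple of \<open>D\<close>.
\<close>

subsection \<open>Spin-weighted harmonics\<close>

text \<open>What joins the two halves is an exponent: on the ray,
  \<open>\<rho> ^ p / (1 - x)\<close> is \<open>v ^ -p\<close> times
  \<open>(1 - x) ^ -(p + 1)\<close>, so the order \<open>p\<close> part of
  \<open>\<phi> 0 / (1 - x)\<close> is built from the very \<open>y\<close> of the Jacobi equation;
  \<open>p + 1\<close> is an indicial exponent at \<open>x = 1\<close>. The obstacle is that all
  happens at \<open>x = -1\<close>, a singular point of the equation and an end of the interval, for
  a field that is an infinite sum over \<open>p\<close>. Since the mode equations hold on the closed
  interval, they can be differentiated at its end, which makes them identities of formal power
  series. The sum over \<open>p\<close> is controlled by writing each Taylor coefficient along the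
  ray as a finite combination, with weights free of \<open>p\<close>, of derivatives whose series
  converge uniformly. The factor is \<open>Q n = (2 n + 1 choose n) / (4 ^ n (n + 1)!)\<close>: the
  \<open>n\<close>-th coefficient of \<open>(2 - X) ^ -(n + 2)\<close> is
  \<open>(2 n + 1 choose n) / 2 ^ (2 n + 2)\<close>, the passage to the physical component gives
  \<open>4 v ^ (n + 1)\<close>, the expansion \<open>1 / ((n + 1)! v ^ (n + 1))\<close>, and so
  \<open>v\<close>, that is the cut, drops out.\<close>

definition coeffs_have_derivative ::
    "(real \<Rightarrow> 'a::real_normed_field fps) \<Rightarrow> 'a fps \<Rightarrow> real filter \<Rightarrow> bool" where
  "coeffs_have_derivative F F' net \<longleftrightarrow>
     (\<forall>i. ((\<lambda>x. fps_nth (F x) i) has_vector_derivative fps_nth F' i) net)"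

lemma coeffs_have_derivative_const [simp]: "coeffs_have_derivative (\<lambda>_. F) 0 net"
  by (simp add: coeffs_have_derivative_def)

lemma coeffs_have_derivative_add:
  assumes "coeffs_have_derivative F F' net" "coeffs_have_derivative G G' net"
  shows "coeffs_have_derivative (\<lambda>x. F x + G x) (F' + G') net"
  using assms by (auto simp: coeffs_have_derivative_def intro!: derivative_intros)

text \<open>Every coefficient of a product is a finite sum, so the product rule holds coefficient by
  coefficient and no topology on series is involved. The parameter is the polar angle at first and
  the base point of a Taylor series later.\<close>

lemma coeffs_have_derivative_mult:
  assumes "coeffs_have_derivative F F' (at x within S)"
    and "coeffs_have_derivative G G' (at x within S)"
  shows "coeffs_have_derivative (\<lambda>x. F x * G x) (F' * G x + F x * G') (at x within S)"
  unfolding coeffs_have_derivative_def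
proof
  fix i
  have "((\<lambda>x. \<Sum>k=0..i. fps_nth (F x) k * fps_nth (G x) (i - k)) has_vector_derivative
      (\<Sum>k=0..i. fps_nth (F x) k * fps_nth G' (i - k) + fps_nth F' k * fps_nth (G x) (i - k)))
      (at x within S)"
    using assms unfolding coeffs_have_derivative_def
    by (intro has_vector_derivative_sum has_vector_derivative_mult) auto
  thus "((\<lambda>x. fps_nth (F x * G x) i) has_vector_derivative
      fps_nth (F' * G x + F x * G') i) (at x within S)"
    by (simp add: fps_mult_nth sum.distrib add.commute)
qed

lemma coeffs_have_derivative_power:
  assumes "coeffs_have_derivative F F' (at x within S)"
  shows "coeffs_have_derivative (\<lambda>x. F x ^ n) (of_nat n * F' * F x ^ (n - 1)) (at x within S)"
proof (induction n)
  case 0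
  show ?case using coeffs_have_derivative_const[of 1] by simp
next
  case (Suc n)
  have "F' * F x ^ n + F x * (of_nat n * F' * F x ^ (n - 1))
      = of_nat (Suc n) * F' * F x ^ (Suc n - 1)"
    by (cases n) (simp_all add: algebra_simps)
  with coeffs_have_derivative_mult[OF assms Suc.IH] show ?case by simp
qed

text \<open>
  Goldberg's sum is, up to normalisation, the coefficient of \<open>X\<^sup>l\<^sup>+\<^sup>m\<close> in \<open>half_binom (l - s) (l + s) \<theta>\<close>. With
  \<open>A = c X - S\<close> and \<open>B = S X + c\<close>, the action of \<open>eth\<close> and \<open>eth_bar\<close> reduces to \<open>A' = - B / 2\<close>, \<open>B' = A / 2\<close>
  and \<open>X = c A + S B\<close>.
\<close>

definition half_binom :: "nat \<Rightarrow> nat \<Rightarrow> real \<Rightarrow> real fps" where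
  "half_binom a b \<theta> =
     (fps_const (cos (\<theta> / 2)) * fps_X - fps_const (sin (\<theta> / 2))) ^ a
     * (fps_const (sin (\<theta> / 2)) * fps_X + fps_const (cos (\<theta> / 2))) ^ b"

context
  fixes \<theta> :: real and A B :: "real fps"
  defines "A \<equiv> fps_const (cos (\<theta> / 2)) * fps_X - fps_const (sin (\<theta> / 2))"
    and "B \<equiv> fps_const (sin (\<theta> / 2)) * fps_X + fps_const (cos (\<theta> / 2))"
begin

lemma half_binom_eq: "half_binom a b \<theta> = A ^ a * B ^ b"
  by (simp add: half_binom_def A_def B_def)

lemma half_binom_coeffs_derivative:
  "coeffs_have_derivative (half_binom a b)
     (fps_const (1/2) * (of_nat b * half_binom (a + 1) (b - 1) \<theta>
        - of_nat a * half_binom (a - 1) (b + 1) \<theta>)) (at \<theta>)"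
proof -
  have A: "coeffs_have_derivative
      (\<lambda>\<theta>. fps_const (cos (\<theta> / 2)) * fps_X - fps_const (sin (\<theta> / 2))) (- (fps_const (1/2) * B)) (at \<theta>)"
    unfolding coeffs_have_derivative_def B_def
    by (auto simp flip: has_real_derivative_iff_has_vector_derivative
        simp: fps_X_def intro!: derivative_eq_intros)
  have B: "coeffs_have_derivative
      (\<lambda>\<theta>. fps_const (sin (\<theta> / 2)) * fps_X + fps_const (cos (\<theta> / 2))) (fps_const (1/2) * A) (at \<theta>)"
    unfolding coeffs_have_derivative_def A_def
    by (auto simp flip: has_real_derivative_iff_has_vector_derivative
        simp: fps_X_def intro!: derivative_eq_intros)
  have "coeffs_have_derivative (half_binom a b)
     (of_nat a * (- (fps_const (1/2) * B)) * A ^ (a - 1) * B ^ b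
       + A ^ a * (of_nat b * (fps_const (1/2) * A) * B ^ (b - 1))) (at \<theta>)"
    using coeffs_have_derivative_mult[OF coeffs_have_derivative_power[OF A]
        coeffs_have_derivative_power[OF B], of a b]
    by (simp add: half_binom_def[abs_def] A_def B_def)
  thus ?thesis
    by (simp add: half_binom_eq algebra_simps)
qed

text \<open>The Euler operator multiplies the coefficient of \<open>X ^ (l + m)\<close> by
  \<open>l + m\<close>; in this way the \<open>m\<close> of the azimuthal derivative enters.
  Replacing the outer \<open>X\<close> by \<open>c A + S B\<close> leads back to products of powers
  of \<open>A\<close> and \<open>B\<close>.\<close>

lemma half_binom_euler:
  "fps_X * fps_deriv (half_binom a b \<theta>) =
     fps_const (real a * (cos (\<theta> / 2))\<^sup>2 + real b * (sin (\<theta> / 2))\<^sup>2) * half_binom a b \<theta>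
     + fps_const (cos (\<theta> / 2) * sin (\<theta> / 2))
       * (of_nat a * half_binom (a - 1) (b + 1) \<theta> + of_nat b * half_binom (a + 1) (b - 1) \<theta>)"
proof -
  define c s where "c = fps_const (cos (\<theta> / 2))" and "s = fps_const (sin (\<theta> / 2))"
  have cs: "c * c + s * s = 1"
    by (simp add: c_def s_def flip: power2_eq_square)
  have "fps_X = (c * c + s * s) * (fps_X :: real fps)" by (simp add: cs)
  also have "\<dots> = c * A + s * B"
    by (simp add: A_def B_def c_def [symmetric] s_def [symmetric] algebra_simps)
  finally have X: "fps_X = c * A + s * B" .
  have dA: "fps_deriv (A ^ a) = of_nat a * c * A ^ (a - 1)"
    by (simp add: fps_deriv_power A_def c_def fps_of_nat)
  have dB: "fps_deriv (B ^ b) = of_nat b * s * B ^ (b - 1)"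
    by (simp add: fps_deriv_power B_def s_def fps_of_nat)
  have a: "of_nat a * (A * A ^ (a - 1)) = of_nat a * A ^ a" by (cases a) auto
  have b: "of_nat b * (B * B ^ (b - 1)) = of_nat b * B ^ b" by (cases b) auto
  have coef: "fps_const (real a * (cos (\<theta> / 2))\<^sup>2 + real b * (sin (\<theta> / 2))\<^sup>2)
      = of_nat a * c\<^sup>2 + of_nat b * s\<^sup>2"
    by (simp add: c_def s_def fps_const_power flip: fps_of_nat)
  have "fps_X * fps_deriv (half_binom a b \<theta>)
      = c\<^sup>2 * (of_nat a * (A * A ^ (a - 1))) * B ^ b + s\<^sup>2 * A ^ a * (of_nat b * (B * B ^ (b - 1)))
        + c * s * (of_nat a * A ^ (a - 1) * (B * B ^ b) + of_nat b * (A * A ^ a) * B ^ (b - 1))"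
    by (simp add: half_binom_eq dA dB) (simp add: X algebra_simps power2_eq_square)
  also have "\<dots> = (of_nat a * c\<^sup>2 + of_nat b * s\<^sup>2) * (A ^ a * B ^ b)
        + c * s * (of_nat a * A ^ (a - 1) * (B * B ^ b) + of_nat b * (A * A ^ a) * B ^ (b - 1))"
    unfolding a b by (simp add: algebra_simps)
  finally show ?thesis
    unfolding coef by (simp add: half_binom_eq c_def s_def mult.assoc)
qed

end

lemma half_binom_nth_derivative:
  "((\<lambda>\<theta>. fps_nth (half_binom a b \<theta>) k) has_real_derivative
     1/2 * (real b * fps_nth (half_binom (a + 1) (b - 1) \<theta>) k
       - real a * fps_nth (half_binom (a - 1) (b + 1) \<theta>) k)) (at \<theta>)"
  using half_binom_coeffs_derivative[of a b \<theta>, unfolded coeffs_have_derivative_def, rule_format, of k]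
  by (simp add: has_real_derivative_iff_has_vector_derivative flip: fps_of_nat)

text \<open>With \<open>k = l + m\<close>, \<open>a = l - s\<close>, \<open>b = l + s\<close> the
  factor on the left is \<open>2 (m + s cos \<theta>)\<close>; divided by
  \<open>2 sin \<theta>\<close> it is, up to sign, what \<open>eth\<close> and
  \<open>eth_bar\<close> add to the derivative in \<theta> of a harmonic.\<close>

lemma half_binom_nth_euler:
  "(2 * real k - real a * (1 + cos \<theta>) - real b * (1 - cos \<theta>)) * fps_nth (half_binom a b \<theta>) k =
     sin \<theta> * (real a * fps_nth (half_binom (a - 1) (b + 1) \<theta>) k
       + real b * fps_nth (half_binom (a + 1) (b - 1) \<theta>) k)"
proof -
  define t where "t = \<theta> / 2"
  have th: "cos \<theta> = 2 * (cos t)\<^sup>2 - 1" "cos \<theta> = 1 - 2 * (sin t)\<^sup>2" "sin \<theta> = 2 * sin t * cos t"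
    using cos_double_cos[of t] cos_double_sin[of t] sin_double[of t] by (simp_all add: t_def)
  have "fps_nth (fps_X * fps_deriv (half_binom a b \<theta>)) k = real k * fps_nth (half_binom a b \<theta>) k"
    by (cases k) (simp_all add: fps_X_mult_nth)
  moreover have "(of_nat n :: real fps) = fps_const (real n)" for n by (simp add: fps_of_nat)
  ultimately have e: "real k * fps_nth (half_binom a b \<theta>) k
     = (real a * (cos t)\<^sup>2 + real b * (sin t)\<^sup>2) * fps_nth (half_binom a b \<theta>) k
     + cos t * sin t * (real a * fps_nth (half_binom (a - 1) (b + 1) \<theta>) k
       + real b * fps_nth (half_binom (a + 1) (b - 1) \<theta>) k)"
    using arg_cong[OF half_binom_euler[of a b \<theta>], of "\<lambda>f. fps_nth f k"] by (simp add: t_def)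
  have "1 + cos \<theta> = 2 * (cos t)\<^sup>2" "1 - cos \<theta> = 2 * (sin t)\<^sup>2" using th(1,2) by linarith+
  thus ?thesis unfolding th(3) by (simp only:) (use e in \<open>simp add: algebra_simps\<close>)
qed

lemma half_binom_nth:
  "fps_nth (half_binom a b \<theta>) k = (\<Sum>r=0..k. real (a choose r) * cos (\<theta> / 2) ^ r
      * (- sin (\<theta> / 2)) ^ (a - r) * (real (b choose (k - r)) * sin (\<theta> / 2) ^ (k - r)
      * cos (\<theta> / 2) ^ (b - (k - r))))"
proof -
  have bin: "fps_nth ((fps_const x * fps_X + fps_const y) ^ n) j
      = real (n choose j) * x ^ j * y ^ (n - j)" for x y :: real and n j
  proof -
    have "(fps_const x * fps_X + fps_const y) ^ n
        = (\<Sum>i\<le>n. fps_const (real (n choose i) * x ^ i * y ^ (n - i)) * fps_X ^ i)"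
      by (subst binomial_ring) (simp add: power_mult_distrib fps_const_power mult_ac
          flip: fps_of_nat fps_const_mult)
    thus ?thesis
      by (simp add: fps_sum_nth fps_X_power_nth if_distrib cong: if_cong)
  qed
  show ?thesis
    using bin[of "cos (\<theta> / 2)" "- sin (\<theta> / 2)" a] bin[of "sin (\<theta> / 2)" "cos (\<theta> / 2)" b]
    by (simp add: half_binom_def fps_mult_nth flip: fps_const_neg)
qed

section \<open>Goldberg's harmonics and the action of \<open>eth\<close> and
  \<open>eth_bar\<close>\<close>

definition Y_norm :: "int \<Rightarrow> nat \<Rightarrow> int \<Rightarrow> real" where
  "Y_norm s l m = (-1) powi m
     * sqrt ((2 * real l + 1) * fact (nat (int l + m)) * fact (nat (int l - m))
             / (4 * pi * fact (nat (int l + s)) * fact (nat (int l - s))))"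

definition Y_theta :: "int \<Rightarrow> nat \<Rightarrow> int \<Rightarrow> real \<Rightarrow> real" where
  "Y_theta s l m \<theta> =
     Y_norm s l m * fps_nth (half_binom (nat (int l - s)) (nat (int l + s)) \<theta>) (nat (int l + m))"

text \<open>Goldberg's second binomial is \<open>b choose (b - (k - r))\<close>, the mirror image of
  the \<open>b choose (k - r)\<close> in the convolution of the two powers. The terms that the
  convolution has in addition contain a vanishing binomial.\<close>

lemma Y_eq:
  assumes s: "\<bar>s\<bar> \<le> int l" and m: "\<bar>m\<bar> \<le> int l"
  shows "Y s l m \<theta> \<alpha> = of_real (Y_theta s l m \<theta>) * cis (of_int m * \<alpha>)"
proof -
  define a b k where "a = nat (int l - s)" and "b = nat (int l + s)" and "k = nat (int l + m)"
  define c S where "c = cos (\<theta> / 2)" and "S = sin (\<theta> / 2)"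
  define f where "f r = real (a choose r) * c ^ r * (- S) ^ (a - r)
      * (real (b choose (k - r)) * S ^ (k - r) * c ^ (b - (k - r)))" for r
  define g where "g r = (-1) ^ nat (int l - r - s)
            * real (nat (int l - s) choose nat r) * real (nat (int l + s) choose nat (r + s - m))
            * c ^ nat (2 * r + s - m) * S ^ nat (2 * int l - 2 * r - s + m)" for r
  have "(\<Sum>r\<in>{max 0 (m - s)..min (int l - s) (int l + m)}. g r)
      = (\<Sum>r\<in>{r. r \<le> k \<and> r \<le> a \<and> k - r \<le> b}. f r)"
  proof (rule sum.reindex_bij_witness[of _ int nat])
    fix r assume r: "r \<in> {max 0 (m - s)..min (int l - s) (int l + m)}"
    then obtain r' where r': "r = int r'" by (metis atLeastAtMost_iff max.boundedE nonneg_int_cases)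
    have 1: "nat (int l - r - s) = a - r'" "nat (r + s - m) = b - (k - r')"
      "nat (2 * r + s - m) = r' + (b - (k - r'))" "nat (2 * int l - 2 * r - s + m) = (a - r') + (k - r')"
      and 2: "k - r' \<le> b"
      using r s m by (auto simp: a_def b_def k_def r' nat_diff_distrib)
    show "f (nat r) = g r"
      unfolding g_def 1 f_def using binomial_symmetric[OF 2]
      by (simp add: r' a_def [symmetric] b_def [symmetric] power_add power_minus[of S] mult_ac)
  qed (use s m in \<open>auto simp: a_def b_def k_def\<close>)
  also have "\<dots> = (\<Sum>r=0..k. f r)"
    by (rule sum.mono_neutral_left) (auto simp: f_def)
  finally have "(\<Sum>r\<in>{max 0 (m - s)..min (int l - s) (int l + m)}. g r)
      = fps_nth (half_binom a b \<theta>) k"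
    by (simp add: half_binom_nth f_def c_def S_def)
  thus ?thesis
    unfolding Y_def Y_theta_def Y_norm_def g_def c_def S_def a_def b_def k_def by simp
qed

text \<open>Attached to the pair of spin weights \<open>s\<close>, \<open>s + 1\<close> and valid in
  both directions up to sign; on weight \<open>s\<close> the operator \<open>eth_bar\<close>
  therefore carries \<open>eth_factor (s - 1)\<close>.\<close>

definition eth_factor :: "int \<Rightarrow> nat \<Rightarrow> real" where
  "eth_factor s l = sqrt (of_int ((int l - s) * (int l + s + 1)))"

text \<open>Passing to \<open>s + 1\<close> replaces \<open>(l + s)! (l - s)!\<close> under the root
  by \<open>(l + s + 1)! (l - s - 1)!\<close>, and the quotient turns the integer
  \<open>l - s\<close> brought down by differentiation into \<open>eth_factor s l\<close>. At
  \<open>s = l\<close> both sides vanish, whatever \<open>Y_norm (l + 1) l m\<close> is.\<close>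

lemma Y_norm_raise:
  assumes "\<bar>s\<bar> \<le> int l"
  shows "real (nat (int l - s)) * Y_norm s l m = eth_factor s l * Y_norm (s + 1) l m"
proof (cases "s = int l")
  case True
  thus ?thesis by (simp add: eth_factor_def)
next
  case False
  define a b where "a = nat (int l - (s + 1))" and "b = nat (int l + s)"
  define K where "K = (2 * real l + 1) * fact (nat (int l + m)) * fact (nat (int l - m)) / (4 * pi)"
  have a: "nat (int l - s) = Suc a" "nat (int l - (s + 1)) = a"
    and b: "nat (int l + s) = b" "nat (int l + (s + 1)) = Suc b"
    and ab: "int l - s = int (Suc a)" "int l + s + 1 = int (Suc b)"
    using assms False by (auto simp: a_def b_def)
  have e: "(int l - s) * (int l + s + 1) = int (Suc a * Suc b)"
    unfolding ab by (rule of_nat_mult [symmetric])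
  have "real (Suc a) * sqrt (K / (fact b * fact (Suc a)))
      = sqrt (real (Suc a) * real (Suc a)) * sqrt (K / (fact b * fact (Suc a)))"
    by simp
  also have "\<dots> = sqrt (real (Suc a * Suc b)) * sqrt (K / (fact (Suc b) * fact a))"
    unfolding real_sqrt_mult [symmetric]
    by (intro arg_cong[of _ _ sqrt]) (simp add: field_simps del: of_nat_Suc mult_Suc mult_Suc_right)
  finally have *: "real (Suc a) * sqrt (K / (fact b * fact (Suc a)))
      = sqrt (real (Suc a * Suc b)) * sqrt (K / (fact (Suc b) * fact a))" .
  have N: "Y_norm s l m = (-1) powi m * sqrt (K / (fact (nat (int l + s)) * fact (nat (int l - s))))" for s
    by (simp add: Y_norm_def K_def mult.assoc)
  thus ?thesis
    unfolding N a b eth_factor_def e of_int_of_nat_eq by (simp only: mult.left_commute[of _ "(-1) powi m"] *)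
qed

lemma Y_norm_lower:
  assumes "\<bar>s\<bar> \<le> int l"
  shows "real (nat (int l + s)) * Y_norm s l m = eth_factor (s - 1) l * Y_norm (s - 1) l m"
proof -
  have sym: "Y_norm (- s) l m = Y_norm s l m" for s by (simp add: Y_norm_def mult_ac)
  have "eth_factor (- s) l = eth_factor (s - 1) l"
    by (simp add: eth_factor_def mult.commute algebra_simps)
  with Y_norm_raise[of "- s" l m] assms sym[of s] sym[of "s - 1"] show ?thesis by simp
qed

context
  fixes s :: int and l :: nat
  assumes s: "\<bar>s\<bar> \<le> int l"
begin

lemma Y_theta_raise:
  "Y_norm s l m * (real (nat (int l - s)) *
     fps_nth (half_binom (nat (int l - s) - 1) (nat (int l + s) + 1) \<theta>) (nat (int l + m)))
   = eth_factor s l * Y_theta (s + 1) l m \<theta>"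
proof -
  have "nat (int l - s) - 1 = nat (int l - (s + 1))" "nat (int l + s) + 1 = nat (int l + (s + 1))"
    using s by auto
  thus ?thesis using Y_norm_raise[OF s, of m] by (simp add: Y_theta_def mult_ac)
qed

lemma Y_theta_lower:
  "Y_norm s l m * (real (nat (int l + s)) *
     fps_nth (half_binom (nat (int l - s) + 1) (nat (int l + s) - 1) \<theta>) (nat (int l + m)))
   = eth_factor (s - 1) l * Y_theta (s - 1) l m \<theta>"
proof -
  have "nat (int l - s) + 1 = nat (int l - (s - 1))" "nat (int l + s) - 1 = nat (int l + (s - 1))"
    using s by auto
  thus ?thesis using Y_norm_lower[OF s, of m] by (simp add: Y_theta_def mult_ac)
qed

lemma Y_theta_has_derivative:
  "(Y_theta s l m has_real_derivative
     1/2 * (eth_factor (s - 1) l * Y_theta (s - 1) l m \<theta> - eth_factor s l * Y_theta (s + 1) l m \<theta>))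
     (at \<theta>)"
  unfolding Y_theta_raise [symmetric] Y_theta_lower [symmetric]
  unfolding Y_theta_def[abs_def]
  by (rule derivative_eq_intros half_binom_nth_derivative refl)+ (simp add: algebra_simps)

text \<open>The derivative in \<theta> yields half the difference of the two neighbouring spin
  weights, this relation half their sum. Adding or subtracting isolates one neighbour, which is how
  \<open>eth\<close> and \<open>eth_bar\<close> become ladder operators.\<close>

lemma Y_theta_euler:
  assumes m: "\<bar>m\<bar> \<le> int l"
  shows "2 * (of_int m + of_int s * cos \<theta>) * Y_theta s l m \<theta> =
     sin \<theta> * (eth_factor s l * Y_theta (s + 1) l m \<theta> + eth_factor (s - 1) l * Y_theta (s - 1) l m \<theta>)"
proof -
  define h where "h = fps_nth (half_binom (nat (int l - s)) (nat (int l + s)) \<theta>) (nat (int l + m))"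
  have r: "real (nat (int l + m)) = real l + of_int m" "real (nat (int l - s)) = real l - of_int s"
    "real (nat (int l + s)) = real l + of_int s" using s m by (simp_all add: of_nat_nat)
  have "(2 * of_int m + 2 * of_int s * cos \<theta>) * h
      = (2 * real (nat (int l + m)) - real (nat (int l - s)) * (1 + cos \<theta>)
          - real (nat (int l + s)) * (1 - cos \<theta>)) * h"
    unfolding r by (simp add: algebra_simps)
  also note half_binom_nth_euler[of "nat (int l + m)" "nat (int l - s)" \<theta> "nat (int l + s)", folded h_def]
  finally have "Y_norm s l m * ((2 * of_int m + 2 * of_int s * cos \<theta>) * h) = Y_norm s l m * (sin \<theta> *
    (real (nat (int l - s)) *
       fps_nth (half_binom (nat (int l - s) - 1) (nat (int l + s) + 1) \<theta>) (nat (int l + m))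
     + real (nat (int l + s)) *
       fps_nth (half_binom (nat (int l - s) + 1) (nat (int l + s) - 1) \<theta>) (nat (int l + m))))"
    by simp
  hence "(2 * of_int m + 2 * of_int s * cos \<theta>) * (Y_norm s l m * h)
      = sin \<theta> * (Y_norm s l m * (real (nat (int l - s)) *
     fps_nth (half_binom (nat (int l - s) - 1) (nat (int l + s) + 1) \<theta>) (nat (int l + m)))
     + Y_norm s l m * (real (nat (int l + s)) *
     fps_nth (half_binom (nat (int l - s) + 1) (nat (int l + s) - 1) \<theta>) (nat (int l + m))))"
    by (simp add: algebra_simps)
  thus ?thesis unfolding Y_theta_raise Y_theta_lower by (simp add: Y_theta_def h_def algebra_simps)
qed

lemma Y_derivatives:
  assumes m: "\<bar>m\<bar> \<le> int l"
  shows "((\<lambda>x. Y s l m x \<alpha>) has_vector_derivative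
      of_real (1/2 * (eth_factor (s - 1) l * Y_theta (s - 1) l m \<theta>
         - eth_factor s l * Y_theta (s + 1) l m \<theta>)) * cis (of_int m * \<alpha>)) (at \<theta>)"
    and "((\<lambda>y. Y s l m \<theta> y) has_vector_derivative \<i> * of_int m * Y s l m \<theta> \<alpha>) (at \<alpha>)"
proof -
  show "((\<lambda>x. Y s l m x \<alpha>) has_vector_derivative
      of_real (1/2 * (eth_factor (s - 1) l * Y_theta (s - 1) l m \<theta>
         - eth_factor s l * Y_theta (s + 1) l m \<theta>)) * cis (of_int m * \<alpha>)) (at \<theta>)"
    unfolding Y_eq[OF s m]
    by (intro has_vector_derivative_mult_left has_vector_derivative_of_real)
      (use Y_theta_has_derivative in \<open>simp add: has_real_derivative_iff_has_vector_derivative\<close>)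
  have "((\<lambda>y. cis (of_int m * y)) has_vector_derivative \<i> * of_int m * cis (of_int m * \<alpha>)) (at \<alpha>)"
  proof -
    have "((\<lambda>z. exp (\<i> * of_int m * z)) has_field_derivative \<i> * of_int m * exp (\<i> * of_int m * of_real \<alpha>))
        (at (of_real \<alpha>))"
      by (auto intro!: derivative_eq_intros)
    from has_vector_derivative_real_field[OF this] show ?thesis
      by (simp add: cis_conv_exp o_def mult.assoc)
  qed
  from has_vector_derivative_mult_right[OF this, of "of_real (Y_theta s l m \<theta>)"]
  show "((\<lambda>y. Y s l m \<theta> y) has_vector_derivative \<i> * of_int m * Y s l m \<theta> \<alpha>) (at \<alpha>)"
    unfolding Y_eq[OF s m] by (simp add: mult_ac)
qed

text \<open>Stated through \<open>Y_theta\<close>, because \<open>Y_eq\<close> does not reach the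
  spin weights \<open>l + 1\<close> and \<open>- l - 1\<close>; in these cases the factor in front
  is zero.\<close>

lemma
  assumes m: "\<bar>m\<bar> \<le> int l" and \<theta>: "\<theta> \<in> {0<..<pi}"
  shows eth_Y': "eth s (Y s l m) \<theta> \<alpha> = of_real (eth_factor s l * Y_theta (s + 1) l m \<theta>) * cis (of_int m * \<alpha>)"
    and eth_bar_Y': "eth_bar s (Y s l m) \<theta> \<alpha>
      = - of_real (eth_factor (s - 1) l * Y_theta (s - 1) l m \<theta>) * cis (of_int m * \<alpha>)"
proof -
  define u where "u = eth_factor s l * Y_theta (s + 1) l m \<theta>"
  define w where "w = eth_factor (s - 1) l * Y_theta (s - 1) l m \<theta>"
  define y where "y = Y_theta s l m \<theta>"
  have sin: "sin \<theta> \<noteq> 0" using \<theta> sin_gt_zero[of \<theta>] by auto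
  have "2 * (of_int m + of_int s * cos \<theta>) * y = sin \<theta> * (u + w)"
    using Y_theta_euler[OF m, of \<theta>] by (simp add: u_def w_def y_def)
  hence e: "(of_int m / sin \<theta> + of_int s * cot \<theta>) * y = (u + w) / 2"
    using sin by (simp add: cot_def field_simps)
  have e': "complex_of_real ((u + w) / 2)
      = (of_int m / of_real (sin \<theta>) + of_int s * of_real (cot \<theta>)) * of_real y"
    unfolding e [symmetric] by simp
  have d: "vector_derivative (\<lambda>x. Y s l m x \<alpha>) (at \<theta>) = of_real (1/2 * (w - u)) * cis (of_int m * \<alpha>)"
    "vector_derivative (\<lambda>y. Y s l m \<theta> y) (at \<alpha>) = \<i> * of_int m * (of_real y * cis (of_int m * \<alpha>))"
    using Y_derivatives[OF m, THEN vector_derivative_at]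
    by (auto simp: u_def w_def y_def Y_eq[OF s m])
  have "eth s (Y s l m) \<theta> \<alpha> = - (of_real (1/2 * (w - u))
     - (of_int m / of_real (sin \<theta>) + of_int s * of_real (cot \<theta>)) * of_real y) * cis (of_int m * \<alpha>)"
    unfolding eth_def d unfolding Y_eq[OF s m] y_def [symmetric] by (simp add: field_simps)
  also have "\<dots> = of_real u * cis (of_int m * \<alpha>)"
    unfolding e' [symmetric] by (simp add: field_simps)
  finally show "eth s (Y s l m) \<theta> \<alpha>
      = of_real (eth_factor s l * Y_theta (s + 1) l m \<theta>) * cis (of_int m * \<alpha>)"
    by (simp add: u_def)
  have "eth_bar s (Y s l m) \<theta> \<alpha> = - (of_real (1/2 * (w - u))
     + (of_int m / of_real (sin \<theta>) + of_int s * of_real (cot \<theta>)) * of_real y) * cis (of_int m * \<alpha>)"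
    unfolding eth_bar_def d unfolding Y_eq[OF s m] y_def [symmetric] by (simp add: field_simps)
  also have "\<dots> = - of_real w * cis (of_int m * \<alpha>)"
    unfolding e' [symmetric] by (simp add: field_simps)
  finally show "eth_bar s (Y s l m) \<theta> \<alpha>
      = - of_real (eth_factor (s - 1) l * Y_theta (s - 1) l m \<theta>) * cis (of_int m * \<alpha>)"
    by (simp add: w_def)
qed

lemma eth_Y:
  assumes m: "\<bar>m\<bar> \<le> int l" and \<theta>: "\<theta> \<in> {0<..<pi}"
  shows "eth s (Y s l m) \<theta> \<alpha> = of_real (eth_factor s l) * Y (s + 1) l m \<theta> \<alpha>"
proof (cases "s = int l")
  case True
  thus ?thesis using eth_Y'[OF assms] by (simp add: eth_factor_def)
next
  case False
  hence "\<bar>s + 1\<bar> \<le> int l" using s by auto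
  thus ?thesis using eth_Y'[OF assms] Y_eq[OF _ m] by (simp add: mult_ac)
qed

lemma eth_bar_Y:
  assumes m: "\<bar>m\<bar> \<le> int l" and \<theta>: "\<theta> \<in> {0<..<pi}"
  shows "eth_bar s (Y s l m) \<theta> \<alpha> = - of_real (eth_factor (s - 1) l) * Y (s - 1) l m \<theta> \<alpha>"
proof (cases "s = - int l")
  case True
  thus ?thesis using eth_bar_Y'[OF assms] by (simp add: eth_factor_def)
next
  case False
  hence "\<bar>s - 1\<bar> \<le> int l" using s by auto
  thus ?thesis using eth_bar_Y'[OF assms] Y_eq[OF _ m] by (simp add: mult_ac)
qed

end

lemma continuous_Y_theta [continuous_intros]: "continuous_on S (Y_theta s l m)"
  unfolding Y_theta_def[abs_def]
  by (intro continuous_intros DERIV_continuous_on[OF has_field_derivative_at_within,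
        OF half_binom_nth_derivative])

section \<open>Orthogonality and norms in the polar angle\<close>

definition theta_inner :: "int \<Rightarrow> nat \<Rightarrow> nat \<Rightarrow> int \<Rightarrow> real" where
  "theta_inner s l l' m = integral {0..pi} (\<lambda>\<theta>. sin \<theta> * (Y_theta s l m \<theta> * Y_theta s l' m \<theta>))"

lemma theta_inner_commute: "theta_inner s l l' m = theta_inner s l' l m"
  by (simp add: theta_inner_def mult_ac)

text \<open>Adjointness of \<open>eth\<close> and \<open>- eth_bar\<close>, by integrating the
  derivative of \<open>sin \<theta> * f * g\<close>. The weights \<open>s\<close> and
  \<open>s + 1\<close> of \<open>f\<close> and \<open>g\<close> make all terms with \<open>m\<close>
  and \<open>cos \<theta>\<close> cancel, and the sine removes the boundary values.\<close>

lemma theta_inner_shift: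
  assumes s: "\<bar>s\<bar> \<le> int l" "\<bar>s + 1\<bar> \<le> int l'" and m: "\<bar>m\<bar> \<le> int l" "\<bar>m\<bar> \<le> int l'"
  shows "eth_factor s l * theta_inner (s + 1) l l' m = eth_factor s l' * theta_inner s l l' m"
proof -
  define f where "f = Y_theta s l m"
  define g where "g = Y_theta (s + 1) l' m"
  define u where "u \<theta> = eth_factor s l * (sin \<theta> * (Y_theta (s + 1) l m \<theta> * g \<theta>))" for \<theta>
  define w where "w \<theta> = eth_factor s l' * (sin \<theta> * (f \<theta> * Y_theta s l' m \<theta>))" for \<theta>
  have "((\<lambda>\<theta>. sin \<theta> * (f \<theta> * g \<theta>)) has_real_derivative (w \<theta> - u \<theta>)) (at \<theta>)" for \<theta>
  proof -
    define f' where "f' = 1/2 * (eth_factor (s - 1) l * Y_theta (s - 1) l m \<theta>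
       - eth_factor s l * Y_theta (s + 1) l m \<theta>)"
    define g' where "g' = 1/2 * (eth_factor s l' * Y_theta s l' m \<theta>
       - eth_factor (s + 1) l' * Y_theta (2 + s) l' m \<theta>)"
    have df: "(f has_real_derivative f') (at \<theta>)"
      unfolding f_def f'_def by (rule Y_theta_has_derivative[OF s(1)])
    have dg: "(g has_real_derivative g') (at \<theta>)"
      using Y_theta_has_derivative[OF s(2), of m \<theta>] by (simp add: g_def g'_def)
    have 1: "sin \<theta> * f' = (of_int m + of_int s * cos \<theta>) * f \<theta>
        - eth_factor s l * (sin \<theta> * Y_theta (s + 1) l m \<theta>)"
      using Y_theta_euler[OF s(1) m(1), of \<theta>] by (simp add: f_def f'_def algebra_simps)
    have 2: "sin \<theta> * g' = - (of_int m + of_int (s + 1) * cos \<theta>) * g \<theta>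
        + eth_factor s l' * (sin \<theta> * Y_theta s l' m \<theta>)"
      using Y_theta_euler[OF s(2) m(2), of \<theta>] by (simp add: g_def g'_def algebra_simps)
    have "w \<theta> - u \<theta> = cos \<theta> * (f \<theta> * g \<theta>) + (sin \<theta> * f') * g \<theta> + f \<theta> * (sin \<theta> * g')"
      unfolding 1 2 by (simp add: u_def w_def algebra_simps)
    thus ?thesis
      by (auto intro!: derivative_eq_intros df dg simp: algebra_simps)
  qed
  hence "((\<lambda>\<theta>. w \<theta> - u \<theta>) has_integral
      (sin pi * (f pi * g pi) - sin 0 * (f 0 * g 0))) {0..pi}"
    by (intro fundamental_theorem_of_calculus)
      (auto simp flip: has_real_derivative_iff_has_vector_derivative
        intro: has_field_derivative_at_within)
  hence "integral {0..pi} (\<lambda>\<theta>. w \<theta> - u \<theta>) = 0" by (simp add: integral_unique)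
  moreover have "w integrable_on {0..pi}" "u integrable_on {0..pi}"
    unfolding w_def u_def f_def g_def
    by (intro integrable_continuous_real continuous_intros)+
  ultimately have "integral {0..pi} u = integral {0..pi} w"
    by (simp add: integral_diff)
  thus ?thesis
    by (simp add: u_def[abs_def] w_def[abs_def] f_def g_def theta_inner_def)
qed

text \<open>The usual argument for a symmetric operator: the shift relation, used in both
  directions, multiplies the inner product by the eigenvalue \<open>(k - s) (k + s + 1)\<close> with
  \<open>k = l\<close> and with \<open>k = l'\<close> to the same effect, and these eigenvalues
  differ by \<open>(l' - l) (l' + l + 1)\<close>.\<close>

lemma theta_inner_orthogonal:
  assumes "l \<noteq> l'" "\<bar>s\<bar> \<le> int l" "\<bar>s\<bar> \<le> int l'" "\<bar>m\<bar> \<le> int l" "\<bar>m\<bar> \<le> int l'"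
  shows "theta_inner s l l' m = 0"
proof -
  have *: "theta_inner s l l' m = 0"
    if "l < l'" "\<bar>s\<bar> \<le> int l" "\<bar>m\<bar> \<le> int l" for l l'
  proof -
    have f: "(eth_factor s k)\<^sup>2 = of_int ((int k - s) * (int k + s + 1))" if "\<bar>s\<bar> \<le> int k" for k
    proof -
      have "(int k - s) * (int k + s + 1) \<ge> 0" using that by (intro mult_nonneg_nonneg) auto
      thus ?thesis unfolding eth_factor_def by (intro real_sqrt_pow2) (simp only: of_int_0_le_iff)
    qed
    have "(int l' - s) * (int l' + s + 1) > 0" using that by (intro mult_pos_pos) auto
    hence pos: "eth_factor s l' \<noteq> 0"
      by (simp only: eth_factor_def real_sqrt_eq_0_iff of_int_eq_0_iff)
    have 1: "eth_factor s l * theta_inner (s + 1) l l' m = eth_factor s l' * theta_inner s l l' m"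
      using that by (intro theta_inner_shift) auto
    show ?thesis
    proof (cases "s = int l")
      case True
      thus ?thesis using 1 pos by (simp add: eth_factor_def)
    next
      case False
      hence 2: "eth_factor s l' * theta_inner (s + 1) l l' m = eth_factor s l * theta_inner s l l' m"
        using theta_inner_shift[of s l' l m] that by (simp add: theta_inner_commute)
      have "(eth_factor s l')\<^sup>2 * theta_inner s l l' m = eth_factor s l * (eth_factor s l' * theta_inner (s + 1) l l' m)"
        using 1 by (simp add: power2_eq_square)
      also have "\<dots> = (eth_factor s l)\<^sup>2 * theta_inner s l l' m"
        using 2 by (simp add: power2_eq_square)
      finally have "((eth_factor s l')\<^sup>2 - (eth_factor s l)\<^sup>2) * theta_inner s l l' m = 0"
        by (simp add: algebra_simps)
      moreover have "(eth_factor s l')\<^sup>2 - (eth_factor s l)\<^sup>2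
          = of_int ((int l' - int l) * (int l' + int l + 1))"
        using that by (simp add: f algebra_simps)
      moreover have "\<dots> \<noteq> 0" using that by (simp only: of_int_eq_0_iff) auto
      ultimately show ?thesis by simp
    qed
  qed
  show ?thesis
  proof (cases "l < l'")
    case True
    thus ?thesis using assms by (intro *) auto
  next
    case False
    thus ?thesis using assms *[of l' l] by (simp add: theta_inner_commute)
  qed
qed

text \<open>A beta integral in the variable \<open>sin(\<theta>/2) ^ 2\<close>. The function
  \<open>2 sin(\<theta>/2) ^ (2 i + 2) cos(\<theta>/2) ^ (2 j + 2)\<close> vanishes at both ends,
  and integrating its derivative trades a squared sine for a squared cosine; hence the induction on
  \<open>i\<close> with \<open>j\<close> free.\<close>

lemma integral_sin_half_powers:
  "integral {0..pi} (\<lambda>\<theta>. sin \<theta> * (sin (\<theta> / 2) ^ (2 * i) * cos (\<theta> / 2) ^ (2 * j)))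
     = 2 * fact i * fact j / fact (i + j + 1)"
proof (induction i arbitrary: j)
  case 0
  have "((\<lambda>\<theta>. sin \<theta> * cos (\<theta> / 2) ^ (2 * j)) has_integral
      (- 2 / (real j + 1) * cos (pi / 2) ^ (2 * j + 2)
        - (- 2 / (real j + 1) * cos (0 / 2) ^ (2 * j + 2)))) {0..pi}"
  proof (rule fundamental_theorem_of_calculus)
    fix \<theta> :: real
    have "((\<lambda>\<theta>. - 2 / (real j + 1) * cos (\<theta> / 2) ^ (2 * j + 2)) has_real_derivative
        sin \<theta> * cos (\<theta> / 2) ^ (2 * j)) (at \<theta>)"
      by (rule derivative_eq_intros refl | simp)+
        (use sin_double[of "\<theta> / 2"] in \<open>simp add: field_simps\<close>)
    thus "((\<lambda>\<theta>. - 2 / (real j + 1) * cos (\<theta> / 2) ^ (2 * j + 2)) has_vector_derivative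
        sin \<theta> * cos (\<theta> / 2) ^ (2 * j)) (at \<theta> within {0..pi})"
      by (simp add: has_field_derivative_at_within flip: has_real_derivative_iff_has_vector_derivative)
  qed simp
  hence "integral {0..pi} (\<lambda>\<theta>. sin \<theta> * cos (\<theta> / 2) ^ (2 * j)) = 2 / (real j + 1)"
    by (simp add: integral_unique)
  moreover have "fact (0 + j + 1) = (real j + 1) * fact j" by (simp add: algebra_simps)
  ultimately show ?case by simp
next
  case (Suc i)
  define f where "f i j \<theta> = sin \<theta> * (sin (\<theta> / 2) ^ (2 * i) * cos (\<theta> / 2) ^ (2 * j))" for i j and \<theta> :: real
  have "((\<lambda>\<theta>. real (Suc i) * f i (Suc j) \<theta> - real (Suc j) * f (Suc i) j \<theta>) has_integral
      (2 * (sin (pi / 2) ^ (2 * Suc i) * cos (pi / 2) ^ (2 * Suc j))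
       - 2 * (sin (0 / 2) ^ (2 * Suc i) * cos (0 / 2) ^ (2 * Suc j)))) {0..pi}"
  proof (rule fundamental_theorem_of_calculus)
    fix \<theta> :: real
    have "((\<lambda>\<theta>. 2 * (sin (\<theta> / 2) ^ (2 * Suc i) * cos (\<theta> / 2) ^ (2 * Suc j))) has_real_derivative
        real (Suc i) * f i (Suc j) \<theta> - real (Suc j) * f (Suc i) j \<theta>) (at \<theta>)"
      by (rule derivative_eq_intros refl | simp)+
        (use sin_double[of "\<theta> / 2"] in \<open>simp add: f_def field_simps\<close>)
    thus "((\<lambda>\<theta>. 2 * (sin (\<theta> / 2) ^ (2 * Suc i) * cos (\<theta> / 2) ^ (2 * Suc j))) has_vector_derivative
        real (Suc i) * f i (Suc j) \<theta> - real (Suc j) * f (Suc i) j \<theta>) (at \<theta> within {0..pi})"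
      by (simp add: has_field_derivative_at_within flip: has_real_derivative_iff_has_vector_derivative)
  qed simp
  hence "integral {0..pi} (\<lambda>\<theta>. real (Suc i) * f i (Suc j) \<theta> - real (Suc j) * f (Suc i) j \<theta>) = 0"
    by (simp add: integral_unique)
  moreover have "f i j integrable_on {0..pi}" for i j
    unfolding f_def by (intro integrable_continuous_real continuous_intros) auto
  ultimately have "real (Suc j) * integral {0..pi} (f (Suc i) j)
      = real (Suc i) * integral {0..pi} (f i (Suc j))"
    by (simp add: integral_diff integrable_on_cmult_left del: of_nat_Suc)
  also have "integral {0..pi} (f i (Suc j)) = 2 * fact i * fact (Suc j) / fact (i + Suc j + 1)"
    using Suc.IH[of "Suc j"] by (simp only: f_def[abs_def])
  finally have "integral {0..pi} (f (Suc i) j) = 2 * fact (Suc i) * fact j / fact (Suc i + j + 1)"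
    by (simp del: of_nat_Suc add: field_simps)
  thus ?case by (simp only: f_def[abs_def])
qed

text \<open>At \<open>s = l\<close> the power of \<open>A\<close> is absent, so the profile is a
  single monomial in sine and cosine and its norm a beta integral. The missing \<open>2 pi\<close>
  comes from the azimuth.\<close>

lemma theta_inner_top:
  assumes m: "\<bar>m\<bar> \<le> int l"
  shows "theta_inner (int l) l l m = 1 / (2 * pi)"
proof -
  define i j where "i = nat (int l + m)" and "j = nat (int l - m)"
  have ij: "2 * l = i + j" using m by (auto simp: i_def j_def)
  have "fps_nth (half_binom 0 (2 * l) \<theta>) i = real (2 * l choose i) * sin (\<theta> / 2) ^ i * cos (\<theta> / 2) ^ j" for \<theta>
    unfolding half_binom_nth by (subst sum.remove[of _ 0]) (auto simp: ij binomial_eq_0 intro!: sum.neutral)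
  moreover have n2: "nat (int l + int l) = 2 * l" by simp
  ultimately have "Y_theta (int l) l m \<theta> = Y_norm (int l) l m
      * (real (2 * l choose i) * sin (\<theta> / 2) ^ i * cos (\<theta> / 2) ^ j)" for \<theta>
    unfolding Y_theta_def n2 i_def [symmetric] by simp
  hence "theta_inner (int l) l l m = integral {0..pi} (\<lambda>\<theta>. (Y_norm (int l) l m * real (2 * l choose i))\<^sup>2
      * (sin \<theta> * (sin (\<theta> / 2) ^ (2 * i) * cos (\<theta> / 2) ^ (2 * j))))"
    unfolding theta_inner_def by (simp add: power2_eq_square mult_ac power_mult power_even_eq)
  also have "\<dots> = (Y_norm (int l) l m)\<^sup>2 * (real (2 * l choose i))\<^sup>2 * (2 * fact i * fact j / fact (2 * l + 1))"
    by (simp add: integral_sin_half_powers ij power_mult_distrib)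
  also have "(Y_norm (int l) l m)\<^sup>2 = (2 * real l + 1) * fact i * fact j / (4 * pi * fact (2 * l))"
    
  proof -
    have "((-1 :: real) powi m)\<^sup>2 = 1" by (cases "even m") auto
    thus ?thesis
      unfolding Y_norm_def n2 i_def [symmetric] j_def [symmetric] by (simp add: power_mult_distrib)
  qed
  also have "real (2 * l choose i) = fact (2 * l) / (fact i * fact j)"
    using binomial_fact[of i "2 * l", where 'a = real] by (simp add: ij)
  finally have "theta_inner (int l) l l m = (2 * real l + 1) * fact i * fact j / (4 * pi * fact (2 * l))
      * (fact (2 * l) / (fact i * fact j))\<^sup>2 * (2 * fact i * fact j / ((2 * real l + 1) * fact (2 * l)))"
    by (simp add: algebra_simps)
  moreover have aux: "N * P * Q / (4 * pi * F) * (F / (P * Q))\<^sup>2 * (2 * P * Q / (N * F)) = 1 / (2 * pi)"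
    if "N > 0" "P > 0" "Q > 0" "F > 0" for N P Q F :: real
    using that by (simp add: power2_eq_square field_simps)
  ultimately show ?thesis using aux[of "2 * real l + 1" "fact i" "fact j" "fact (2 * l)"] by simp
qed

text \<open>For \<open>l' = l\<close> the shift relation says that the norm is the same at
  \<open>s\<close> and \<open>s + 1\<close> whenever \<open>eth_factor s l\<close> is not zero; so
  descend from \<open>s = l\<close>.\<close>

lemma theta_inner_self:
  assumes s: "\<bar>s\<bar> \<le> int l" and m: "\<bar>m\<bar> \<le> int l"
  shows "theta_inner s l l m = 1 / (2 * pi)"
proof -
  have "s \<le> int l" using s by simp
  thus ?thesis using s
  proof (induction rule: int_le_induct)
    case base
    show ?case by (rule theta_inner_top[OF m])
  next
    case (step i)
    have "eth_factor (i - 1) l * theta_inner i l l m = eth_factor (i - 1) l * theta_inner (i - 1) l l m"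
      using theta_inner_shift[of "i - 1" l l m] step m by auto
    moreover have "eth_factor (i - 1) l \<noteq> 0" using step by (auto simp: eth_factor_def)
    ultimately have "theta_inner (i - 1) l l m = theta_inner i l l m" by simp
    thus ?case using step by auto
  qed
qed

section \<open>The integral over the sphere and orthonormality\<close>

definition sphere_continuous :: "sphere_fun \<Rightarrow> bool" where
  "sphere_continuous f \<longleftrightarrow>
     continuous_on (cbox (0, 0) (pi, 2 * pi)) (\<lambda>x. f (fst x) (snd x))"

lemma open_box_eq: "box (0, 0) (pi, 2 * pi) = {0<..<pi} \<times> {0<..<2 * pi}"
  by (simp add: box_prod box_real)

text \<open>The integral runs over the open rectangle, but continuity is asked for on the closed
  one, whose compactness supplies integrability.\<close>

lemma sphere_continuous_set_integrable:
  assumes "sphere_continuous f"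
  shows "set_integrable lborel ({0<..<pi} \<times> {0<..<2 * pi})
           (\<lambda>x. of_real (sin (fst x)) * f (fst x) (snd x))"
proof -
  have "set_integrable lborel (cbox (0, 0) (pi, 2 * pi))
      (\<lambda>x. of_real (sin (fst x)) * f (fst x) (snd x))"
    unfolding set_integrable_def using assms
    by (intro borel_integrable_compact compact_cbox continuous_intros)
      (simp add: sphere_continuous_def)
  moreover have "{0<..<pi} \<times> {0<..<2 * pi} \<in> sets (lborel :: (real \<times> real) measure)"
    by (simp flip: open_box_eq)
  ultimately show ?thesis
    by (rule set_integrable_subset) (use box_subset_cbox open_box_eq in blast)
qed

lemma sphere_integral_eq:
  assumes "sphere_continuous f"
  shows "sphere_integral f =
    integral (cbox (0, 0) (pi, 2 * pi)) (\<lambda>x. of_real (sin (fst x)) * f (fst x) (snd x))"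
  unfolding sphere_integral_def
    set_borel_integral_eq_integral(2)[OF sphere_continuous_set_integrable[OF assms]]
  unfolding open_box_eq [symmetric] by (rule integral_open_interval)

lemma sphere_integral_sum:
  assumes I: "finite I" and f: "\<And>i. i \<in> I \<Longrightarrow> sphere_continuous (f i)"
  shows "sphere_integral (\<lambda>\<theta> \<alpha>. \<Sum>i\<in>I. c i * f i \<theta> \<alpha>) = (\<Sum>i\<in>I. c i * sphere_integral (f i))"
proof -
  let ?S = "cbox (0, 0) (pi, 2 * pi)"
  have f': "continuous_on ?S (\<lambda>x. f i (fst x) (snd x))" if "i \<in> I" for i
    using f[OF that] by (simp add: sphere_continuous_def)
  have "sphere_continuous (\<lambda>\<theta> \<alpha>. \<Sum>i\<in>I. c i * f i \<theta> \<alpha>)"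
    unfolding sphere_continuous_def by (intro continuous_intros f')
  hence "sphere_integral (\<lambda>\<theta> \<alpha>. \<Sum>i\<in>I. c i * f i \<theta> \<alpha>)
      = integral ?S (\<lambda>x. of_real (sin (fst x)) * (\<Sum>i\<in>I. c i * f i (fst x) (snd x)))"
    by (rule sphere_integral_eq)
  also have "\<dots> = integral ?S (\<lambda>x. \<Sum>i\<in>I. c i * (of_real (sin (fst x)) * f i (fst x) (snd x)))"
    by (simp add: sum_distrib_left mult_ac)
  also have "\<dots> = (\<Sum>i\<in>I. integral ?S (\<lambda>x. c i * (of_real (sin (fst x)) * f i (fst x) (snd x))))"
    by (intro integral_sum I integrable_continuous continuous_intros f')
  also have "\<dots> = (\<Sum>i\<in>I. c i * sphere_integral (f i))"
    by (intro sum.cong refl) (simp add: sphere_integral_eq f)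
  finally show ?thesis .
qed

lemma sphere_integral_product:
  assumes f: "continuous_on {0..pi} f" and g: "continuous_on {0..2 * pi} g"
  shows "sphere_integral (\<lambda>\<theta> \<alpha>. f \<theta> * g \<alpha>)
     = integral {0..pi} (\<lambda>\<theta>. of_real (sin \<theta>) * f \<theta>) * integral {0..2 * pi} g"
proof -
  have c: "continuous_on (cbox (0, 0) (pi, 2 * pi)) (\<lambda>x. f (fst x) * g (snd x))"
    by (intro continuous_intros continuous_on_compose2[OF f] continuous_on_compose2[OF g])
      (auto simp: cbox_Pair_eq)
  have "sphere_integral (\<lambda>\<theta> \<alpha>. f \<theta> * g \<alpha>)
     = integral (cbox (0, 0) (pi, 2 * pi)) (\<lambda>x. of_real (sin (fst x)) * (f (fst x) * g (snd x)))"
    using c by (intro sphere_integral_eq) (simp add: sphere_continuous_def)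
  also have "\<dots> = integral (cbox 0 pi) (\<lambda>\<theta>. integral (cbox 0 (2 * pi))
      (\<lambda>\<alpha>. of_real (sin \<theta>) * (f \<theta> * g \<alpha>)))"
    by (subst integral_prod_continuous) (auto intro!: continuous_intros c)
  also have "\<dots> = integral {0..pi} (\<lambda>\<theta>. (of_real (sin \<theta>) * f \<theta>) * integral {0..2 * pi} g)"
    by (simp add: mult.assoc[symmetric])
  finally show ?thesis by simp
qed

lemma integral_cis:
  "integral {0..2 * pi} (\<lambda>\<alpha>. cis (of_int k * \<alpha>)) = (if k = 0 then of_real (2 * pi) else 0)"
proof (cases "k = 0")
  case True
  thus ?thesis by (simp add: scaleR_conv_of_real)
next
  case False
  have "((\<lambda>\<alpha>. cis (of_int k * \<alpha>)) has_integral
      (cis (of_int k * (2 * pi)) / (\<i> * of_int k) - cis (of_int k * 0) / (\<i> * of_int k))) {0..2 * pi}"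
  proof (rule fundamental_theorem_of_calculus)
    fix \<alpha> :: real
    have "((\<lambda>z. exp (\<i> * of_int k * z) / (\<i> * of_int k)) has_field_derivative
        exp (\<i> * of_int k * of_real \<alpha>)) (at (of_real \<alpha>))"
      using False by (auto intro!: derivative_eq_intros)
    from has_vector_derivative_real_field[OF this]
    show "((\<lambda>\<alpha>. cis (of_int k * \<alpha>) / (\<i> * of_int k)) has_vector_derivative cis (of_int k * \<alpha>))
        (at \<alpha> within {0..2 * pi})"
      by (simp add: cis_conv_exp o_def mult.assoc)
  qed simp
  moreover have "cis (of_int k * (2 * pi)) = 1"
    using cos_int_2pin[of k] sin_int_2pin[of k] by (intro complex_eqI) (simp_all add: mult_ac)
  ultimately show ?thesis using False by (simp add: integral_unique)
qed

lemma sphere_continuous_Y_mult: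
  assumes "\<bar>s\<bar> \<le> int l" "\<bar>s\<bar> \<le> int l'" "\<bar>m\<bar> \<le> int l" "\<bar>m'\<bar> \<le> int l'"
  shows "sphere_continuous (\<lambda>\<theta> \<alpha>. cnj (Y s l m \<theta> \<alpha>) * Y s l' m' \<theta> \<alpha>)"
  unfolding sphere_continuous_def Y_eq[OF assms(1,3)] Y_eq[OF assms(2,4)] cis_conv_exp
  by (intro continuous_intros continuous_on_compose2[OF continuous_Y_theta[of UNIV]]) auto

theorem Y_orthonormal:
  assumes "\<bar>s\<bar> \<le> int l" "\<bar>s\<bar> \<le> int l'" "\<bar>m\<bar> \<le> int l" "\<bar>m'\<bar> \<le> int l'"
  shows "sphere_integral (\<lambda>\<theta> \<alpha>. cnj (Y s l m \<theta> \<alpha>) * Y s l' m' \<theta> \<alpha>)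
    = (if l = l' \<and> m = m' then 1 else 0)"
proof -
  have "cnj (Y s l m \<theta> \<alpha>) * Y s l' m' \<theta> \<alpha>
      = of_real (Y_theta s l m \<theta> * Y_theta s l' m' \<theta>) * cis (of_int (m' - m) * \<alpha>)" for \<theta> \<alpha>
    unfolding Y_eq[OF assms(1,3)] Y_eq[OF assms(2,4)]
    by (simp add: cis_cnj cis_mult algebra_simps)
  hence "sphere_integral (\<lambda>\<theta> \<alpha>. cnj (Y s l m \<theta> \<alpha>) * Y s l' m' \<theta> \<alpha>)
    = integral {0..pi} (\<lambda>\<theta>. of_real (sin \<theta>) * of_real (Y_theta s l m \<theta> * Y_theta s l' m' \<theta>))
      * (if m' - m = 0 then of_real (2 * pi) else 0)"
    unfolding integral_cis [symmetric]
    by (subst sphere_integral_product [symmetric])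
      (auto intro!: continuous_intros simp: cis_conv_exp)
  also have "(\<lambda>\<theta>. of_real (sin \<theta>) * of_real (Y_theta s l m \<theta> * Y_theta s l' m' \<theta>))
      = (\<lambda>\<theta>. complex_of_real (sin \<theta> * (Y_theta s l m \<theta> * Y_theta s l' m' \<theta>)))"
    by simp
  also have "integral {0..pi} \<dots> = of_real (integral {0..pi}
      (\<lambda>\<theta>. sin \<theta> * (Y_theta s l m \<theta> * Y_theta s l' m' \<theta>)))"
    by (rule integral_linear[OF _ bounded_linear_of_real, unfolded o_def])
      (auto intro!: integrable_continuous_real continuous_intros)
  finally have e: "sphere_integral (\<lambda>\<theta> \<alpha>. cnj (Y s l m \<theta> \<alpha>) * Y s l' m' \<theta> \<alpha>)
    = of_real (integral {0..pi} (\<lambda>\<theta>. sin \<theta> * (Y_theta s l m \<theta> * Y_theta s l' m' \<theta>)))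
      * (if m' - m = 0 then of_real (2 * pi) else 0)" .
  show ?thesis
  proof (cases "m = m'")
    case True
    show ?thesis
      using e theta_inner_self[OF assms(1,3)] theta_inner_orthogonal[of l l' s m] assms True
      by (auto simp: theta_inner_def)
  qed (use e in simp)
qed

corollary sphere_integral_Y_sum:
  assumes I: "finite I" "\<And>l' m'. (l', m') \<in> I \<Longrightarrow> \<bar>s\<bar> \<le> int l' \<and> \<bar>m'\<bar> \<le> int l'"
    and "\<bar>s\<bar> \<le> int l" "\<bar>m\<bar> \<le> int l"
  shows "sphere_integral (\<lambda>\<theta> \<alpha>. cnj (Y s l m \<theta> \<alpha>) * (\<Sum>(l', m')\<in>I. c l' m' * Y s l' m' \<theta> \<alpha>))
    = (if (l, m) \<in> I then c l m else 0)"
proof -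
  have "sphere_integral (\<lambda>\<theta> \<alpha>. cnj (Y s l m \<theta> \<alpha>) * (\<Sum>(l', m')\<in>I. c l' m' * Y s l' m' \<theta> \<alpha>))
    = sphere_integral (\<lambda>\<theta> \<alpha>. \<Sum>i\<in>I. c (fst i) (snd i) *
         (cnj (Y s l m \<theta> \<alpha>) * Y s (fst i) (snd i) \<theta> \<alpha>))"
    by (simp add: sum_distrib_left case_prod_beta mult_ac)
  also have "\<dots> = (\<Sum>i\<in>I. c (fst i) (snd i) *
      sphere_integral (\<lambda>\<theta> \<alpha>. cnj (Y s l m \<theta> \<alpha>) * Y s (fst i) (snd i) \<theta> \<alpha>))"
    by (rule sphere_integral_sum) (use assms in \<open>auto intro!: sphere_continuous_Y_mult\<close>)
  also have "\<dots> = (\<Sum>i\<in>I. if (l, m) = i then c l m else 0)"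
    by (intro sum.cong refl, subst Y_orthonormal) (use assms in auto)
  finally show ?thesis using I by simp
qed

lemma Y_sum_eq_0D:
  assumes I: "finite I" "\<And>l' m'. (l', m') \<in> I \<Longrightarrow> \<bar>s\<bar> \<le> int l' \<and> \<bar>m'\<bar> \<le> int l'"
    and "(l, m) \<in> I"
    and z: "\<And>\<theta> \<alpha>. \<theta> \<in> {0<..<pi} \<Longrightarrow> (\<Sum>(l', m')\<in>I. c l' m' * Y s l' m' \<theta> \<alpha>) = 0"
  shows "c l m = 0"
proof -
  have "sphere_integral (\<lambda>\<theta> \<alpha>. cnj (Y s l m \<theta> \<alpha>) * (\<Sum>(l', m')\<in>I. c l' m' * Y s l' m' \<theta> \<alpha>))
    = sphere_integral (\<lambda>\<theta> \<alpha>. 0)"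
    unfolding sphere_integral_def set_lebesgue_integral_def
    by (rule Bochner_Integration.integral_cong) (auto simp: indicator_def z)
  also have "\<dots> = 0" by (simp add: sphere_integral_def set_lebesgue_integral_def)
  finally show ?thesis
    using sphere_integral_Y_sum[OF I, of l m c] assms by auto
qed

subsection \<open>Termwise differentiation and the mode equations\<close>

text \<open>Only real arguments \<open>x \<ge> 0\<close> are at hand. Once the lower coefficients
  are known to vanish, division by \<open>x ^ p\<close> leaves a series that is zero for
  \<open>0 < x < r\<close>; its limit at 0, taken along the points \<open>r / (n + 2)\<close>, is
  \<open>c p\<close>.\<close>

lemma powser_eq_0D:
  fixes c :: "nat \<Rightarrow> complex"
  assumes r: "r > 0" and c: "\<And>x. 0 \<le> x \<Longrightarrow> x < r \<Longrightarrow> (\<lambda>p. c p * of_real (x ^ p)) sums 0"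
  shows "c p = 0"
proof (induction p rule: less_induct)
  case (less p)
  have s0: "(\<lambda>j. c (j + p) * of_real (x ^ j)) sums 0" if "0 < x" "x < r" for x
  proof -
    have "(\<lambda>j. c (j + p) * of_real (x ^ (j + p))) sums 0"
      using c[of x] that less by (subst sums_iff_shift) (simp add: sum.neutral)
    from sums_mult[OF this, of "inverse (of_real (x ^ p))"] show ?thesis
      using that by (simp add: power_add field_simps)
  qed
  define f where "f z = (\<Sum>j. c (j + p) * z ^ j)" for z
  have "(f \<longlongrightarrow> c (0 + p)) (at 0)"
  proof (rule powser_limit_0)
    show "r / 2 > 0" using r by simp
    show "(\<lambda>j. c (j + p) * z ^ j) sums f z" if "norm z < r / 2" for z
      unfolding f_def
    proof (rule summable_sums, rule powser_inside)
      show "summable (\<lambda>j. c (j + p) * of_real (r / 2) ^ j)"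
        using s0[of "r / 2"] r by (auto simp: sums_iff)
      show "norm z < norm (complex_of_real (r / 2))" using that r by (simp add: norm_of_real)
    qed
  qed
  moreover have "filterlim (\<lambda>n. complex_of_real (r / real (n + 2))) (at 0) sequentially"
  proof -
    have "(\<lambda>n. r / real (n + 2)) \<longlonglongrightarrow> 0"
      using LIMSEQ_ignore_initial_segment[OF lim_const_over_n[of r], of 2] by simp
    from tendsto_of_real[OF this, where 'a = complex] show ?thesis
      unfolding filterlim_at using r by (intro conjI always_eventually allI) (simp_all only: of_real_eq_0_iff, simp_all)
  qed
  ultimately have "(\<lambda>n. f (of_real (r / real (n + 2)))) \<longlonglongrightarrow> c p"
    using filterlim_compose by fastforce
  moreover have "f (of_real (r / real (n + 2))) = 0" for n
    using s0[of "r / real (n + 2)"] r unfolding f_def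
    by (auto simp: sums_iff divide_less_eq simp del: of_real_divide)
  ultimately show "c p = 0" by (simp add: LIMSEQ_const_iff)
qed

text \<open>Everything is relative to \<open>S\<close>, so that the one-sided derivatives at
  \<open>\<tau> = -1\<close>, \<open>\<tau> = 1\<close> and \<open>\<rho> = 0\<close> are
  covered.\<close>

lemma sums_has_vector_derivative:
  fixes f f' :: "nat \<Rightarrow> real \<Rightarrow> 'a::banach"
  assumes S: "convex S"
    and f: "\<And>p x. x \<in> S \<Longrightarrow> (f p has_vector_derivative f' p x) (at x within S)"
    and u: "uniformly_convergent_on S (\<lambda>N x. \<Sum>p<N. f' p x)"
    and F: "\<And>x. x \<in> S \<Longrightarrow> (\<lambda>p. f p x) sums F x"
    and x: "x \<in> S"
  shows "(F has_vector_derivative (\<Sum>p. f' p x)) (at x within S)"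
    and "(\<lambda>p. f' p x) sums (\<Sum>p. f' p x)"
proof -
  from u obtain G where G: "uniform_limit S (\<lambda>N x. \<Sum>p<N. f' p x) G sequentially"
    unfolding uniformly_convergent_on_def by blast
  have sG: "(\<lambda>p. f' p y) sums G y" if "y \<in> S" for y
    using tendsto_uniform_limitI[OF G that] by (simp add: sums_def)
  have "\<exists>g. \<forall>x\<in>S. (\<lambda>n. f n x) sums g x \<and> (g has_derivative (\<lambda>h. h *\<^sub>R G x)) (at x within S)"
  proof (rule has_derivative_series[OF S])
    show "(f n has_derivative (\<lambda>h. h *\<^sub>R f' n y)) (at y within S)" if "y \<in> S" for n y
      using f[OF that, of n] by (simp add: has_vector_derivative_def)
    show "\<forall>\<^sub>F n in sequentially. \<forall>y\<in>S. \<forall>h. norm ((\<Sum>i<n. h *\<^sub>R f' i y) - h *\<^sub>R G y) \<le> e * norm h"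
      if "e > 0" for e :: real
      using uniform_limitD[OF G that]
    proof eventually_elim
      case (elim n)
      show ?case
      proof (intro ballI allI)
        fix y h assume "y \<in> S"
        hence "norm ((\<Sum>i<n. f' i y) - G y) \<le> e" using elim by (auto simp: dist_norm)
        thus "norm ((\<Sum>i<n. h *\<^sub>R f' i y) - h *\<^sub>R G y) \<le> e * norm h"
          by (simp add: mult.commute[of e] mult_left_mono
              flip: scaleR_sum_right scaleR_right_diff_distrib)
      qed
    qed
  qed (use x F in auto)
  then obtain g where g: "\<And>y. y \<in> S \<Longrightarrow> (\<lambda>n. f n y) sums g y"
    "\<And>y. y \<in> S \<Longrightarrow> (g has_derivative (\<lambda>h. h *\<^sub>R G y)) (at y within S)" by blast
  have "F y = g y" if "y \<in> S" for y using sums_unique2 F g(1) that by blast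
  hence "(F has_vector_derivative G x) (at x within S)"
    unfolding has_vector_derivative_def using g(2)[OF x] x
    by (intro has_derivative_transform[OF x, of F g]) auto
  thus "(F has_vector_derivative (\<Sum>p. f' p x)) (at x within S)"
    using sG[OF x] by (simp add: sums_iff)
  show "(\<lambda>p. f' p x) sums (\<Sum>p. f' p x)" using sG[OF x] by (simp add: sums_iff)
qed

lemma uniformly_convergent_on_compose_set:
  assumes "uniformly_convergent_on D f" "g ` S \<subseteq> D"
  shows "uniformly_convergent_on S (\<lambda>N x. f N (g x))"
proof -
  from assms(1) obtain l where l: "uniform_limit D f l sequentially"
    unfolding uniformly_convergent_on_def by blast
  have "uniform_limit S (\<lambda>N x. f N (g x)) (\<lambda>x. l (g x)) sequentially"
    unfolding uniform_limit_iff
  proof (intro allI impI)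
    fix e :: real assume "e > 0"
    from uniform_limitD[OF l this] show "\<forall>\<^sub>F N in sequentially. \<forall>x\<in>S. dist (f N (g x)) (l (g x)) < e"
      by eventually_elim (use assms(2) in auto)
  qed
  thus ?thesis unfolding uniformly_convergent_on_def by blast
qed

lemma uniformly_convergent_on_add:
  fixes f g :: "nat \<Rightarrow> 'a \<Rightarrow> 'b::real_normed_vector"
  assumes "uniformly_convergent_on S f" "uniformly_convergent_on S g"
  shows "uniformly_convergent_on S (\<lambda>N x. f N x + g N x)"
  using assms unfolding uniformly_convergent_on_def by (blast intro: uniform_limit_add)

lemma uniformly_convergent_on_bounded_mult:
  fixes c :: "'a \<Rightarrow> 'b::real_normed_algebra"
  assumes u: "uniformly_convergent_on S f" and c: "bounded (c ` S)"
  shows "uniformly_convergent_on S (\<lambda>N x. c x * f N x)"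
proof -
  from u obtain l where l: "uniform_limit S f l sequentially"
    unfolding uniformly_convergent_on_def by blast
  from c obtain B where B: "B > 0" "\<And>x. x \<in> S \<Longrightarrow> norm (c x) \<le> B"
    unfolding bounded_pos by blast
  have "uniform_limit S (\<lambda>N x. c x * f N x) (\<lambda>x. c x * l x) sequentially"
    unfolding uniform_limit_iff
  proof (intro allI impI)
    fix e :: real assume "e > 0"
    hence "e / B > 0" using B by simp
    from uniform_limitD[OF l this]
    show "\<forall>\<^sub>F N in sequentially. \<forall>x\<in>S. dist (c x * f N x) (c x * l x) < e"
    proof eventually_elim
      case (elim N)
      show ?case
      proof
        fix x assume x: "x \<in> S"
        have "dist (c x * f N x) (c x * l x) \<le> norm (c x) * norm (f N x - l x)"
          unfolding dist_norm right_diff_distrib [symmetric] by (rule norm_mult_ineq)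
        also have "\<dots> \<le> B * norm (f N x - l x)"
          by (intro mult_right_mono B x) simp
        also have "\<dots> < e" using elim x B by (simp add: dist_norm field_simps)
        finally show "dist (c x * f N x) (c x * l x) < e" .
      qed
    qed
  qed
  thus ?thesis unfolding uniformly_convergent_on_def by blast
qed

lemma higher_deriv_power:
  "(deriv ^^ j) (\<lambda>r :: real. r ^ p) = (\<lambda>r. fact j * real (p choose j) * r ^ (p - j))"
proof (induction j)
  case (Suc j)
  have "deriv (\<lambda>r. fact j * real (p choose j) * r ^ (p - j)) r
      = fact (Suc j) * real (p choose Suc j) * r ^ (p - Suc j)" for r :: real
  proof -
    have "deriv (\<lambda>r. fact j * real (p choose j) * r ^ (p - j)) r
       = fact j * real ((p choose j) * (p - j)) * r ^ (p - Suc j)"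
      by (rule DERIV_imp_deriv) (auto intro!: derivative_eq_intros)
    also have "(p choose j) * (p - j) = Suc j * (p choose Suc j)"
      by (metis binomial_absorb_comp binomial_absorption mult.commute)
    finally show ?thesis unfolding of_nat_mult by (simp only: fact_Suc of_nat_mult mult_ac of_nat_fact)
  qed
  with Suc show ?case by (simp del: fact_Suc)
qed simp

section \<open>Termwise derivatives of the expansion\<close>

definition modes :: "nat \<Rightarrow> nat \<Rightarrow> (nat \<times> int) set" where
  "modes k p = (SIGMA l:{k..p}. {- int l..int l})"

lemma finite_modes [simp]: "finite (modes k p)" by (simp add: modes_def)

lemma modes_iff [simp]: "(l, m) \<in> modes k p \<longleftrightarrow> k \<le> l \<and> l \<le> p \<and> \<bar>m\<bar> \<le> int l"
  by (auto simp: modes_def)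

text \<open>The component of spin weight 0 starts at \<open>l = 0\<close>, the other two at
  \<open>l = 1\<close>. As \<open>eth_factor 0 0 = 0\<close>, the operators \<open>eth\<close> and
  \<open>eth_bar\<close> do not see the difference, and the sums in one field equation can be given
  a common index set.\<close>

lemma modes_sum_mono:
  assumes "k' \<le> k" and "\<And>l m. l < k \<Longrightarrow> f l m = 0"
  shows "(\<Sum>(l, m)\<in>modes k p. f l m) = (\<Sum>(l, m)\<in>modes k' p. f l m)"
  using assms by (intro sum.mono_neutral_left) (auto simp: not_le)

lemma expansion_term_eq:
  "expansion_term a n i j w p \<tau> \<rho> \<theta> \<alpha> = (\<Sum>(l, m)\<in>modes (nat \<bar>spin n\<bar>) p.
     1 / fact p * (d1_tau ^^ i) (a n p l m) \<tau>
     * ang_deriv w (spin n) (Y (spin n) l m) \<theta> \<alpha>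
     * of_real (fact j * real (p choose j) * \<rho> ^ (p - j)))"
  unfolding expansion_term_def modes_def higher_deriv_power by (rule sum.Sigma) auto

locale expansion =
  fixes \<phi> :: field and \<rho>\<^sub>0 :: real and a :: coeffs
  assumes rho0: "\<rho>\<^sub>0 > 0" and expansion: "has_expansion \<phi> \<rho>\<^sub>0 a"
begin

lemma spin_bounds:
  assumes "n \<le> 2" "(l, m) \<in> modes (nat \<bar>spin n\<bar>) p"
  shows "\<bar>spin n\<bar> \<le> int l" "\<bar>m\<bar> \<le> int l" "l \<in> {nat \<bar>spin n\<bar>..p}" "m \<in> {- int l..int l}"
  using assms by auto

lemma coeff_has_derivative:
  assumes "n \<le> 2" "(l, m) \<in> modes (nat \<bar>spin n\<bar>) p" "\<tau> \<in> {-1..1}"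
  shows "((d1_tau ^^ i) (a n p l m) has_vector_derivative (d1_tau ^^ Suc i) (a n p l m) \<tau>)
    (at \<tau> within {-1..1})"
proof -
  have "(d1_tau ^^ i) (a n p l m) differentiable (at \<tau> within {-1..1})"
    using expansion assms spin_bounds(3,4)[OF assms(1,2)]
    unfolding has_expansion_def differentiable_on_def by blast
  thus ?thesis by (simp add: vector_derivative_works d1_tau_def)
qed

lemma expansion_term_tau_derivative:
  assumes "n \<le> 2" "\<tau> \<in> {-1..1}"
  shows "((\<lambda>t. expansion_term a n i j w p t \<rho> \<theta> \<alpha>) has_vector_derivative
    expansion_term a n (Suc i) j w p \<tau> \<rho> \<theta> \<alpha>) (at \<tau> within {-1..1})"
  unfolding expansion_term_eq case_prod_beta
  by (intro has_vector_derivative_sum has_vector_derivative_mult_left has_vector_derivative_mult_right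
      coeff_has_derivative) (use assms in auto)

lemma expansion_term_rho_derivative:
  "((\<lambda>r. expansion_term a n i j w p \<tau> r \<theta> \<alpha>) has_vector_derivative
    expansion_term a n i (Suc j) w p \<tau> \<rho> \<theta> \<alpha>) (at \<rho> within S)"
proof -
  have "((\<lambda>r. fact j * real (p choose j) * r ^ (p - j)) has_real_derivative
      fact (Suc j) * real (p choose Suc j) * \<rho> ^ (p - Suc j)) (at \<rho> within S)"
  proof -
    have "(p choose j) * (p - j) = Suc j * (p choose Suc j)"
      by (metis binomial_absorb_comp binomial_absorption mult.commute)
    hence "real (p choose j) * real (p - j) = real (Suc j) * real (p choose Suc j)"
      by (metis of_nat_mult)
    thus ?thesis by (auto intro!: derivative_eq_intros simp: mult_ac)
  qed
  thus ?thesis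
    unfolding expansion_term_eq case_prod_beta
    by (intro has_vector_derivative_sum has_vector_derivative_mult_right has_vector_derivative_of_real)
      (simp add: has_real_derivative_iff_has_vector_derivative)
qed

text \<open>Uniform convergence is assumed for words in \<open>eth\<close> and
  \<open>eth_bar\<close>, so the coordinate derivatives are expressed by these: minus half their sum
  is the derivative in \<theta>, and their difference gives the one in \<alpha>, up to a multiple of
  the function itself.\<close>

lemma expansion_term_theta_derivative:
  assumes "n \<le> 2"
  shows "((\<lambda>x. expansion_term a n i j [] p \<tau> \<rho> x \<alpha>) has_vector_derivative
    - (expansion_term a n i j [True] p \<tau> \<rho> \<theta> \<alpha> + expansion_term a n i j [False] p \<tau> \<rho> \<theta> \<alpha>) / 2)
    (at \<theta> within S)"
proof -
  define A where "A l m = 1 / fact p * (d1_tau ^^ i) (a n p l m) \<tau>" for l m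
  define B where "B = complex_of_real (fact j * real (p choose j) * \<rho> ^ (p - j))"
  have dY: "((\<lambda>x. Y (spin n) l m x \<alpha>) has_vector_derivative vector_derivative (\<lambda>x. Y (spin n) l m x \<alpha>) (at \<theta>)) (at \<theta> within S)"
    if "(l, m) \<in> modes (nat \<bar>spin n\<bar>) p" for l m
    using Y_derivatives(1)[OF spin_bounds(1,2)[OF assms(1) that]]
    by (metis vector_derivative_at has_vector_derivative_at_within)
  have "((\<lambda>x. expansion_term a n i j [] p \<tau> \<rho> x \<alpha>) has_vector_derivative
      (\<Sum>(l, m)\<in>modes (nat \<bar>spin n\<bar>) p. A l m * vector_derivative (\<lambda>x. Y (spin n) l m x \<alpha>) (at \<theta>) * B))
      (at \<theta> within S)"
    unfolding expansion_term_eq case_prod_beta A_def B_def ang_deriv.simps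
    by (intro has_vector_derivative_sum has_vector_derivative_mult_left has_vector_derivative_mult_right)
      (use dY in auto)
  also have "(\<Sum>(l, m)\<in>modes (nat \<bar>spin n\<bar>) p.
        A l m * vector_derivative (\<lambda>x. Y (spin n) l m x \<alpha>) (at \<theta>) * B)
      = (\<Sum>(l, m)\<in>modes (nat \<bar>spin n\<bar>) p. - (A l m * eth (spin n) (Y (spin n) l m) \<theta> \<alpha> * B
          + A l m * eth_bar (spin n) (Y (spin n) l m) \<theta> \<alpha> * B) / 2)"
    by (intro sum.cong refl) (auto simp: eth_def eth_bar_def algebra_simps)
  also have "\<dots> = - (expansion_term a n i j [True] p \<tau> \<rho> \<theta> \<alpha> + expansion_term a n i j [False] p \<tau> \<rho> \<theta> \<alpha>) / 2"
    unfolding expansion_term_eq A_def [symmetric] B_def [symmetric]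
    by (simp add: case_prod_beta sum_negf sum.distrib sum_subtractf flip: sum_divide_distrib)
  finally show ?thesis .
qed

lemma expansion_term_phi_derivative:
  assumes "n \<le> 2" and \<theta>: "\<theta> \<in> {0<..<pi}"
  shows "((\<lambda>y. expansion_term a n i j [] p \<tau> \<rho> \<theta> y) has_vector_derivative
    of_real (sin \<theta>) / (2 * \<i>) * (2 * of_int (spin n) * of_real (cot \<theta>) * expansion_term a n i j [] p \<tau> \<rho> \<theta> \<alpha>
       - (expansion_term a n i j [True] p \<tau> \<rho> \<theta> \<alpha> - expansion_term a n i j [False] p \<tau> \<rho> \<theta> \<alpha>)))
    (at \<alpha> within S)"
proof -
  define A where "A l m = 1 / fact p * (d1_tau ^^ i) (a n p l m) \<tau>" for l m
  define B where "B = complex_of_real (fact j * real (p choose j) * \<rho> ^ (p - j))"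
  define C where "C = complex_of_real (sin \<theta>) / (2 * \<i>)"
  define D where "D = 2 * of_int (spin n) * complex_of_real (cot \<theta>)"
  have sin: "sin \<theta> \<noteq> 0" using \<theta> sin_gt_zero[of \<theta>] by auto
  have dY: "((\<lambda>y. Y (spin n) l m \<theta> y) has_vector_derivative vector_derivative (\<lambda>y. Y (spin n) l m \<theta> y) (at \<alpha>)) (at \<alpha> within S)"
    if "(l, m) \<in> modes (nat \<bar>spin n\<bar>) p" for l m
    using Y_derivatives(2)[OF spin_bounds(1,2)[OF assms(1) that]]
    by (metis vector_derivative_at has_vector_derivative_at_within)
  have "((\<lambda>y. expansion_term a n i j [] p \<tau> \<rho> \<theta> y) has_vector_derivative
      (\<Sum>(l, m)\<in>modes (nat \<bar>spin n\<bar>) p. A l m * vector_derivative (\<lambda>y. Y (spin n) l m \<theta> y) (at \<alpha>) * B))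
      (at \<alpha> within S)"
    unfolding expansion_term_eq case_prod_beta A_def B_def ang_deriv.simps
    by (intro has_vector_derivative_sum has_vector_derivative_mult_left has_vector_derivative_mult_right)
      (use dY in auto)
  also have "(\<Sum>(l, m)\<in>modes (nat \<bar>spin n\<bar>) p.
        A l m * vector_derivative (\<lambda>y. Y (spin n) l m \<theta> y) (at \<alpha>) * B)
      = (\<Sum>(l, m)\<in>modes (nat \<bar>spin n\<bar>) p. C * (D * (A l m * Y (spin n) l m \<theta> \<alpha> * B)
          - (A l m * eth (spin n) (Y (spin n) l m) \<theta> \<alpha> * B
            - A l m * eth_bar (spin n) (Y (spin n) l m) \<theta> \<alpha> * B)))"
  proof (intro sum.cong refl, clarify)
    fix l m
    have *: "vector_derivative (\<lambda>y. Y (spin n) l m \<theta> y) (at \<alpha>) = C * (D * Y (spin n) l m \<theta> \<alpha>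
        - (eth (spin n) (Y (spin n) l m) \<theta> \<alpha> - eth_bar (spin n) (Y (spin n) l m) \<theta> \<alpha>))"
      using sin by (simp add: eth_def eth_bar_def C_def D_def field_simps)
    show "A l m * vector_derivative (\<lambda>y. Y (spin n) l m \<theta> y) (at \<alpha>) * B
      = C * (D * (A l m * Y (spin n) l m \<theta> \<alpha> * B) - (A l m * eth (spin n) (Y (spin n) l m) \<theta> \<alpha> * B
            - A l m * eth_bar (spin n) (Y (spin n) l m) \<theta> \<alpha> * B))"
      unfolding * by (simp add: algebra_simps)
  qed
  also have "\<dots> = C * (D * expansion_term a n i j [] p \<tau> \<rho> \<theta> \<alpha>
       - (expansion_term a n i j [True] p \<tau> \<rho> \<theta> \<alpha> - expansion_term a n i j [False] p \<tau> \<rho> \<theta> \<alpha>))"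
    unfolding expansion_term_eq A_def [symmetric] B_def [symmetric]
    by (simp add: case_prod_beta sum_subtractf flip: sum_distrib_left)
  finally show ?thesis by (simp add: C_def D_def)
qed

lemma uniformly_convergent_expansion:
  assumes "n \<le> 2" "R < \<rho>\<^sub>0" "g ` S \<subseteq> {-1..1} \<times> {0..R} \<times> {0<..<pi} \<times> UNIV"
  shows "uniformly_convergent_on S
    (\<lambda>N x. case g x of (\<tau>, \<rho>, \<theta>, \<alpha>) \<Rightarrow> \<Sum>p<N. expansion_term a n i j w p \<tau> \<rho> \<theta> \<alpha>)"
  using expansion assms unfolding has_expansion_def
  by (intro uniformly_convergent_on_compose_set[OF _ assms(3)]) auto

lemma sums_phi:
  assumes "n \<le> 2" "\<tau> \<in> {-1..1}" "\<rho> \<in> {0..<\<rho>\<^sub>0}" "\<theta> \<in> {0<..<pi}"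
  shows "(\<lambda>p. expansion_term a n 0 0 [] p \<tau> \<rho> \<theta> \<alpha>) sums \<phi> n \<tau> \<rho> \<theta> \<alpha>"
  using expansion assms unfolding has_expansion_def by blast

lemma summable_expansion:
  assumes "n \<le> 2" "\<tau> \<in> {-1..1}" "\<rho> \<in> {0..<\<rho>\<^sub>0}" "\<theta> \<in> {0<..<pi}"
  shows "summable (\<lambda>p. expansion_term a n i j w p \<tau> \<rho> \<theta> \<alpha>)"
proof -
  have "uniformly_convergent_on {(\<tau>, \<rho>, \<theta>, \<alpha>)}
      (\<lambda>N x. case x of (\<tau>, \<rho>, \<theta>, \<alpha>) \<Rightarrow> \<Sum>p<N. expansion_term a n i j w p \<tau> \<rho> \<theta> \<alpha>)"
    using uniformly_convergent_expansion[of n \<rho> id "{(\<tau>, \<rho>, \<theta>, \<alpha>)}"] assms by simp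
  thus ?thesis
    by (auto simp: uniformly_convergent_on_def summable_def sums_def dest!: tendsto_uniform_limitI)
qed

context
  fixes n :: nat and \<tau> \<rho> \<theta> \<alpha> :: real
  assumes n: "n \<le> 2" and \<tau>: "\<tau> \<in> {-1..1}" and \<rho>: "\<rho> \<in> {0..<\<rho>\<^sub>0}" and \<theta>: "\<theta> \<in> {0<..<pi}"
begin

lemma sums_d_tau:
  "(\<lambda>p. expansion_term a n 1 0 [] p \<tau> \<rho> \<theta> \<alpha>) sums d_tau (\<lambda>t r. \<phi> n t r \<theta> \<alpha>) \<tau> \<rho>"
proof -
  have u: "uniformly_convergent_on {-1..1} (\<lambda>N t. \<Sum>p<N. expansion_term a n (Suc 0) 0 [] p t \<rho> \<theta> \<alpha>)"
    using uniformly_convergent_expansion[OF n, of \<rho> "\<lambda>t. (t, \<rho>, \<theta>, \<alpha>)" "{-1..1}" "Suc 0" 0 "[]"] \<rho> \<theta>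
    by (simp add: image_subset_iff)
  note d = sums_has_vector_derivative[OF convex_real_interval(5) expansion_term_tau_derivative[OF n] u
      sums_phi[OF n _ \<rho> \<theta>] \<tau>]
  have "d_tau (\<lambda>t r. \<phi> n t r \<theta> \<alpha>) \<tau> \<rho> = (\<Sum>p. expansion_term a n (Suc 0) 0 [] p \<tau> \<rho> \<theta> \<alpha>)"
    unfolding d_tau_def using d(1) \<tau> by (intro vector_derivative_within_closed_interval) auto
  with d(2) show ?thesis by simp
qed

lemma sums_d_rho:
  "(\<lambda>p. expansion_term a n 0 1 [] p \<tau> \<rho> \<theta> \<alpha>) sums d_rho (\<lambda>t r. \<phi> n t r \<theta> \<alpha>) \<tau> \<rho>"
proof -
  \<comment> \<open>Uniform convergence is available only on \<open>{0..R}\<close> with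
    \<open>R < \<rho>\<^sub>0\<close>. Since \<open>\<rho> < R\<close>, the derivative within
    \<open>{0..}\<close> at \<open>\<rho>\<close> is the one within \<open>{0..R}\<close>.\<close>
  obtain R where R: "\<rho> < R" "R < \<rho>\<^sub>0" using \<rho> dense by force
  have u: "uniformly_convergent_on {0..R} (\<lambda>N r. \<Sum>p<N. expansion_term a n 0 (Suc 0) [] p \<tau> r \<theta> \<alpha>)"
    using uniformly_convergent_expansion[OF n, of R "\<lambda>r. (\<tau>, r, \<theta>, \<alpha>)" "{0..R}" 0 "Suc 0" "[]"] R \<tau> \<theta>
    by (simp add: image_subset_iff)
  have r: "\<rho> \<in> {0..R}" using \<rho> R by auto
  have s: "(\<lambda>p. expansion_term a n 0 0 [] p \<tau> r \<theta> \<alpha>) sums \<phi> n \<tau> r \<theta> \<alpha>" if "r \<in> {0..R}" for r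
    using that R by (intro sums_phi n \<tau> \<theta>) auto
  note d = sums_has_vector_derivative[OF convex_real_interval(5) expansion_term_rho_derivative u s r]
  have "at \<rho> within {0..} = at \<rho> within {0..R}"
    by (rule at_within_nhd[of _ "{..<R}"]) (use R in auto)
  hence "d_rho (\<lambda>t r. \<phi> n t r \<theta> \<alpha>) \<tau> \<rho> = (\<Sum>p. expansion_term a n 0 (Suc 0) [] p \<tau> \<rho> \<theta> \<alpha>)"
    unfolding d_rho_def using d(1) r R \<rho> by (simp add: vector_derivative_within_closed_interval)
  with d(2) show ?thesis by simp
qed

lemma phi_angular_derivatives:
  shows "((\<lambda>x. \<phi> n \<tau> \<rho> x \<alpha>) has_vector_derivative
      - ((\<Sum>p. expansion_term a n 0 0 [True] p \<tau> \<rho> \<theta> \<alpha>)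
        + (\<Sum>p. expansion_term a n 0 0 [False] p \<tau> \<rho> \<theta> \<alpha>)) / 2) (at \<theta>)"
    and "((\<lambda>y. \<phi> n \<tau> \<rho> \<theta> y) has_vector_derivative
      of_real (sin \<theta>) / (2 * \<i>) * (2 * of_int (spin n) * of_real (cot \<theta>) * \<phi> n \<tau> \<rho> \<theta> \<alpha>
       - ((\<Sum>p. expansion_term a n 0 0 [True] p \<tau> \<rho> \<theta> \<alpha>)
         - (\<Sum>p. expansion_term a n 0 0 [False] p \<tau> \<rho> \<theta> \<alpha>)))) (at \<alpha>)"
proof -
  let ?T = "\<lambda>w p. expansion_term a n 0 0 w p \<tau> \<rho>"
  have sums: "(\<lambda>p. ?T w p \<theta> \<alpha>) sums (\<Sum>p. ?T w p \<theta> \<alpha>)" for w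
    by (intro summable_sums summable_expansion n \<tau> \<rho> \<theta>)
  have u: "uniformly_convergent_on {0<..<pi} (\<lambda>N x. \<Sum>p<N. ?T w p x \<alpha>)" for w
    using uniformly_convergent_expansion[OF n, of \<rho> "\<lambda>x. (\<tau>, \<rho>, x, \<alpha>)" "{0<..<pi}" 0 0 w] \<tau> \<rho>
    by (simp add: image_subset_iff)
  have u': "uniformly_convergent_on UNIV (\<lambda>N y. \<Sum>p<N. ?T w p \<theta> y)" for w
    using uniformly_convergent_expansion[OF n, of \<rho> "\<lambda>y. (\<tau>, \<rho>, \<theta>, y)" "UNIV" 0 0 w] \<tau> \<rho> \<theta>
    by (simp add: image_subset_iff)
  have U0: "uniformly_convergent_on {0<..<pi} (\<lambda>N x. (-1/2) * ((\<Sum>p<N. ?T [True] p x \<alpha>) + (\<Sum>p<N. ?T [False] p x \<alpha>)))"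
    by (intro uniformly_convergent_on_bounded_mult uniformly_convergent_on_add u)
      (auto simp: image_constant_conv)
  have half: "- z / 2 = (-1/2) * z" for z :: complex by simp
  have eq: "(\<Sum>p<N. - (?T [True] p x \<alpha> + ?T [False] p x \<alpha>) / 2)
      = (-1/2) * ((\<Sum>p<N. ?T [True] p x \<alpha>) + (\<Sum>p<N. ?T [False] p x \<alpha>))" for N x
    unfolding sum.distrib [symmetric] sum_distrib_left by (intro sum.cong refl half)
  have U: "uniformly_convergent_on {0<..<pi} (\<lambda>N x. \<Sum>p<N. - (?T [True] p x \<alpha> + ?T [False] p x \<alpha>) / 2)"
    using U0 by (simp only: eq)
  have s: "(\<lambda>p. - (?T [True] p \<theta> \<alpha> + ?T [False] p \<theta> \<alpha>) / 2) sums
      (- ((\<Sum>p. ?T [True] p \<theta> \<alpha>) + (\<Sum>p. ?T [False] p \<theta> \<alpha>)) / 2)"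
    by (intro sums_divide sums_minus sums_add sums)
  show "((\<lambda>x. \<phi> n \<tau> \<rho> x \<alpha>) has_vector_derivative
      - ((\<Sum>p. ?T [True] p \<theta> \<alpha>) + (\<Sum>p. ?T [False] p \<theta> \<alpha>)) / 2) (at \<theta>)"
    using sums_has_vector_derivative(1)[OF convex_real_interval(8) expansion_term_theta_derivative[OF n] U
        sums_phi[OF n \<tau> \<rho>] \<theta>]
    by (simp only: sums_unique[OF s, symmetric] at_within_open[OF \<theta> open_greaterThanLessThan])
  define C where "C = complex_of_real (sin \<theta>) / (2 * \<i>)"
  define D where "D = 2 * of_int (spin n) * complex_of_real (cot \<theta>)"
  have "uniformly_convergent_on UNIV (\<lambda>N y. C * (D * (\<Sum>p<N. ?T [] p \<theta> y)
      + ((-1) * (\<Sum>p<N. ?T [True] p \<theta> y) + (\<Sum>p<N. ?T [False] p \<theta> y))))"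
    by (intro uniformly_convergent_on_bounded_mult uniformly_convergent_on_add u')
      (auto simp: image_constant_conv)
  moreover have "(\<Sum>p<N. C * (D * ?T [] p \<theta> y - (?T [True] p \<theta> y - ?T [False] p \<theta> y)))
      = C * (D * (\<Sum>p<N. ?T [] p \<theta> y) + ((-1) * (\<Sum>p<N. ?T [True] p \<theta> y) + (\<Sum>p<N. ?T [False] p \<theta> y)))" for N y
    by (simp add: sum_subtractf flip: sum_distrib_left)
  ultimately have U': "uniformly_convergent_on UNIV
      (\<lambda>N y. \<Sum>p<N. C * (D * ?T [] p \<theta> y - (?T [True] p \<theta> y - ?T [False] p \<theta> y)))"
    by simp
  have s': "(\<lambda>p. C * (D * ?T [] p \<theta> \<alpha> - (?T [True] p \<theta> \<alpha> - ?T [False] p \<theta> \<alpha>))) sums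
      (C * (D * \<phi> n \<tau> \<rho> \<theta> \<alpha> - ((\<Sum>p. ?T [True] p \<theta> \<alpha>) - (\<Sum>p. ?T [False] p \<theta> \<alpha>))))"
    by (intro sums_mult sums_diff sums sums_phi[OF n \<tau> \<rho> \<theta>])
  note d = expansion_term_phi_derivative[OF n \<theta>, folded C_def D_def]
  show "((\<lambda>y. \<phi> n \<tau> \<rho> \<theta> y) has_vector_derivative
      of_real (sin \<theta>) / (2 * \<i>) * (2 * of_int (spin n) * of_real (cot \<theta>) * \<phi> n \<tau> \<rho> \<theta> \<alpha>
       - ((\<Sum>p. ?T [True] p \<theta> \<alpha>) - (\<Sum>p. ?T [False] p \<theta> \<alpha>)))) (at \<alpha>)"
    using sums_has_vector_derivative(1)[OF convex_UNIV d U'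
        sums_phi[OF n \<tau> \<rho> \<theta>], of \<alpha>, OF UNIV_I]
    unfolding C_def [symmetric] D_def [symmetric] by (simp only: sums_unique[OF s', symmetric])
qed

lemma
  shows sums_eth: "(\<lambda>p. expansion_term a n 0 0 [True] p \<tau> \<rho> \<theta> \<alpha>) sums eth (spin n) (\<phi> n \<tau> \<rho>) \<theta> \<alpha>"
    and sums_eth_bar: "(\<lambda>p. expansion_term a n 0 0 [False] p \<tau> \<rho> \<theta> \<alpha>) sums eth_bar (spin n) (\<phi> n \<tau> \<rho>) \<theta> \<alpha>"
proof -
  have sin: "sin \<theta> \<noteq> 0" using \<theta> sin_gt_zero[of \<theta>] by auto
  note d = phi_angular_derivatives[THEN vector_derivative_at]
  have "eth (spin n) (\<phi> n \<tau> \<rho>) \<theta> \<alpha> = (\<Sum>p. expansion_term a n 0 0 [True] p \<tau> \<rho> \<theta> \<alpha>)"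
    "eth_bar (spin n) (\<phi> n \<tau> \<rho>) \<theta> \<alpha> = (\<Sum>p. expansion_term a n 0 0 [False] p \<tau> \<rho> \<theta> \<alpha>)"
    unfolding eth_def eth_bar_def d using sin by (simp_all add: field_simps)
  thus "(\<lambda>p. expansion_term a n 0 0 [True] p \<tau> \<rho> \<theta> \<alpha>) sums eth (spin n) (\<phi> n \<tau> \<rho>) \<theta> \<alpha>"
    "(\<lambda>p. expansion_term a n 0 0 [False] p \<tau> \<rho> \<theta> \<alpha>) sums eth_bar (spin n) (\<phi> n \<tau> \<rho>) \<theta> \<alpha>"
    by (simp_all add: summable_sums[OF summable_expansion[OF n \<tau> \<rho> \<theta>]])
qed

end

section \<open>Projection of the Maxwell equations on the modes\<close>

lemma eth_Y_mode:
  assumes "\<bar>s\<bar> \<le> int l" "\<bar>m\<bar> \<le> int l" "\<theta> \<in> {0<..<pi}"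
  shows "ang_deriv [True] s (Y s l m) \<theta> \<alpha> = of_real (eth_factor s l) * Y (s + 1) l m \<theta> \<alpha>"
    and "ang_deriv [False] s (Y s l m) \<theta> \<alpha> = - of_real (eth_factor (s - 1) l) * Y (s - 1) l m \<theta> \<alpha>"
  using assms by (simp_all add: eth_Y eth_bar_Y)

text \<open>Two separations in turn: by powers of \<rho>, where the angles are fixed, and then by
  harmonics within one order, where the sum is finite and orthonormality applies.\<close>

lemma mode_sums_eq_0D:
  assumes s: "nat \<bar>s\<bar> \<le> k" and lm: "(l, m) \<in> modes k p"
    and sums: "\<And>\<rho> \<theta> \<alpha>. \<rho> \<in> {0..<\<rho>\<^sub>0} \<Longrightarrow> \<theta> \<in> {0<..<pi} \<Longrightarrow>
      (\<lambda>p. (\<Sum>(l, m)\<in>modes k p. c p l m * Y s l m \<theta> \<alpha>) * of_real (\<rho> ^ p)) sums 0"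
  shows "c p l m = 0"
proof (rule Y_sum_eq_0D[OF _ _ lm])
  show "\<bar>s\<bar> \<le> int l' \<and> \<bar>m'\<bar> \<le> int l'" if "(l', m') \<in> modes k p" for l' m'
    using that s by auto
  show "(\<Sum>(l', m')\<in>modes k p. c p l' m' * Y s l' m' \<theta> \<alpha>) = 0" if "\<theta> \<in> {0<..<pi}" for \<theta> \<alpha>
    using sums[OF _ that, of _ \<alpha>] by (intro powser_eq_0D[OF rho0]) auto
qed simp

text \<open>The operator \<open>\<rho> d/d\<rho>\<close> multiplies the order \<open>p\<close> part
  by \<open>p\<close>; for \<open>p = 0\<close> both sides are zero in spite of the truncated
  exponent.\<close>

lemma fact_choose_1_mult:
  "complex_of_real \<rho> * of_real (fact 1 * real (p choose 1) * \<rho> ^ (p - 1)) = of_nat p * of_real (\<rho> ^ p)"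
  by (cases p) (simp_all add: mult_ac)

context
  fixes p l :: nat and m :: int and \<tau> :: real and \<mu> :: complex and b b' :: "nat \<Rightarrow> complex"
  assumes maxwell: "maxwell \<phi>" and lp: "1 \<le> l" "l \<le> p" and m: "\<bar>m\<bar> \<le> int l"
    and \<tau>: "\<tau> \<in> {-1..1}"
  defines "\<mu> \<equiv> of_real (eth_factor 0 l)"
    and "b \<equiv> \<lambda>n. a n p l m \<tau>" and "b' \<equiv> \<lambda>n. d1_tau (a n p l m) \<tau>"
begin

lemma maxwell_mode_0:
  "(1 + of_real \<tau>) * b' 0 - of_nat p * b 0 + \<mu> * b 1 + b 0 = 0"
proof -
  define c where "c p l m = 1 / fact p * ((1 + of_real \<tau>) * d1_tau (a 0 p l m) \<tau> - of_nat p * a 0 p l m \<tau>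
      + of_real (eth_factor 0 l) * a 1 p l m \<tau> + a 0 p l m \<tau>)" for p l m
  have "c p l m = 0"
  proof (rule mode_sums_eq_0D[of 1 1])
    fix \<rho> \<theta> \<alpha> assume \<rho>: "\<rho> \<in> {0..<\<rho>\<^sub>0}" and \<theta>: "\<theta> \<in> {0<..<pi}"
    let ?T = "\<lambda>n i j w p. expansion_term a n i j w p \<tau> \<rho> \<theta> \<alpha>"
    have "(\<lambda>p. (1 + of_real \<tau>) * ?T 0 1 0 [] p - of_real \<rho> * ?T 0 0 1 [] p + ?T 1 0 0 [True] p
          + ?T 0 0 0 [] p) sums
      ((1 + of_real \<tau>) * d_tau (\<lambda>t r. \<phi> 0 t r \<theta> \<alpha>) \<tau> \<rho> - of_real \<rho> * d_rho (\<lambda>t r. \<phi> 0 t r \<theta> \<alpha>) \<tau> \<rho>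
        + eth (spin 1) (\<phi> 1 \<tau> \<rho>) \<theta> \<alpha> + \<phi> 0 \<tau> \<rho> \<theta> \<alpha>)"
      by (intro sums_add sums_diff sums_mult sums_d_tau sums_d_rho sums_eth sums_phi \<tau> \<rho> \<theta>) auto
    also have "\<dots> = 0"
      using maxwell \<tau> \<rho> \<theta> unfolding maxwell_def Let_def by (simp add: spin_def)
    also
    note sums_0 = calculation
    have eq: "(1 + of_real \<tau>) * ?T 0 1 0 [] p - of_real \<rho> * ?T 0 0 1 [] p + ?T 1 0 0 [True] p
          + ?T 0 0 0 [] p = (\<Sum>(l, m)\<in>modes 1 p. c p l m * Y 1 l m \<theta> \<alpha>) * of_real (\<rho> ^ p)" for p
    proof -
      have "?T 1 0 0 [True] p = (\<Sum>(l, m)\<in>modes 0 p.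
          1 / fact p * a 1 p l m \<tau> * (of_real (eth_factor 0 l) * Y 1 l m \<theta> \<alpha>) * of_real (\<rho> ^ p))"
        unfolding expansion_term_eq using \<theta>
        by (intro sum.cong) (auto simp: spin_def eth_Y_mode simp del: ang_deriv.simps)
      also have "\<dots> = (\<Sum>(l, m)\<in>modes 1 p.
          1 / fact p * a 1 p l m \<tau> * (of_real (eth_factor 0 l) * Y 1 l m \<theta> \<alpha>) * of_real (\<rho> ^ p))"
        by (rule modes_sum_mono [symmetric]) (auto simp: eth_factor_def)
      finally have 1: "?T 1 0 0 [True] p = \<dots>" .
      have 2: "of_real \<rho> * ?T 0 0 1 [] p = (\<Sum>(l, m)\<in>modes 1 p.
          1 / fact p * a 0 p l m \<tau> * Y 1 l m \<theta> \<alpha> * (of_nat p * of_real (\<rho> ^ p)))"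
        unfolding expansion_term_eq fact_choose_1_mult [symmetric]
        by (simp add: spin_def sum_distrib_left mult_ac case_prod_beta)
      show ?thesis
        unfolding 1 2 unfolding expansion_term_eq
        by (simp add: spin_def sum_distrib_left sum_distrib_right case_prod_beta c_def
            flip: sum_subtractf sum.distrib) (intro sum.cong refl,
              simp add: algebra_simps add_divide_distrib diff_divide_distrib)
    qed
    show "(\<lambda>p. (\<Sum>(l, m)\<in>modes 1 p. c p l m * Y 1 l m \<theta> \<alpha>) * of_real (\<rho> ^ p)) sums 0"
      using sums_0 by (simp only: eq)
  qed (use lp m in auto)
  thus ?thesis by (simp add: c_def b_def b'_def \<mu>_def)
qed

text \<open>The second and the fourth field equation, doubled. Since \<open>eth_bar\<close> lowers
  with a minus sign, \<open>b 0\<close> enters with the sign opposite to that of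
  \<open>eth_bar\<close> in the field equation; and since
  \<open>eth_factor (-1) l = eth_factor 0 l\<close>, the only coupling is
  \<open>sqrt (l (l + 1))\<close>.\<close>

lemma
  shows maxwell_mode_1: "2 * b' 1 + \<mu> * (b 2 - b 0) = 0"
    and maxwell_mode_3: "2 * of_real \<tau> * b' 1 - 2 * of_nat p * b 1 + \<mu> * (b 2 + b 0) = 0"
proof -
  have f: "eth_factor (-1) l = eth_factor 0 l" for l by (simp add: eth_factor_def mult.commute)
  have T2: "expansion_term a 2 0 0 [True] p \<tau> \<rho> \<theta> \<alpha> = (\<Sum>(l, m)\<in>modes 0 p.
          1 / fact p * a 2 p l m \<tau> * (of_real (eth_factor 0 l) * Y 0 l m \<theta> \<alpha>) * of_real (\<rho> ^ p))"
    if \<theta>: "\<theta> \<in> {0<..<pi}" for p \<rho> \<theta> \<alpha>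
  proof -
    have "expansion_term a 2 0 0 [True] p \<tau> \<rho> \<theta> \<alpha> = (\<Sum>(l, m)\<in>modes 1 p.
          1 / fact p * a 2 p l m \<tau> * (of_real (eth_factor 0 l) * Y 0 l m \<theta> \<alpha>) * of_real (\<rho> ^ p))"
      unfolding expansion_term_eq using \<theta>
      by (intro sum.cong) (auto simp: spin_def eth_Y_mode f simp del: ang_deriv.simps)
    also have "\<dots> = (\<Sum>(l, m)\<in>modes 0 p.
          1 / fact p * a 2 p l m \<tau> * (of_real (eth_factor 0 l) * Y 0 l m \<theta> \<alpha>) * of_real (\<rho> ^ p))"
      by (rule modes_sum_mono) (auto simp: eth_factor_def)
    finally show ?thesis .
  qed
  have T0: "expansion_term a 0 0 0 [False] p \<tau> \<rho> \<theta> \<alpha> = (\<Sum>(l, m)\<in>modes 0 p.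
          - (1 / fact p * a 0 p l m \<tau> * (of_real (eth_factor 0 l) * Y 0 l m \<theta> \<alpha>) * of_real (\<rho> ^ p)))"
    if \<theta>: "\<theta> \<in> {0<..<pi}" for p \<rho> \<theta> \<alpha>
  proof -
    have "expansion_term a 0 0 0 [False] p \<tau> \<rho> \<theta> \<alpha> = (\<Sum>(l, m)\<in>modes 1 p.
          - (1 / fact p * a 0 p l m \<tau> * (of_real (eth_factor 0 l) * Y 0 l m \<theta> \<alpha>) * of_real (\<rho> ^ p)))"
      unfolding expansion_term_eq using \<theta>
      by (intro sum.cong) (auto simp: spin_def eth_Y_mode f simp del: ang_deriv.simps)
    also have "\<dots> = (\<Sum>(l, m)\<in>modes 0 p.
          - (1 / fact p * a 0 p l m \<tau> * (of_real (eth_factor 0 l) * Y 0 l m \<theta> \<alpha>) * of_real (\<rho> ^ p)))"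
      by (rule modes_sum_mono) (auto simp: eth_factor_def)
    finally show ?thesis .
  qed
  define c where "c p l m = 1 / fact p * (2 * d1_tau (a 1 p l m) \<tau>
      + of_real (eth_factor 0 l) * (a 2 p l m \<tau> - a 0 p l m \<tau>))" for p l m
  have "c p l m = 0"
  proof (rule mode_sums_eq_0D[of 0 0])
    fix \<rho> \<theta> \<alpha> assume \<rho>: "\<rho> \<in> {0..<\<rho>\<^sub>0}" and \<theta>: "\<theta> \<in> {0<..<pi}"
    let ?T = "\<lambda>n i j w p. expansion_term a n i j w p \<tau> \<rho> \<theta> \<alpha>"
    have "(\<lambda>p. 2 * ?T 1 1 0 [] p + (?T 2 0 0 [True] p + ?T 0 0 0 [False] p)) sums
      (2 * d_tau (\<lambda>t r. \<phi> 1 t r \<theta> \<alpha>) \<tau> \<rho>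
        + (eth (spin 2) (\<phi> 2 \<tau> \<rho>) \<theta> \<alpha> + eth_bar (spin 0) (\<phi> 0 \<tau> \<rho>) \<theta> \<alpha>))"
      by (intro sums_add sums_mult sums_d_tau sums_eth sums_eth_bar \<tau> \<rho> \<theta>) auto
    also have "\<dots> = 2 * (d_tau (\<lambda>t r. \<phi> 1 t r \<theta> \<alpha>) \<tau> \<rho>
        + 1/2 * (eth (-1) (\<phi> 2 \<tau> \<rho>) \<theta> \<alpha> + eth_bar 1 (\<phi> 0 \<tau> \<rho>) \<theta> \<alpha>))"
      by (simp add: spin_def)
    also have "\<dots> = 0"
      using maxwell \<tau> \<rho> \<theta> unfolding maxwell_def Let_def by simp
    also
    note sums_0 = calculation
    have eq: "2 * ?T 1 1 0 [] p + (?T 2 0 0 [True] p + ?T 0 0 0 [False] p)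
        = (\<Sum>(l, m)\<in>modes 0 p. c p l m * Y 0 l m \<theta> \<alpha>) * of_real (\<rho> ^ p)" for p
      unfolding T2[OF \<theta>] T0[OF \<theta>] unfolding expansion_term_eq
      by (simp add: spin_def sum_distrib_left sum_distrib_right case_prod_beta c_def
            flip: sum_subtractf sum.distrib) (intro sum.cong refl,
              simp add: algebra_simps add_divide_distrib diff_divide_distrib)
    show "(\<lambda>p. (\<Sum>(l, m)\<in>modes 0 p. c p l m * Y 0 l m \<theta> \<alpha>) * of_real (\<rho> ^ p)) sums 0"
      using sums_0 by (simp only: eq)
  qed (use lp m in auto)
  thus "2 * b' 1 + \<mu> * (b 2 - b 0) = 0" by (simp add: c_def b_def b'_def \<mu>_def)
  define e where "e p l m = 1 / fact p * (2 * of_real \<tau> * d1_tau (a 1 p l m) \<tau> - 2 * of_nat p * a 1 p l m \<tau>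
      + of_real (eth_factor 0 l) * (a 2 p l m \<tau> + a 0 p l m \<tau>))" for p l m
  have "e p l m = 0"
  proof (rule mode_sums_eq_0D[of 0 0])
    fix \<rho> \<theta> \<alpha> assume \<rho>: "\<rho> \<in> {0..<\<rho>\<^sub>0}" and \<theta>: "\<theta> \<in> {0<..<pi}"
    let ?T = "\<lambda>n i j w p. expansion_term a n i j w p \<tau> \<rho> \<theta> \<alpha>"
    have "(\<lambda>p. 2 * of_real \<tau> * ?T 1 1 0 [] p - 2 * (of_real \<rho> * ?T 1 0 1 [] p)
         + (?T 2 0 0 [True] p - ?T 0 0 0 [False] p)) sums
      (2 * of_real \<tau> * d_tau (\<lambda>t r. \<phi> 1 t r \<theta> \<alpha>) \<tau> \<rho> - 2 * (of_real \<rho> * d_rho (\<lambda>t r. \<phi> 1 t r \<theta> \<alpha>) \<tau> \<rho>)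
        + (eth (spin 2) (\<phi> 2 \<tau> \<rho>) \<theta> \<alpha> - eth_bar (spin 0) (\<phi> 0 \<tau> \<rho>) \<theta> \<alpha>))"
      by (intro sums_add sums_diff sums_mult sums_d_tau sums_d_rho sums_eth sums_eth_bar \<tau> \<rho> \<theta>) auto
    also have "\<dots> = 2 * (of_real \<tau> * d_tau (\<lambda>t r. \<phi> 1 t r \<theta> \<alpha>) \<tau> \<rho> - of_real \<rho> * d_rho (\<lambda>t r. \<phi> 1 t r \<theta> \<alpha>) \<tau> \<rho>
        + 1/2 * (eth (-1) (\<phi> 2 \<tau> \<rho>) \<theta> \<alpha> - eth_bar 1 (\<phi> 0 \<tau> \<rho>) \<theta> \<alpha>))"
      by (simp add: spin_def)
    also have "\<dots> = 0"
      using maxwell \<tau> \<rho> \<theta> unfolding maxwell_def Let_def by simp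
    also
    note sums_0 = calculation
    have eq: "2 * of_real \<tau> * ?T 1 1 0 [] p - 2 * (of_real \<rho> * ?T 1 0 1 [] p)
         + (?T 2 0 0 [True] p - ?T 0 0 0 [False] p)
        = (\<Sum>(l, m)\<in>modes 0 p. e p l m * Y 0 l m \<theta> \<alpha>) * of_real (\<rho> ^ p)" for p
    proof -
      have 2: "of_real \<rho> * ?T 1 0 1 [] p = (\<Sum>(l, m)\<in>modes 0 p.
          1 / fact p * a 1 p l m \<tau> * Y 0 l m \<theta> \<alpha> * (of_nat p * of_real (\<rho> ^ p)))"
        unfolding expansion_term_eq fact_choose_1_mult [symmetric]
        by (simp add: spin_def sum_distrib_left mult_ac case_prod_beta)
      show ?thesis
        unfolding T2[OF \<theta>] T0[OF \<theta>] 2 unfolding expansion_term_eq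
        by (simp add: spin_def sum_distrib_left sum_distrib_right case_prod_beta e_def
            flip: sum_subtractf sum.distrib) (intro sum.cong refl,
              simp add: algebra_simps add_divide_distrib diff_divide_distrib)
    qed
    show "(\<lambda>p. (\<Sum>(l, m)\<in>modes 0 p. e p l m * Y 0 l m \<theta> \<alpha>) * of_real (\<rho> ^ p)) sums 0"
      using sums_0 by (simp only: eq)
  qed (use lp m in auto)
  thus "2 * of_real \<tau> * b' 1 - 2 * of_nat p * b 1 + \<mu> * (b 2 + b 0) = 0"
    by (simp add: e_def b_def b'_def \<mu>_def)
qed

end

end

subsection \<open>Taylor jets\<close>

text \<open>\<open>F x\<close> is the Taylor series at \<open>x\<close> of the function \<open>\<lambda>x. fps_nth (F x) 0\<close>.\<close>

definition jet_on :: "real set \<Rightarrow> (real \<Rightarrow> complex fps) \<Rightarrow> bool" where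
  "jet_on S F \<longleftrightarrow> (\<forall>x\<in>S. coeffs_have_derivative F (fps_deriv (F x)) (at x within S))"

lemma jet_onD:
  assumes "jet_on S F" "x \<in> S"
  shows "((\<lambda>x. fps_nth (F x) i) has_vector_derivative of_nat (i + 1) * fps_nth (F x) (i + 1))
           (at x within S)"
  using assms by (simp add: jet_on_def coeffs_have_derivative_def)

lemma jet_on_subset: "jet_on S F \<Longrightarrow> T \<subseteq> S \<Longrightarrow> jet_on T F"
  unfolding jet_on_def coeffs_have_derivative_def
  by (meson has_vector_derivative_within_subset subsetD)

lemma jet_on_const: "jet_on S (\<lambda>_. fps_const c)"
  by (simp add: jet_on_def)

lemma jet_on_add: "jet_on S F \<Longrightarrow> jet_on S G \<Longrightarrow> jet_on S (\<lambda>x. F x + G x)"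
  unfolding jet_on_def by (auto intro: coeffs_have_derivative_add)

lemma jet_on_mult: "jet_on S F \<Longrightarrow> jet_on S G \<Longrightarrow> jet_on S (\<lambda>x. F x * G x)"
  unfolding jet_on_def using coeffs_have_derivative_mult by (fastforce simp: add.commute)

lemma jet_on_power: "jet_on S F \<Longrightarrow> jet_on S (\<lambda>x. F x ^ n)"
proof (induction n)
  case 0
  show ?case using jet_on_const[of S 1] by simp
qed (simp add: jet_on_mult)

lemma jet_on_sum: "(\<And>i. i \<in> I \<Longrightarrow> jet_on S (F i)) \<Longrightarrow> jet_on S (\<lambda>x. \<Sum>i\<in>I. F i x)"
proof (induction I rule: infinite_finite_induct)
  case (insert i I)
  thus ?case by (simp add: jet_on_add)
qed (use jet_on_const[of S 0] in simp_all)

lemma jet_on_deriv: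
  assumes "jet_on S F"
  shows "jet_on S (\<lambda>x. fps_deriv (F x))"
  unfolding jet_on_def coeffs_have_derivative_def
proof (intro ballI allI)
  fix x i assume "x \<in> S"
  from has_vector_derivative_mult_right[OF jet_onD[OF assms this, of "i + 1"], of "of_nat (i + 1)"]
  show "((\<lambda>x. fps_nth (fps_deriv (F x)) i) has_vector_derivative fps_nth (fps_deriv (fps_deriv (F x))) i)
      (at x within S)"
    by simp
qed

lemma jet_on_X: "jet_on S (\<lambda>x. fps_const (of_real x) + fps_X)"
  unfolding jet_on_def coeffs_have_derivative_def
proof (intro ballI allI)
  fix x i
  show "((\<lambda>x. fps_nth (fps_const (of_real x) + fps_X) i) has_vector_derivative
      fps_nth (fps_deriv (fps_const (complex_of_real x) + fps_X)) i) (at x within S)"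
    using has_vector_derivative_of_real[of "\<lambda>x. x" 1 "at x within S", where 'a = complex]
    by (cases i) (auto intro!: derivative_eq_intros)
qed

text \<open>The passage from functions to series: an equation that holds pointwise on an interval
  holds for all Taylor coefficients, at the end points too, because one-sided derivatives on a
  nondegenerate interval are unique.\<close>

lemma jet_on_eq_0:
  assumes F: "jet_on {a..b} F" and ab: "a < b"
    and 0: "\<And>x. x \<in> {a..b} \<Longrightarrow> fps_nth (F x) 0 = 0" and x: "x \<in> {a..b}"
  shows "F x = 0"
proof -
  have "\<forall>x\<in>{a..b}. fps_nth (F x) i = 0" for i
  proof (induction i)
    case (Suc i)
    show ?case
    proof
      fix x assume x: "x \<in> {a..b}"
      have "((\<lambda>x. fps_nth (F x) i) has_vector_derivative 0) (at x within {a..b})"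
        by (rule has_vector_derivative_transform[OF x _ has_vector_derivative_const[of 0]])
          (use Suc in simp)
      with jet_onD[OF F x, of i] have "of_nat (i + 1) * fps_nth (F x) (i + 1) = 0"
        using vector_derivative_unique_within_closed_interval[of a b x, unfolded cbox_interval] ab x by blast
      thus "fps_nth (F x) (Suc i) = 0" by (simp del: of_nat_Suc)
    qed
  qed (use 0 in simp)
  thus ?thesis using x by (simp add: fps_eq_iff)
qed

section \<open>Taylor series of the powers of \<open>1 / (1 - x)\<close>\<close>

definition geometric_jet :: "real \<Rightarrow> complex fps" where
  "geometric_jet x = Abs_fps (\<lambda>i. of_real (1 / (1 - x)) ^ (i + 1))"

lemma jet_on_geometric:
  assumes "1 \<notin> S"
  shows "jet_on S geometric_jet"
  unfolding jet_on_def coeffs_have_derivative_def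
proof (intro ballI allI)
  fix x i assume "x \<in> S"
  hence x: "1 - x \<noteq> 0" using assms by auto
  have "((\<lambda>x. (1 / (1 - x)) ^ (i + 1)) has_real_derivative real (i + 1) * (1 / (1 - x)) ^ (i + 2))
      (at x within S)"
  proof -
    have "((\<lambda>x. 1 / (1 - x)) has_real_derivative (1 / (1 - x))\<^sup>2) (at x within S)"
      using x by (auto intro!: derivative_eq_intros simp: power2_eq_square)
    from DERIV_power[OF this, of "i + 1"] show ?thesis
      by (simp add: power2_eq_square mult_ac)
  qed
  from has_vector_derivative_of_real[OF this,
      where 'a = complex]
  show "((\<lambda>x. fps_nth (geometric_jet x) i) has_vector_derivative fps_nth (fps_deriv (geometric_jet x)) i)
      (at x within S)"
    by (simp add: geometric_jet_def)
qed

lemma geometric_jet_inverse: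
  assumes "x \<noteq> 1"
  shows "(fps_const (of_real (1 - x)) - fps_X) * geometric_jet x = 1"
proof (rule fps_ext)
  fix i
  define g d where "g = complex_of_real (1 / (1 - x))" and "d = complex_of_real (1 - x)"
  have "d * g = complex_of_real ((1 - x) * (1 / (1 - x)))" by (simp only: g_def d_def of_real_mult)
  hence g: "d * g = 1" using assms by simp
  have "d * fps_nth (geometric_jet x) i = (d * g) * g ^ i"
    by (simp add: geometric_jet_def g_def)
  thus "fps_nth ((fps_const (of_real (1 - x)) - fps_X) * geometric_jet x) i = fps_nth 1 i"
    unfolding d_def [symmetric]
    by (cases i) (simp_all add: left_diff_distrib g, simp add: geometric_jet_def g_def)
qed

text \<open>The negative binomial series. Multiplication by \<open>d - X\<close> takes the candidate
  for \<open>k + 1\<close> to that for \<open>k\<close>, which is Pascal's rule, and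
  \<open>geometric_jet x\<close> inverts this multiplication.\<close>

lemma geometric_jet_power_nth:
  assumes "x \<noteq> 1"
  shows "fps_nth (geometric_jet x ^ (k + 1)) i = of_nat (k + i choose i) * of_real (1 / (1 - x)) ^ (k + i + 1)"
proof -
  define g d where "g = complex_of_real (1 / (1 - x))" and "d = complex_of_real (1 - x)"
  have "d * g = complex_of_real ((1 - x) * (1 / (1 - x)))" by (simp only: g_def d_def of_real_mult)
  hence g: "d * g = 1" using assms by simp
  define P where "P k = Abs_fps (\<lambda>i. of_nat (k + i choose i) * g ^ (k + i + 1))" for k
  have step: "(fps_const d - fps_X) * P (Suc k) = P k" for k
  proof (rule fps_ext)
    fix i
    have "d * fps_nth (P (Suc k)) i = of_nat (Suc k + i choose i) * (d * g) * g ^ (k + i + 1)"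
      by (simp add: P_def mult_ac)
    hence 1: "d * fps_nth (P (Suc k)) i = of_nat (Suc k + i choose i) * g ^ (k + i + 1)"
      by (simp add: g)
    show "fps_nth ((fps_const d - fps_X) * P (Suc k)) i = fps_nth (P k) i"
    proof (cases i)
      case 0
      thus ?thesis using 1 by (simp add: left_diff_distrib P_def)
    next
      case (Suc j)
      have "(Suc k + i choose i) = (k + i choose i) + (Suc k + j choose j)"
        by (simp add: Suc)
      hence "d * fps_nth (P (Suc k)) i = fps_nth (P k) i + fps_nth (P (Suc k)) j"
        unfolding 1 by (simp add: P_def Suc algebra_simps)
      thus ?thesis by (simp add: left_diff_distrib Suc)
    qed
  qed
  have "geometric_jet x ^ (k + 1) = P k"
  proof (induction k)
    case 0
    show ?case by (simp add: geometric_jet_def P_def g_def)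
  next
    case (Suc k)
    have "geometric_jet x ^ (Suc k + 1) = geometric_jet x * ((fps_const d - fps_X) * P (Suc k))"
      unfolding step using Suc by simp
    also have "\<dots> = ((fps_const d - fps_X) * geometric_jet x) * P (Suc k)"
      by (simp only: mult_ac)
    also have "\<dots> = P (Suc k)"
      using geometric_jet_inverse[OF assms] by (simp only: d_def mult_1)
    finally show ?case .
  qed
  thus ?thesis by (simp add: P_def g_def)
qed

section \<open>The mode equations as identities of power series\<close>

text \<open>The series are based at \<open>x = -1\<close>, so that \<open>X\<close> is
  \<open>1 + x\<close> and \<open>2 - X\<close> is \<open>1 - x\<close>. The first equation
  expresses \<open>M * A1\<close> by \<open>A0\<close>, and \<open>A2\<close> cancels between the
  other two; in terms of \<open>Z\<close> the result is
  \<open>X (2 - X) Z'' - (4 X + 2 (p - 2)) Z' + (l (l + 1) - 2) Z = 0\<close>. Its leading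
  coefficient vanishes at \<open>X = 0\<close>, whence only neighbouring coefficients are
  linked.\<close>

lemma fps_mode_recurrence:
  fixes A0 A1 A2 Z M :: "complex fps"
  assumes E1: "fps_X * fps_deriv A0 - of_nat p * A0 + M * A1 + A0 = 0"
    and E2: "2 * fps_deriv A1 + M * (A2 - A0) = 0"
    and E3: "2 * (fps_X - 1) * fps_deriv A1 - 2 * of_nat p * A1 + M * (A2 + A0) = 0"
    and M: "fps_deriv M = 0" "M * M = of_nat l * (of_nat l + 1)" and p: "p \<ge> 1"
    and A0: "A0 = (2 - fps_X) ^ (p + 1) * Z"
  shows "2 * of_nat (j + 1) * (of_nat j + 2 - of_nat p) * fps_nth Z (j + 1)
    = ((of_nat j + 1) * (of_nat j + 2) - of_nat l * (of_nat l + 1)) * fps_nth Z j"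
proof -
  define P H :: "complex fps" where "P = of_nat p" and "H = 2 - fps_X"
  note P = P_def [symmetric]
  obtain q where q: "p = Suc q" using p by (cases p) auto
  have dP: "fps_deriv P = 0" by (simp add: P_def)
  have dH: "fps_deriv H = -1" by (simp add: H_def)
  have 1: "M * A1 = P * A0 - A0 - fps_X * fps_deriv A0"
    using E1 by (simp add: P algebra_simps)
  have "fps_deriv (M * A1) = fps_deriv (P * A0 - A0 - fps_X * fps_deriv A0)" by (simp add: 1)
  hence 2: "M * fps_deriv A1 = P * fps_deriv A0 - 2 * fps_deriv A0 - fps_X * fps_deriv (fps_deriv A0)"
    by (simp add: dP M algebra_simps)
  \<comment> \<open>\<open>M\<close> times the difference of the third and the second equation: the
    terms in \<open>A2\<close> cancel, and the rest contains \<open>A1\<close> only through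
    \<open>M * A1\<close> and its derivative.\<close>
  have "2 * ((fps_X - 2) * (M * fps_deriv A1) - P * (M * A1) + (M * M) * A0)
      = M * (2 * (fps_X - 1) * fps_deriv A1 - 2 * P * A1 + M * (A2 + A0))
       - M * (2 * fps_deriv A1 + M * (A2 - A0))"
    by (simp add: algebra_simps)
  also have "\<dots> = 0" unfolding P_def E2 E3 by simp
  finally have "(fps_X - 2) * (M * fps_deriv A1) - P * (M * A1) + (M * M) * A0 = 0"
    by (simp only: mult_eq_0_iff) simp
  hence ode: "fps_X * H * fps_deriv (fps_deriv A0) - (H * (P - 2) - P * fps_X) * fps_deriv A0
     + (M * M - P * (P - 1)) * A0 = 0"
    unfolding 1 2 by (simp add: H_def algebra_simps)
  have pw: "fps_deriv (H ^ k) = - (of_nat k * H ^ (k - 1))" for k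
    by (simp add: fps_deriv_power dH fps_of_nat)
  have a0: "A0 = H ^ q * (H * H * Z)" by (simp add: A0 H_def q mult_ac)
  have dHp: "fps_deriv (H ^ p) = - (P * H ^ q)" "fps_deriv (H ^ (p + 1)) = - ((P + 1) * H ^ p)"
    by (simp only: pw, simp add: P_def q)+
  have d1: "fps_deriv A0 = H ^ p * (H * fps_deriv Z - (P + 1) * Z)"
    unfolding A0 H_def [symmetric] fps_deriv_mult dHp by (simp add: algebra_simps)
  hence a1: "fps_deriv A0 = H ^ q * (H * (H * fps_deriv Z - (P + 1) * Z))"
    by (simp add: q mult_ac)
  have "fps_deriv (H * fps_deriv Z - (P + 1) * Z)
      = H * fps_deriv (fps_deriv Z) - (P + 2) * fps_deriv Z"
    by (simp add: dH dP algebra_simps)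
  hence "fps_deriv (fps_deriv A0) = H ^ p * (H * fps_deriv (fps_deriv Z) - (P + 2) * fps_deriv Z)
      - P * H ^ q * (H * fps_deriv Z - (P + 1) * Z)"
    unfolding d1 by (simp add: dHp)
  hence a2: "fps_deriv (fps_deriv A0) = H ^ q * (P * (P + 1) * Z - 2 * (P + 1) * H * fps_deriv Z
      + H * H * fps_deriv (fps_deriv Z))"
    by (simp add: q algebra_simps)
  have "H ^ q * (H * H * (fps_X * H * fps_deriv (fps_deriv Z)
        - (4 * fps_X + 2 * (P - 2)) * fps_deriv Z + (M * M - 2) * Z)) = 0"
  proof -
    have *: "H * (P - 2) - P * fps_X = 2 * (P - 2) - (2 * P - 2) * fps_X"
      by (simp add: H_def algebra_simps)
    have "H ^ q * (H * (fps_X * (P * (P + 1) * Z - 2 * (P + 1) * H * fps_deriv Z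
      + H * H * fps_deriv (fps_deriv Z)) - (H * (P - 2) - P * fps_X) * (H * fps_deriv Z - (P + 1) * Z)
      + (M * M - P * (P - 1)) * (H * Z))) = 0"
      using ode unfolding a2 unfolding a1 unfolding a0 by (simp add: algebra_simps)
    \<comment> \<open>A further factor \<open>H\<close> comes out because \<open>p + 1\<close> is an
      exponent of the equation at its singular point \<open>H = 0\<close>. Cancelling it leaves the
      Jacobi form.\<close>
    moreover have "fps_X * (P * (P + 1) * Z - 2 * (P + 1) * H * fps_deriv Z
      + H * H * fps_deriv (fps_deriv Z)) - (H * (P - 2) - P * fps_X) * (H * fps_deriv Z - (P + 1) * Z)
      + (M * M - P * (P - 1)) * (H * Z)
      = H * (fps_X * H * fps_deriv (fps_deriv Z)
        - (4 * fps_X + 2 * (P - 2)) * fps_deriv Z + (M * M - 2) * Z)"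
      by (simp add: H_def algebra_simps)
    ultimately show ?thesis by (simp add: mult.assoc)
  qed
  moreover have "H \<noteq> 0"
  proof
    assume "H = 0"
    hence "fps_nth H 0 = 0" by simp
    thus False by (simp add: H_def)
  qed
  ultimately have "fps_X * H * fps_deriv (fps_deriv Z)
        - (4 * fps_X + 2 * (P - 2)) * fps_deriv Z + (M * M - 2) * Z = 0" by simp
  hence "2 * (fps_X * fps_deriv (fps_deriv Z)) - fps_X * (fps_X * fps_deriv (fps_deriv Z))
      - 4 * (fps_X * fps_deriv Z) - 2 * (P * fps_deriv Z) + 4 * fps_deriv Z
      + (of_nat l * (of_nat l + 1)) * Z - 2 * Z = 0"
    unfolding M H_def by (simp add: algebra_simps)
  hence "fps_nth (2 * (fps_X * fps_deriv (fps_deriv Z)) - fps_X * (fps_X * fps_deriv (fps_deriv Z))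
      - 4 * (fps_X * fps_deriv Z) - 2 * (P * fps_deriv Z) + 4 * fps_deriv Z
      + (of_nat l * (of_nat l + 1)) * Z - 2 * Z) j = 0" by simp
  moreover have num: "fps_nth (of_nat k * F) j = of_nat k * fps_nth F j"
    "fps_nth (numeral w * F) j = numeral w * fps_nth F j" for k w and F :: "complex fps"
    by (simp_all flip: fps_of_nat add: numeral_fps_const)
  moreover have c: "fps_nth ((of_nat l * (of_nat l + 1)) * Z) j = of_nat l * (of_nat l + 1) * fps_nth Z j"
    by (simp flip: fps_of_nat add: distrib_left distrib_right mult.assoc)
  ultimately have "2 * fps_nth (fps_X * fps_deriv (fps_deriv Z)) j
      - fps_nth (fps_X * (fps_X * fps_deriv (fps_deriv Z))) j - 4 * fps_nth (fps_X * fps_deriv Z) j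
      - 2 * (of_nat p * fps_nth (fps_deriv Z) j) + 4 * fps_nth (fps_deriv Z) j
      + of_nat l * (of_nat l + 1) * fps_nth Z j - 2 * fps_nth Z j = 0"
    by (simp only: fps_sub_nth fps_add_nth num c P_def)
  moreover have "fps_nth (fps_X * fps_deriv (fps_deriv Z)) j = of_nat j * of_nat (j + 1) * fps_nth Z (j + 1)"
    "fps_nth (fps_X * fps_deriv Z) j = of_nat j * fps_nth Z j"
    by (cases j; simp)+
  moreover have "fps_nth (fps_X * (fps_X * fps_deriv (fps_deriv Z))) j = of_nat j * (of_nat j - 1) * fps_nth Z j"
  proof (cases j)
    case (Suc i)
    thus ?thesis by (cases i) simp_all
  qed simp
  moreover have "fps_nth (fps_deriv Z) j = of_nat (j + 1) * fps_nth Z (j + 1)" by simp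
  ultimately have "2 * (of_nat j * of_nat (j + 1) * fps_nth Z (j + 1))
      - of_nat j * (of_nat j - 1) * fps_nth Z j - 4 * (of_nat j * fps_nth Z j)
      - 2 * (of_nat p * (of_nat (j + 1) * fps_nth Z (j + 1))) + 4 * (of_nat (j + 1) * fps_nth Z (j + 1))
      + of_nat l * (of_nat l + 1) * fps_nth Z j - 2 * fps_nth Z j = 0"
    by (simp only:)
  thus ?thesis by (simp add: algebra_simps)
qed

text \<open>At \<open>j = l - 1\<close> the right side of the recurrence is zero, as
  \<open>(j + 1) (j + 2) = l (l + 1)\<close>, while the factor \<open>l + 1 - p\<close> on the left
  is not.\<close>

corollary fps_mode_vanishes:
  fixes A0 A1 A2 Z M :: "complex fps"
  assumes "fps_X * fps_deriv A0 - of_nat p * A0 + M * A1 + A0 = 0"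
    and "2 * fps_deriv A1 + M * (A2 - A0) = 0"
    and "2 * (fps_X - 1) * fps_deriv A1 - 2 * of_nat p * A1 + M * (A2 + A0) = 0"
    and "fps_deriv M = 0" "M * M = of_nat l * (of_nat l + 1)" and "p \<ge> 1"
    and "A0 = (2 - fps_X) ^ (p + 1) * Z" and l: "l \<ge> 1" and "p \<noteq> l + 1"
  shows "fps_nth Z l = 0"
proof -
  obtain j where j: "l = j + 1" using l by (cases l) auto
  have "2 * of_nat (j + 1) * (of_nat j + 2 - of_nat p) * fps_nth Z (j + 1) = 0"
    unfolding fps_mode_recurrence[OF assms(1-7)] by (simp add: j algebra_simps)
  moreover have "of_nat j + 2 - of_nat p \<noteq> (0 :: complex)"
  proof
    assume "of_nat j + 2 - of_nat p = (0 :: complex)"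
    hence "of_nat (j + 2) = (of_nat p :: complex)" by (simp add: add.commute)
    hence "j + 2 = p" by (simp only: of_nat_eq_iff)
    thus False using \<open>p \<noteq> l + 1\<close> j by simp
  qed
  ultimately show ?thesis by (simp add: j del: of_nat_Suc)
qed

text \<open>Here \<open>T\<close> is \<open>1 + x\<close> at an arbitrary base point, as the mode is
  to be followed from the data at \<open>x = 0\<close> to \<open>x = -1\<close>. The last two
  equations give \<open>A1\<close> algebraically; for \<open>p = n + 1\<close>, \<open>l = n\<close>
  one has \<open>l (l + 1) = p (p - 1)\<close>, and just this makes the right sides depend on
  \<open>A0 - A2\<close> alone. So equal constants solve the system, which is where the summand
  \<open>D\<close> of the solution comes from.\<close>

lemma fps_critical_mode:
  fixes A0 A1 A2 M T :: "complex fps"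
  assumes E1: "T * fps_deriv A0 - of_nat (n + 1) * A0 + M * A1 + A0 = 0"
    and E2: "2 * fps_deriv A1 + M * (A2 - A0) = 0"
    and E3: "2 * (T - 1) * fps_deriv A1 - 2 * of_nat (n + 1) * A1 + M * (A2 + A0) = 0"
    and M: "fps_deriv M = 0" "M * M = of_nat n * (of_nat n + 1)" and n: "n \<ge> 1"
    and T: "fps_deriv T = 1"
  shows "2 * T * fps_deriv A0 = of_nat n * (2 - T) * (A0 - A2)"
    and "2 * (2 - T) * fps_deriv A2 = of_nat n * T * (A0 - A2)"
proof -
  define N P :: "complex fps" where "N = of_nat n" and "P = N + 1"
  have P: "of_nat (n + 1) = P" by (simp add: P_def N_def)
  have dP: "fps_deriv P = 0" by (simp add: P_def N_def)
  have MM: "M * M = N * P" using M by (simp add: N_def P_def)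
  have "N \<noteq> 0" using n by (simp add: N_def)
  moreover have "P \<noteq> 0" unfolding P [symmetric] by (simp only: of_nat_eq_0_iff)
  ultimately have M0: "M \<noteq> 0" using MM by auto
  have e2: "2 * fps_deriv A1 = - (M * (A2 - A0))" using E2 by (simp add: eq_neg_iff_add_eq_0)
  have i: "2 * P * A1 = M * ((2 - T) * A2 + T * A0)"
  proof -
    have "2 * P * A1 = (T - 1) * (2 * fps_deriv A1) + M * (A2 + A0)"
      using E3 unfolding P by (simp add: algebra_simps)
    also have "\<dots> = M * ((2 - T) * A2 + T * A0)" unfolding e2 by (simp add: algebra_simps)
    finally show ?thesis .
  qed
  have "fps_deriv (2 * P * A1) = fps_deriv (M * ((2 - T) * A2 + T * A0))" unfolding i ..
  hence "P * (2 * fps_deriv A1) = M * ((2 - T) * fps_deriv A2 - A2 + T * fps_deriv A0 + A0)"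
    by (simp add: dP M T algebra_simps)
  hence "M * (P * (A0 - A2)) = M * ((2 - T) * fps_deriv A2 - A2 + T * fps_deriv A0 + A0)"
    unfolding e2 by (simp add: algebra_simps)
  from mult_left_cancel[OF M0, THEN iffD1, OF this]
  have ii: "N * (A0 - A2) = (2 - T) * fps_deriv A2 + T * fps_deriv A0"
    by (simp add: P_def algebra_simps)
  have "P * (2 * T * fps_deriv A0) = 2 * P * (T * fps_deriv A0 - P * A0 + M * A1 + A0)
      + 2 * P * N * A0 - M * (2 * P * A1)"
    by (simp add: P_def algebra_simps)
  also have "\<dots> = P * (N * (2 - T) * (A0 - A2))"
    unfolding E1[unfolded P] i mult.assoc[symmetric, of M M] MM by (simp add: algebra_simps)
  finally show iii: "2 * T * fps_deriv A0 = of_nat n * (2 - T) * (A0 - A2)"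
    using \<open>P \<noteq> 0\<close> by (simp add: N_def)
  have "2 * (2 - T) * fps_deriv A2 = 2 * ((2 - T) * fps_deriv A2 + T * fps_deriv A0) - 2 * T * fps_deriv A0"
    by (simp add: algebra_simps)
  also have "\<dots> = of_nat n * T * (A0 - A2)"
    unfolding iii ii [symmetric] by (simp add: N_def algebra_simps)
  finally show "2 * (2 - T) * fps_deriv A2 = of_nat n * T * (A0 - A2)" .
qed

text \<open>The probability that a binomial variable with parameters \<open>2 n + 1\<close> and \<open>(1 + x) / 2\<close> is less
  than \<open>n\<close>; this is the function \<open>Q1\<close> of the modes with \<open>p = n + 1\<close>, \<open>l = n\<close>, whereas \<open>Q3\<close> is, up to
  a sign, the complementary probability.\<close>

definition binomial_tail :: "nat \<Rightarrow> real \<Rightarrow> real" where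
  "binomial_tail n x = (\<Sum>j<n. real (2 * n + 1 choose j) * ((1 + x) / 2) ^ j * ((1 - x) / 2) ^ (2 * n + 1 - j))"

text \<open>Both Jacobi polynomials of the critical mode have a parameter that sums with the degree
  to -1. One of the two binomials then degenerates to a sign, and the other one, over
  \<open>2 n + 1\<close>, forms a truncated binomial expansion.\<close>

lemma gbinomial_minus_1: "((-1 :: real) gchoose s) = (-1) ^ s"
  using gbinomial_minus[of "1 :: real" s] by (simp flip: binomial_gbinomial add: of_nat_gbinomial[symmetric])

lemma Q1_eq_binomial_tail:
  assumes n: "n \<ge> 1"
  shows "Q1 (n + 1) n x = binomial_tail n x"
proof -
  have a: "real (n - 1) + (real (n + 1) + 1) = real (2 * n + 1)" "real (n - 1) + (- real (n + 1) + 1) = -1"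
    using n by simp_all
  have "jacobi (n - 1) (real (n + 1) + 1) (- real (n + 1) + 1) x
      = (\<Sum>s=0..n - 1. real (2 * n + 1 choose (n - 1 - s)) * ((1 - x) / 2) ^ s * ((1 + x) / 2) ^ (n - 1 - s))"
    unfolding jacobi_def a gbinomial_minus_1 binomial_gbinomial of_nat_gbinomial
  proof (intro sum.cong refl)
    fix s
    have "(-1) ^ s * ((x - 1) / 2) ^ s = ((1 - x) / 2) ^ s"
      by (simp flip: power_mult_distrib)
    thus "(real (2 * n + 1) gchoose (n - 1 - s)) * (-1) ^ s * ((x - 1) / 2) ^ s * ((x + 1) / 2) ^ (n - 1 - s)
      = (real (2 * n + 1) gchoose (n - 1 - s)) * ((1 - x) / 2) ^ s * ((1 + x) / 2) ^ (n - 1 - s)"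
      by (simp add: mult_ac add_ac)
  qed
  also have "\<dots> = (\<Sum>j<n. real (2 * n + 1 choose j) * ((1 - x) / 2) ^ (n - 1 - j) * ((1 + x) / 2) ^ j)"
    by (rule sum.reindex_bij_witness[of _ "\<lambda>j. n - 1 - j" "\<lambda>j. n - 1 - j"]) (use n in auto)
  finally have "Q1 (n + 1) n x = (\<Sum>j<n. ((1 - x) / 2) ^ (n + 2)
      * (real (2 * n + 1 choose j) * ((1 - x) / 2) ^ (n - 1 - j) * ((1 + x) / 2) ^ j))"
    by (simp add: Q1_def sum_distrib_left)
  also have "\<dots> = binomial_tail n x"
    unfolding binomial_tail_def
  proof (intro sum.cong refl)
    fix j assume "j \<in> {..<n}"
    hence "2 * n + 1 - j = (n + 2) + (n - 1 - j)" by auto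
    thus "((1 - x) / 2) ^ (n + 2) * (real (2 * n + 1 choose j) * ((1 - x) / 2) ^ (n - 1 - j) * ((1 + x) / 2) ^ j)
      = real (2 * n + 1 choose j) * ((1 + x) / 2) ^ j * ((1 - x) / 2) ^ (2 * n + 1 - j)"
      by (simp only: power_add mult_ac)
  qed
  finally show ?thesis .
qed

lemma binomial_tail_complement:
  "(\<Sum>s\<le>n + 1. real (2 * n + 1 choose s) * ((1 - x) / 2) ^ s * ((1 + x) / 2) ^ (2 * n + 1 - s))
     = 1 - binomial_tail n x"
proof -
  define f where "f j = real (2 * n + 1 choose j) * ((1 + x) / 2) ^ j * ((1 - x) / 2) ^ (2 * n + 1 - j)" for j
  have "(\<Sum>j\<le>2 * n + 1. f j) = ((1 + x) / 2 + (1 - x) / 2) ^ (2 * n + 1)"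
    unfolding f_def by (rule binomial_ring [symmetric])
  also have "(1 + x) / 2 + (1 - x) / 2 = 1" by (simp add: field_simps)
  also have "{..2 * n + 1} = {..<n} \<union> {n..2 * n + 1}" by auto
  also have "sum f ({..<n} \<union> {n..2 * n + 1}) = sum f {..<n} + sum f {n..2 * n + 1}"
    by (rule sum.union_disjoint) auto
  also have "sum f {n..2 * n + 1} = (\<Sum>s\<le>n + 1. f (2 * n + 1 - s))"
    by (rule sum.reindex_bij_witness[of _ "\<lambda>j. 2 * n + 1 - j" "\<lambda>j. 2 * n + 1 - j"]) auto
  also have "\<dots> = (\<Sum>s\<le>n + 1. real (2 * n + 1 choose s) * ((1 - x) / 2) ^ s * ((1 + x) / 2) ^ (2 * n + 1 - s))"
  proof (intro sum.cong refl)
    fix s assume "s \<in> {..n + 1}"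
    thus "f (2 * n + 1 - s) = real (2 * n + 1 choose s) * ((1 - x) / 2) ^ s * ((1 + x) / 2) ^ (2 * n + 1 - s)"
      using binomial_symmetric[of s "2 * n + 1"] by (cases "s = 2 * n + 1") (auto simp: f_def mult_ac)
  qed
  finally show ?thesis by (simp add: f_def binomial_tail_def)
qed

lemma Q3_eq_binomial_tail:
  assumes n: "n \<ge> 1"
  shows "(-1) ^ (n + 1) * Q3 (n + 1) n x = 1 - binomial_tail n x"
proof -
  have a: "real (n + 1) + (- real (n + 1) - 1) = -1" "real (n + 1) + (real (n + 1) - 1) = real (2 * n + 1)"
    by simp_all
  have "(-1) ^ (n + 1) * Q3 (n + 1) n x
      = (\<Sum>s=0..n + 1. (-1) ^ (n + 1) * (((1 + x) / 2) ^ n * ((-1) ^ (n + 1 - s) * (real (2 * n + 1) gchoose s)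
         * ((x - 1) / 2) ^ s * ((x + 1) / 2) ^ (n + 1 - s))))"
    unfolding Q3_def jacobi_def a gbinomial_minus_1 by (simp only: sum_distrib_left add_diff_cancel_right')
  also have "\<dots> = (\<Sum>s\<le>n + 1. real (2 * n + 1 choose s) * ((1 - x) / 2) ^ s * ((1 + x) / 2) ^ (2 * n + 1 - s))"
  proof (intro sum.cong)
    fix s assume "s \<in> {..n + 1}"
    hence s: "2 * n + 1 - s = n + (n + 1 - s)" and s': "n + 1 = (n + 1 - s) + s" by auto
    have "(-1) ^ (n + 1) * ((-1) ^ (n + 1 - s) * ((x - 1) / 2) ^ s) = ((-1) * (-1)) ^ (n + 1 - s) * ((-1) * ((x - 1) / 2)) ^ s"
      by (subst s') (simp only: power_add power_mult_distrib mult_ac)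
    also have "\<dots> = ((1 - x) / 2) ^ s" by simp
    finally have *: "(-1) ^ (n + 1) * ((-1) ^ (n + 1 - s) * ((x - 1) / 2) ^ s) = ((1 - x) / 2) ^ s" .
    show "(-1) ^ (n + 1) * (((1 + x) / 2) ^ n * ((-1) ^ (n + 1 - s) * (real (2 * n + 1) gchoose s)
         * ((x - 1) / 2) ^ s * ((x + 1) / 2) ^ (n + 1 - s)))
      = real (2 * n + 1 choose s) * ((1 - x) / 2) ^ s * ((1 + x) / 2) ^ (2 * n + 1 - s)"
      unfolding s * [symmetric] by (simp only: power_add mult_ac add.commute[of x] of_nat_gbinomial binomial_gbinomial)
  qed auto
  finally show ?thesis unfolding binomial_tail_complement .
qed

text \<open>At \<open>x = 0\<close> all products of powers equal \<open>2 ^ -(2 n + 1)\<close>, and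
  the complementary sum exceeds the tail by the two equal central binomials.\<close>

lemma binomial_tail_0: "1 - 2 * binomial_tail n 0 = real (2 * n + 1 choose n) / 4 ^ n"
proof -
  have pw: "(1 / 2 :: real) ^ j * (1 / 2) ^ (2 * n + 1 - j) = (1 / 2) ^ (2 * n + 1)" if "j \<le> 2 * n + 1" for j
    using that by (simp flip: power_add)
  have 1: "binomial_tail n 0 = (\<Sum>j<n. real (2 * n + 1 choose j)) * (1 / 2) ^ (2 * n + 1)"
    unfolding binomial_tail_def sum_distrib_right
    by (intro sum.cong refl) (use pw in \<open>auto simp: mult.assoc\<close>)
  have "(\<Sum>s\<le>n + 1. real (2 * n + 1 choose s) * (1 / 2) ^ s * (1 / 2) ^ (2 * n + 1 - s))
      = (\<Sum>s\<le>n + 1. real (2 * n + 1 choose s)) * (1 / 2) ^ (2 * n + 1)"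
    unfolding sum_distrib_right mult.assoc
  proof (intro sum.cong refl)
    fix s assume "s \<in> {..n + 1}"
    thus "real (2 * n + 1 choose s) * ((1 / 2) ^ s * (1 / 2) ^ (2 * n + 1 - s))
       = real (2 * n + 1 choose s) * (1 / 2) ^ (2 * n + 1)"
      by (cases "s \<le> 2 * n + 1") (simp_all only: pw, auto)
  qed
  hence 2: "1 - binomial_tail n 0 = (\<Sum>s\<le>n + 1. real (2 * n + 1 choose s)) * (1 / 2) ^ (2 * n + 1)"
    using binomial_tail_complement[of n 0] by simp
  have 3: "(\<Sum>s\<le>n + 1. real (2 * n + 1 choose s)) = (\<Sum>j<n. real (2 * n + 1 choose j)) + 2 * real (2 * n + 1 choose n)"
    using binomial_symmetric[of n "2 * n + 1"] by (simp add: lessThan_Suc_atMost [symmetric])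
  have "1 - 2 * binomial_tail n 0 = 2 * real (2 * n + 1 choose n) * (1 / 2) ^ (2 * n + 1)"
    using 1 2 unfolding 3 by (simp add: algebra_simps)
  also have "\<dots> = real (2 * n + 1 choose n) / 4 ^ n"
    by (simp add: power_mult power_divide)
  finally show ?thesis .
qed

text \<open>An incomplete beta function: the derivatives of the summands telescope and only the
  boundary term at \<open>j = n\<close> is left.\<close>

lemma binomial_tail_derivative:
  assumes n: "n \<ge> 1"
  shows "(binomial_tail n has_real_derivative
    - (real n / 2 * real (2 * n + 1 choose n) * ((1 + x) / 2) ^ (n - 1) * ((1 - x) / 2) ^ (n + 1))) (at x within S)"
proof -
  define u w where "u = (1 + x) / 2" and "w = (1 - x) / 2"
  define b where "b j = real j * real (2 * n + 1 choose j) * u ^ (j - 1) * w ^ (2 * n + 1 - j)" for j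
  have "(binomial_tail n has_real_derivative (\<Sum>j<n. 1/2 * (b j - b (Suc j)))) (at x within S)"
    unfolding binomial_tail_def[abs_def]
  proof (rule DERIV_sum)
    fix j assume "j \<in> {..<n}"
    define k where "k = 2 * n - j"
    have k: "2 * n + 1 - j = Suc k" "2 * n + 1 - Suc j = k" using \<open>j \<in> {..<n}\<close> by (auto simp: k_def)
    have "(2 * n + 1 choose j) * (2 * n + 1 - j) = Suc j * (2 * n + 1 choose Suc j)"
      by (metis binomial_absorb_comp binomial_absorption mult.commute)
    hence bin: "real (Suc k) * real (2 * n + 1 choose j) = real (Suc j) * real (2 * n + 1 choose Suc j)"
      unfolding k by (metis of_nat_mult mult.commute)
    have "((\<lambda>x. real (2 * n + 1 choose j) * ((1 + x) / 2) ^ j * ((1 - x) / 2) ^ Suc k) has_real_derivative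
        1/2 * (real j * real (2 * n + 1 choose j) * u ^ (j - 1) * w ^ Suc k
          - (real (Suc k) * real (2 * n + 1 choose j)) * u ^ j * w ^ k)) (at x within S)"
    proof -
      have du: "((\<lambda>x. (1 + x) / 2) has_real_derivative 1 / 2) (at x within S)"
        and dw: "((\<lambda>x. (1 - x) / 2) has_real_derivative - 1 / 2) (at x within S)"
        by (auto intro!: derivative_eq_intros)
      show ?thesis
        using DERIV_cmult[OF DERIV_mult[OF DERIV_power[OF du, of j] DERIV_power[OF dw, of "Suc k"]],
            of "real (2 * n + 1 choose j)"]
        unfolding u_def [symmetric] w_def [symmetric] mult.assoc
        by (rule DERIV_cong) (simp add: algebra_simps)
    qed
    thus "((\<lambda>x. real (2 * n + 1 choose j) * ((1 + x) / 2) ^ j * ((1 - x) / 2) ^ (2 * n + 1 - j)) has_real_derivative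
        1/2 * (b j - b (Suc j))) (at x within S)"
      unfolding b_def bin k by simp
  qed
  also have "(\<Sum>j<n. 1/2 * (b j - b (Suc j))) = 1/2 * (b 0 - b n)"
    unfolding sum_distrib_left [symmetric] sum_lessThan_telescope' ..
  also have "\<dots> = - (real n / 2 * real (2 * n + 1 choose n) * ((1 + x) / 2) ^ (n - 1) * ((1 - x) / 2) ^ (n + 1))"
    by (simp add: b_def u_def w_def)
  finally show ?thesis .
qed

text \<open>The difference \<open>d = f - g\<close> satisfies
  \<open>(1 - x^2) d' = - 2 n x d\<close>, so it is a multiple of \<open>(1 - x^2) ^ n\<close>, and
  the equation for \<open>f'\<close> then makes \<open>f'\<close> a multiple of the derivative of
  \<open>binomial_tail n\<close>. As the equations degenerate at both ends, this is done in the open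
  interval and extended by continuity.\<close>

lemma critical_mode_solution:
  fixes f g f' g' :: "real \<Rightarrow> complex"
  assumes n: "n \<ge> 1"
    and f: "\<And>x. x \<in> {-1..1} \<Longrightarrow> (f has_vector_derivative f' x) (at x within {-1..1})"
    and g: "\<And>x. x \<in> {-1..1} \<Longrightarrow> (g has_vector_derivative g' x) (at x within {-1..1})"
    and f': "\<And>x. x \<in> {-1..1} \<Longrightarrow> 2 * of_real (1 + x) * f' x = of_nat n * of_real (1 - x) * (f x - g x)"
    and g': "\<And>x. x \<in> {-1..1} \<Longrightarrow> 2 * of_real (1 - x) * g' x = of_nat n * of_real (1 + x) * (f x - g x)"
    and C: "of_real (binomial_tail n 0) * C + of_real (1 - binomial_tail n 0) * D = f 0"
    and D: "of_real (1 - binomial_tail n 0) * C + of_real (binomial_tail n 0) * D = g 0"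
    and x: "x \<in> {-1..1}"
  shows "f x = D + (C - D) * of_real (binomial_tail n x)"
proof -
  define d0 where "d0 = f 0 - g 0"
  have d: "f x - g x = d0 * of_real ((1 - x\<^sup>2) ^ n)" if x: "x \<in> {-1<..<1}" for x
  proof -
    define h where "h x = (f x - g x) * of_real (1 / (1 - x\<^sup>2) ^ n)" for x
    have "(h has_vector_derivative 0) (at x within {-1<..<1})" if x: "x \<in> {-1<..<1}" for x
    proof -
      have x1: "x \<in> {-1..1}" and nz: "1 + x \<noteq> 0" "1 - x \<noteq> 0" using x by auto
      have x2: "1 - x\<^sup>2 = (1 + x) * (1 - x)" by (simp add: power2_eq_square algebra_simps)
      hence nz2: "1 - x\<^sup>2 \<noteq> 0" using nz by simp
      have "(f has_vector_derivative f' x) (at x within {-1<..<1})"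
        "(g has_vector_derivative g' x) (at x within {-1<..<1})"
        using f[OF x1] g[OF x1] by (auto intro: has_vector_derivative_within_subset)
      note d = has_vector_derivative_diff[OF this]
      have "((\<lambda>x. 1 / (1 - x\<^sup>2) ^ n) has_real_derivative 2 * real n * x / (1 - x\<^sup>2) ^ (n + 1)) (at x within {-1<..<1})"
      proof -
        obtain k where k: "n = Suc k" using n by (cases n) auto
        have "((\<lambda>x. 1 / (1 - x\<^sup>2)) has_real_derivative 2 * x / (1 - x\<^sup>2)\<^sup>2) (at x within {-1<..<1})"
          using nz2 by (auto intro!: derivative_eq_intros simp: power2_eq_square)
        from DERIV_power[OF this, of n] show ?thesis
          unfolding k power_one_over by (rule DERIV_cong) (simp add: power2_eq_square mult_ac)
      qed
      from has_vector_derivative_mult[OF d has_vector_derivative_of_real[OF this]]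
      have h: "(h has_vector_derivative (f x - g x) * of_real (2 * real n * x / (1 - x\<^sup>2) ^ (n + 1))
          + (f' x - g' x) * of_real (1 / (1 - x\<^sup>2) ^ n)) (at x within {-1<..<1})"
        unfolding h_def[abs_def] .
      have c: "complex_of_real (1 + x) \<noteq> 0" "complex_of_real (1 - x) \<noteq> 0"
        using nz by (simp_all only: of_real_eq_0_iff not_False_eq_True)
      have "2 * (of_real (1 - x\<^sup>2) * (f' x - g' x)) = of_real (1 - x) * (2 * of_real (1 + x) * f' x)
          - of_real (1 + x) * (2 * of_real (1 - x) * g' x)"
        unfolding x2 by (simp add: algebra_simps)
      also have "\<dots> = 2 * (- (2 * of_nat n * of_real x * (f x - g x)))"
        unfolding f'[OF x1] g'[OF x1] by (simp add: algebra_simps)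
      finally have e: "of_real (1 - x\<^sup>2) * (f' x - g' x) = - (2 * of_nat n * of_real x * (f x - g x))"
        by (simp only: mult_cancel_left) simp
      define s where "s = complex_of_real (1 - x\<^sup>2)"
      have s: "s \<noteq> 0" using nz2 unfolding s_def by (simp only: of_real_eq_0_iff not_False_eq_True)
      have e': "f' x - g' x = - (2 * of_nat n * of_real x * (f x - g x)) / s"
        by (simp only: nonzero_eq_divide_eq[OF s] mult.commute[of _ s] e[folded s_def])
      have "(f x - g x) * of_real (2 * real n * x / (1 - x\<^sup>2) ^ (n + 1))
          + (f' x - g' x) * of_real (1 / (1 - x\<^sup>2) ^ n) = 0"
        unfolding e' of_real_divide of_real_power s_def [symmetric] using s by (simp add: field_simps)
      with h show ?thesis by simp
    qed
    from has_vector_derivative_zero_constant[OF _ this] obtain c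
      where c: "\<And>x. x \<in> {-1<..<1} \<Longrightarrow> h x = c" by auto
    have "h x = h 0" using c[OF x] c[of 0] by simp
    moreover have "1 - x\<^sup>2 \<noteq> 0" using x by (auto simp: power2_eq_1_iff)
    hence "complex_of_real ((1 - x\<^sup>2) ^ n) \<noteq> 0" by (simp only: of_real_eq_0_iff power_eq_0_iff) simp
    ultimately show ?thesis by (simp add: h_def d0_def field_simps of_real_divide)
  qed
  \<comment> \<open>The constant \<open>d0\<close> in terms of \<open>C - D\<close>: the factor is
    \<open>2 q - 1\<close> with \<open>q = binomial_tail n 0\<close>, known from
    \<open>binomial_tail_0\<close>. Its denominator \<open>4 ^ n\<close> is compensated by
    \<open>(1 - x^2) ^ n\<close>, which is \<open>4 ^ n\<close> times the \<open>n\<close>-th power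
    of \<open>(1 + x) / 2 * ((1 - x) / 2)\<close>.\<close>
  have c4: "(2 * of_real (binomial_tail n 0) - 1) * (C - D) = d0"
    unfolding d0_def C [symmetric] D [symmetric] by (simp add: algebra_simps)
  have "2 * complex_of_real (binomial_tail n 0) - 1 = of_real (- (1 - 2 * binomial_tail n 0))" by simp
  also have "\<dots> = - of_real (real (2 * n + 1 choose n) / 4 ^ n)" unfolding binomial_tail_0 by simp
  finally have "d0 * 4 ^ n = - of_real (real (2 * n + 1 choose n) / 4 ^ n) * (C - D) * 4 ^ n"
    using c4 by simp
  hence d0: "d0 * 4 ^ n = - (of_nat (2 * n + 1 choose n) * (C - D))" by simp
  have f'_eq: "f' x = (C - D) * of_real (- (real n / 2 * real (2 * n + 1 choose n)
      * ((1 + x) / 2) ^ (n - 1) * ((1 - x) / 2) ^ (n + 1)))" if x: "x \<in> {-1<..<1}" for x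
  proof -
    obtain k where k: "n = Suc k" using n by (cases n) auto
    have "complex_of_real (1 + x) \<noteq> 0" using x by (simp only: of_real_eq_0_iff) auto
    have "2 * of_real (1 + x) * f' x = of_nat n * of_real (1 - x) * (d0 * of_real ((1 - x\<^sup>2) ^ n))"
      using f'[of x] d[OF x] x by simp
    also have "1 - x\<^sup>2 = 4 * ((1 + x) / 2 * ((1 - x) / 2))" by (simp add: power2_eq_square algebra_simps)
    also have "complex_of_real ((4 * ((1 + x) / 2 * ((1 - x) / 2))) ^ n)
        = 4 ^ n * of_real (((1 + x) / 2) ^ n * ((1 - x) / 2) ^ n)"
      by (simp only: power_mult_distrib of_real_mult of_real_power of_real_numeral)
    also have "of_nat n * of_real (1 - x) * (d0 * (4 ^ n * of_real (((1 + x) / 2) ^ n * ((1 - x) / 2) ^ n)))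
        = (d0 * 4 ^ n) * (of_nat n * of_real (1 - x) * of_real (((1 + x) / 2) ^ n * ((1 - x) / 2) ^ n))"
      by (simp only: mult_ac)
    also have "\<dots> = (C - D) * of_real (- (real n * (1 - x) * (((1 + x) / 2) ^ n * ((1 - x) / 2) ^ n)
        * real (2 * n + 1 choose n)))"
      unfolding d0 by (simp only: of_real_mult of_real_minus of_real_of_nat_eq) (simp only: mult_ac mult_minus_left mult_minus_right)
    also have "real n * (1 - x) * (((1 + x) / 2) ^ n * ((1 - x) / 2) ^ n) * real (2 * n + 1 choose n)
        = 2 * (1 + x) * (real n / 2 * real (2 * n + 1 choose n) * ((1 + x) / 2) ^ (n - 1) * ((1 - x) / 2) ^ (n + 1))"
    proof -
      define u w where "u = (1 + x) / 2" and "w = (1 - x) / 2"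
      have uw: "1 + x = 2 * u" "1 - x = 2 * w" by (simp_all add: u_def w_def)
      show ?thesis unfolding u_def [symmetric] w_def [symmetric] uw
        using k by (simp del: of_nat_Suc)
    qed
    also have "(C - D) * of_real (- (2 * (1 + x) * z)) = 2 * of_real (1 + x) * ((C - D) * of_real (- z))" for z
      by (simp add: algebra_simps)
    finally show ?thesis
      using \<open>complex_of_real (1 + x) \<noteq> 0\<close> by (simp only: mult_cancel_left mult_eq_0_iff) simp
  qed
  define r where "r x = f x - (C - D) * of_real (binomial_tail n x)" for x
  have r': "(r has_vector_derivative f' x - (C - D) * of_real (- (real n / 2 * real (2 * n + 1 choose n)
      * ((1 + x) / 2) ^ (n - 1) * ((1 - x) / 2) ^ (n + 1)))) (at x within {-1..1})" if "x \<in> {-1..1}" for x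
    unfolding r_def
    by (intro has_vector_derivative_diff has_vector_derivative_mult_right has_vector_derivative_of_real
        binomial_tail_derivative n f that)
  have const: "r x = r (-1)" if "x \<in> {-1..1}" for x
  proof (rule has_derivative_zero_unique_strong_interval[of "{-1, 1}" "-1" 1 r])
    show "continuous_on {-1..1} r"
      by (rule continuous_on_vector_derivative[OF r'])
    show "(r has_derivative (\<lambda>h. 0)) (at x within {-1..1})" if "x \<in> {-1..1} - {-1, 1}" for x
      using r'[of x] f'_eq[of x] that by (simp add: has_vector_derivative_def)
  qed (use that in auto)
  have "r x = r 0" using const[OF x] const[of 0] by simp
  moreover have "r 0 = D" unfolding r_def C [symmetric] by (simp add: algebra_simps)
  ultimately have "r x = D" by simp
  thus ?thesis by (simp add: r_def diff_eq_eq)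
qed

subsection \<open>Asymptotic expansions and the sphere integral\<close>

text \<open>Taylor's formula with integral remainder at the left end point, where one-sided
  derivatives suffice. The bound is uniform on the interval because the derivative of order
  \<open>N + 1\<close> is continuous.\<close>

lemma jet_taylor_bound:
  assumes F: "jet_on {a..b} F"
  obtains B where "\<And>x. x \<in> {a..b} \<Longrightarrow>
    norm (fps_nth (F x) 0 - (\<Sum>k\<le>N. fps_nth (F a) k * of_real ((x - a) ^ k))) \<le> B * (x - a) ^ (N + 1)"
proof -
  define Df where "Df i x = fact i * fps_nth (F x) i" for i x
  have Df: "(Df i has_vector_derivative Df (Suc i) x) (at x within {a..b})" if "x \<in> {a..b}" for i x
    unfolding Df_def using has_vector_derivative_mult_right[OF jet_onD[OF F that, of i], of "fact i"]
    by (simp add: mult_ac)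
  have "continuous_on {a..b} (Df (N + 1))"
    by (rule continuous_on_vector_derivative[OF Df])
  hence "bounded (Df (N + 1) ` {a..b})"
    by (intro compact_imp_bounded compact_continuous_image) auto
  then obtain K where K: "K > 0" "\<And>x. x \<in> {a..b} \<Longrightarrow> norm (Df (N + 1) x) \<le> K"
    unfolding bounded_pos by blast
  show ?thesis
  proof (rule that[of K])
    fix x assume x: "x \<in> {a..b}"
    let ?i = "\<lambda>t. ((x - t) ^ (N + 1 - 1) / fact (N + 1 - 1)) *\<^sub>R Df (N + 1) t"
    have "(?i has_integral (Df 0 x - (\<Sum>i<N + 1. ((x - a) ^ i / fact i) *\<^sub>R Df i a))) {a..x}"
    proof (rule Taylor_has_integral)
      show "(Df m has_vector_derivative Df (Suc m) t) (at t within {a..x})" if "a \<le> t" "t \<le> x" for m t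
        by (rule has_vector_derivative_within_subset[OF Df]) (use that x in auto)
    qed (use x in auto)
    moreover have "norm (?i t) \<le> K * (x - a) ^ N" if "t \<in> {a..x}" for t
    proof -
      have "(x - t) ^ N / fact N \<le> (x - t) ^ N / 1"
        using that by (intro divide_left_mono) (auto simp: fact_ge_1)
      also have "\<dots> \<le> (x - a) ^ N" using that by (simp add: power_mono)
      finally have "(x - t) ^ N / fact N * norm (Df (N + 1) t) \<le> (x - a) ^ N * K"
        using that x by (intro mult_mono K) auto
      moreover have "norm (?i t) = (x - t) ^ N / fact N * norm (Df (N + 1) t)"
        using that by simp
      ultimately show ?thesis by (simp only: mult.commute[of K])
    qed
    ultimately have "norm (Df 0 x - (\<Sum>i<N + 1. ((x - a) ^ i / fact i) *\<^sub>R Df i a))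
        \<le> K * (x - a) ^ N * measure lborel {a..x}"
      using x K by (intro has_integral_bound_real[of _ "{}"]) auto
    also have "measure lborel {a..x} = x - a" using x by simp
    also have "(\<Sum>i<N + 1. ((x - a) ^ i / fact i) *\<^sub>R Df i a)
        = (\<Sum>k\<le>N. fps_nth (F a) k * of_real ((x - a) ^ k))"
      by (intro sum.cong) (auto simp: Df_def scaleR_conv_of_real)
    finally show "norm (fps_nth (F x) 0 - (\<Sum>k\<le>N. fps_nth (F a) k * of_real ((x - a) ^ k)))
        \<le> K * (x - a) ^ (N + 1)"
      by (simp add: Df_def mult_ac)
  qed
qed

section \<open>Uniqueness and existence of the radial expansion\<close>

lemma radial_expansion_unique:
  assumes "is_radial_expansion \<phi> v \<theta> \<alpha> c" "is_radial_expansion \<phi> v \<theta> \<alpha> c'"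
  shows "c = c'"
proof
  fix N
  show "c N = c' N"
  proof (induction N rule: less_induct)
    case (less N)
    have "(\<lambda>r. (phi2_phys \<phi> (tau_of v r) (rho_of v r) \<theta> \<alpha> - (\<Sum>k\<le>N. c' k / of_real (r ^ (3 + k))))
        - (phi2_phys \<phi> (tau_of v r) (rho_of v r) \<theta> \<alpha> - (\<Sum>k\<le>N. c k / of_real (r ^ (3 + k)))))
        \<in> o[at_top](\<lambda>r. complex_of_real (1 / r ^ (3 + N)))"
      by (rule sum_in_smallo(2)[OF assms(2)[unfolded is_radial_expansion_def, rule_format]
            assms(1)[unfolded is_radial_expansion_def, rule_format]])
    also have "(\<lambda>r. (phi2_phys \<phi> (tau_of v r) (rho_of v r) \<theta> \<alpha> - (\<Sum>k\<le>N. c' k / of_real (r ^ (3 + k))))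
        - (phi2_phys \<phi> (tau_of v r) (rho_of v r) \<theta> \<alpha> - (\<Sum>k\<le>N. c k / of_real (r ^ (3 + k)))))
      = (\<lambda>r. (c N - c' N) / of_real (r ^ (3 + N)))"
    proof
      fix r :: real
      have "(\<Sum>k<N. c' k / of_real (r ^ (3 + k))) = (\<Sum>k<N. c k / of_real (r ^ (3 + k)))"
        using less by (intro sum.cong) auto
      thus "(phi2_phys \<phi> (tau_of v r) (rho_of v r) \<theta> \<alpha> - (\<Sum>k\<le>N. c' k / of_real (r ^ (3 + k))))
        - (phi2_phys \<phi> (tau_of v r) (rho_of v r) \<theta> \<alpha> - (\<Sum>k\<le>N. c k / of_real (r ^ (3 + k))))
        = (c N - c' N) / of_real (r ^ (3 + N))"
        by (simp add: lessThan_Suc_atMost [symmetric] diff_divide_distrib)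
    qed
    finally have "((\<lambda>r. (c N - c' N) / of_real (r ^ (3 + N)) / complex_of_real (1 / r ^ (3 + N))) \<longlongrightarrow> 0) at_top"
      by (rule smalloD_tendsto)
    moreover have "\<forall>\<^sub>F r in at_top. (c N - c' N) / of_real (r ^ (3 + N)) / complex_of_real (1 / r ^ (3 + N)) = c N - c' N"
      using eventually_gt_at_top[of "0 :: real"] by eventually_elim simp
    ultimately have "((\<lambda>r :: real. c N - c' N) \<longlongrightarrow> 0) at_top"
      by (rule Lim_transform_eventually)
    thus "c N = c' N" by (simp add: tendsto_const_iff)
  qed
qed

lemma phi2_coeff_eqI:
  assumes "is_radial_expansion \<phi> v \<theta> \<alpha> c"
  shows "phi2_coeff \<phi> k v \<theta> \<alpha> = c k"
proof -
  have "(THE c. is_radial_expansion \<phi> v \<theta> \<alpha> c) = c"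
    using assms radial_expansion_unique by blast
  thus ?thesis by (simp add: phi2_coeff_def)
qed

text \<open>With \<open>\<rho> = 1 / (v (1 - x))\<close> the physical component is
  \<open>4 v r ^ -3\<close> times \<open>\<phi> 0 / (1 - x)\<close>, and
  \<open>x + 1 = v / r\<close> turns the Taylor term \<open>u k (x + 1) ^ k\<close> into
  \<open>u k v ^ k / r ^ k\<close>. The ray meets \<open>x = -1\<close> only in the limit, so
  \<open>h\<close> need represent the field for \<open>x > -1\<close>.\<close>

lemma is_radial_expansionI:
  assumes v: "v > 0" and x1: "x1 > -1"
    and h: "\<And>x. x \<in> {-1<..x1} \<Longrightarrow> x < 1 \<Longrightarrow>
       of_real (1 / (1 - x)) * \<phi> 0 x (1 / (v * (1 - x))) \<theta> \<alpha> = h x"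
    and bound: "\<And>N. \<exists>B. \<forall>x\<in>{-1..x1}. norm (h x - (\<Sum>k\<le>N. u k * of_real ((x + 1) ^ k))) \<le> B * (x + 1) ^ (N + 1)"
  shows "is_radial_expansion \<phi> v \<theta> \<alpha> (\<lambda>k. 4 * of_real v ^ (k + 1) * u k)"
  unfolding is_radial_expansion_def
proof
  fix N
  obtain B where B: "\<And>x. x \<in> {-1..x1} \<Longrightarrow>
      norm (h x - (\<Sum>k\<le>N. u k * of_real ((x + 1) ^ k))) \<le> B * (x + 1) ^ (N + 1)"
    using bound by blast
  let ?f = "\<lambda>r. phi2_phys \<phi> (tau_of v r) (rho_of v r) \<theta> \<alpha>
     - (\<Sum>k\<le>N. 4 * of_real v ^ (k + 1) * u k / of_real (r ^ (3 + k)))"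
  let ?g = "\<lambda>r. complex_of_real (1 / r ^ (3 + N))"
  have ev: "\<forall>\<^sub>F r in at_top. r > v \<and> v / r \<le> x1 + 1 \<and> r > 0"
    using eventually_gt_at_top[of v] eventually_gt_at_top[of 0] eventually_ge_at_top[of "v / (x1 + 1)"]
    by eventually_elim (use x1 in \<open>auto simp: field_simps\<close>)
  have "\<forall>\<^sub>F r in at_top. norm (?f r / ?g r) \<le> 4 * v * B * v ^ (N + 1) / r"
    using ev
  proof eventually_elim
    case (elim r)
    define x where "x = tau_of v r"
    have r: "r > 0" "r > v / 2" using elim v by auto
    have x1': "x + 1 = v / r" by (simp add: x_def tau_of_def)
    have "v / r > 0" "v / r < 1" using elim v by auto
    hence x: "x \<in> {-1<..x1}" "x < 1" using elim x1' by (simp_all only: greaterThanAtMost_iff) linarith+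
    have rho: "rho_of v r = 1 / (v * (1 - x))" by (simp add: rho_of_def x_def)
    have rad: "phys_radius x (rho_of v r) = r" unfolding x_def by (rule phys_radius_inverse[OF v r(2)])
    have "4 / (rho_of v r * (1 - x)\<^sup>2) = 4 * v * (1 / (1 - x))"
      unfolding rho using x v by (simp add: power2_eq_square)
    hence "phi2_prime \<phi> x (rho_of v r) \<theta> \<alpha> = of_real (4 * v) * h x"
      unfolding phi2_prime_def h[OF x, symmetric] rho by simp
    hence phys: "phi2_phys \<phi> x (rho_of v r) \<theta> \<alpha> = of_real (4 * v / r ^ 3) * h x"
      by (simp add: phi2_phys_def rad)
    have s: "(\<Sum>k\<le>N. 4 * of_real v ^ (k + 1) * u k / of_real (r ^ (3 + k)))
        = of_real (4 * v / r ^ 3) * (\<Sum>k\<le>N. u k * of_real ((x + 1) ^ k))"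
      unfolding x1' sum_distrib_left
      by (intro sum.cong refl) (simp add: power_add power_divide mult_ac)
    have "?f r / ?g r = of_real (4 * v * r ^ N) * (h x - (\<Sum>k\<le>N. u k * of_real ((x + 1) ^ k)))"
      unfolding x_def [symmetric] phys s using r by (simp add: power_add field_simps)
    hence "norm (?f r / ?g r) = 4 * v * r ^ N * norm (h x - (\<Sum>k\<le>N. u k * of_real ((x + 1) ^ k)))"
      using r v by (simp only: norm_mult norm_of_real) simp
    also have "\<dots> \<le> 4 * v * r ^ N * (B * (x + 1) ^ (N + 1))"
      using r v x by (intro mult_left_mono B) auto
    also have "\<dots> = 4 * v * B * v ^ (N + 1) / r"
      unfolding x1' using r by (simp add: power_divide field_simps)
    finally show ?case .
  qed
  moreover have "((\<lambda>r. 4 * v * B * v ^ (N + 1) / r) \<longlongrightarrow> 0) at_top"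
    by (intro tendsto_divide_0[OF tendsto_const] filterlim_at_top_imp_at_infinity filterlim_ident)
  ultimately have "((\<lambda>r. ?f r / ?g r) \<longlongrightarrow> 0) at_top"
    by (rule Lim_null_comparison)
  moreover have "\<forall>\<^sub>F r in at_top. ?g r \<noteq> 0"
    using eventually_gt_at_top[of "0 :: real"] by eventually_elim simp
  ultimately show "?f \<in> o[at_top](?g)" by (rule smalloI_tendsto)
qed

section \<open>Limits under the sphere integral\<close>

lemma sphere_integral_cong:
  assumes "\<And>\<theta> \<alpha>. \<theta> \<in> {0<..<pi} \<Longrightarrow> f \<theta> \<alpha> = g \<theta> \<alpha>"
  shows "sphere_integral f = sphere_integral g"
  unfolding sphere_integral_def set_lebesgue_integral_def
  by (rule Bochner_Integration.integral_cong) (auto simp: indicator_def assms)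

lemma sphere_integral_cmult: "sphere_integral (\<lambda>\<theta> \<alpha>. c * f \<theta> \<alpha>) = c * sphere_integral f"
  unfolding sphere_integral_def set_lebesgue_integral_def integral_mult_right_zero [symmetric]
  by (simp add: mult.left_commute)

lemma sphere_continuous_bounded:
  assumes "sphere_continuous f"
  obtains K where "K > 0" "\<And>\<theta> \<alpha>. \<theta> \<in> {0<..<pi} \<Longrightarrow> \<alpha> \<in> {0<..<2 * pi} \<Longrightarrow> norm (f \<theta> \<alpha>) \<le> K"
proof -
  have "bounded ((\<lambda>x. f (fst x) (snd x)) ` cbox (0, 0) (pi, 2 * pi))"
    using assms unfolding sphere_continuous_def
    by (intro compact_imp_bounded compact_continuous_image compact_cbox)
  then obtain K where "K > 0" "\<And>x. x \<in> cbox (0, 0) (pi, 2 * pi) \<Longrightarrow> norm (f (fst x) (snd x)) \<le> K"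
    unfolding bounded_pos by blast
  thus ?thesis by (intro that[of K]) force+
qed

text \<open>Dominated convergence. Nothing is known about \<open>G\<close> beyond the convergence,
  from which its measurability on the open rectangle is deduced.\<close>

lemma sphere_integral_uniform_limit:
  assumes F: "\<And>N. sphere_continuous (F N)" and H: "sphere_continuous H"
    and lim: "uniform_limit ({0<..<pi} \<times> UNIV) (\<lambda>N (\<theta>, \<alpha>). F N \<theta> \<alpha>) (\<lambda>(\<theta>, \<alpha>). G \<theta> \<alpha>) sequentially"
  shows "(\<lambda>N. sphere_integral (\<lambda>\<theta> \<alpha>. H \<theta> \<alpha> * F N \<theta> \<alpha>)) \<longlonglongrightarrow> sphere_integral (\<lambda>\<theta> \<alpha>. H \<theta> \<alpha> * G \<theta> \<alpha>)"
proof -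
  let ?S = "{0<..<pi} \<times> {0<..<2 * pi} :: (real \<times> real) set"
  have "\<forall>\<^sub>F N in sequentially. \<forall>x\<in>{0<..<pi} \<times> UNIV. dist (case x of (\<theta>, \<alpha>) \<Rightarrow> F N \<theta> \<alpha>) (case x of (\<theta>, \<alpha>) \<Rightarrow> G \<theta> \<alpha>) < 1"
    by (rule uniform_limitD[OF lim]) simp
  then obtain N0 where "\<forall>N\<ge>N0. \<forall>x\<in>{0<..<pi} \<times> UNIV.
      dist (case x of (\<theta>, \<alpha>) \<Rightarrow> F N \<theta> \<alpha>) (case x of (\<theta>, \<alpha>) \<Rightarrow> G \<theta> \<alpha>) < 1"
    unfolding eventually_sequentially by blast
  hence N0: "\<And>N \<theta> \<alpha>. N \<ge> N0 \<Longrightarrow> \<theta> \<in> {0<..<pi} \<Longrightarrow> dist (F N \<theta> \<alpha>) (G \<theta> \<alpha>) < 1"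
    by auto
  obtain K0 where K0: "K0 > 0" "\<And>\<theta> \<alpha>. \<theta> \<in> {0<..<pi} \<Longrightarrow> \<alpha> \<in> {0<..<2 * pi} \<Longrightarrow> norm (F N0 \<theta> \<alpha>) \<le> K0"
    using sphere_continuous_bounded[OF F] by blast
  obtain K where K: "K > 0" "\<And>\<theta> \<alpha>. \<theta> \<in> {0<..<pi} \<Longrightarrow> \<alpha> \<in> {0<..<2 * pi} \<Longrightarrow> norm (H \<theta> \<alpha>) \<le> K"
    using sphere_continuous_bounded[OF H] by blast
  \<comment> \<open>The dominating constant: \<open>F N0\<close> is bounded by continuity on the
    closed rectangle, and every later \<open>F N\<close> is within 2 of it, as both are within 1 of
    \<open>G\<close>.\<close>
  have FB: "norm (F N \<theta> \<alpha>) \<le> K0 + 2" if "N \<ge> N0" "\<theta> \<in> {0<..<pi}" "\<alpha> \<in> {0<..<2 * pi}" for N \<theta> \<alpha>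
  proof -
    have "norm (F N \<theta> \<alpha>) \<le> norm (F N0 \<theta> \<alpha>) + dist (F N \<theta> \<alpha>) (F N0 \<theta> \<alpha>)"
      unfolding dist_norm by (metis add.commute norm_triangle_sub)
    also have "dist (F N \<theta> \<alpha>) (F N0 \<theta> \<alpha>) \<le> dist (F N \<theta> \<alpha>) (G \<theta> \<alpha>) + dist (F N0 \<theta> \<alpha>) (G \<theta> \<alpha>)"
      by (rule dist_triangle2)
    finally show ?thesis
      using N0[of N \<theta> \<alpha>] N0[of N0 \<theta> \<alpha>] K0(2)[of \<theta> \<alpha>] that by auto
  qed
  define f where "f N x = indicator ?S x *\<^sub>R (of_real (sin (fst x)) * (H (fst x) (snd x) * F N (fst x) (snd x)))" for N and x :: "real \<times> real"
  define g where "g x = indicator ?S x *\<^sub>R (of_real (sin (fst x)) * (H (fst x) (snd x) * G (fst x) (snd x)))" for x :: "real \<times> real"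
  have fm: "integrable lborel (f N)" for N
  proof -
    have "sphere_continuous (\<lambda>\<theta> \<alpha>. H \<theta> \<alpha> * F N \<theta> \<alpha>)"
      using F[of N] H unfolding sphere_continuous_def by (intro continuous_intros)
    from sphere_continuous_set_integrable[OF this] show ?thesis
      by (simp add: set_integrable_def f_def[abs_def])
  qed
  have fl: "(\<lambda>N. f N x) \<longlonglongrightarrow> g x" for x
  proof (cases "x \<in> ?S")
    case True
    have "(\<lambda>N. F N (fst x) (snd x)) \<longlonglongrightarrow> G (fst x) (snd x)"
      using tendsto_uniform_limitI[OF lim, of x] True by (auto simp: split_beta)
    thus ?thesis unfolding f_def g_def by (intro tendsto_intros)
  qed (simp add: f_def g_def)
  have "(\<lambda>N. integral\<^sup>L lborel (f (N + N0))) \<longlonglongrightarrow> integral\<^sup>L lborel g"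
  proof (rule integral_dominated_convergence)
    have m: "f N \<in> borel_measurable lborel" for N using fm by (rule borel_measurable_integrable)
    show "f (N + N0) \<in> borel_measurable lborel" for N by (rule m)
    show "g \<in> borel_measurable lborel" by (rule borel_measurable_LIMSEQ_metric[OF m fl])
    show "integrable lborel (\<lambda>x :: real \<times> real. indicator ?S x *\<^sub>R (K * (K0 + 2)))"
    proof -
      have "?S \<in> sets lborel" by (simp flip: open_box_eq)
      moreover have "emeasure lborel ?S < \<infinity>"
        unfolding open_box_eq [symmetric] by (rule emeasure_lborel_box_finite)
      ultimately show ?thesis by (intro integrable_scaleR_left integrable_real_indicator) auto
    qed
    show "AE x in lborel. (\<lambda>N. f (N + N0) x) \<longlonglongrightarrow> g x"
      using LIMSEQ_ignore_initial_segment[OF fl] by simp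
    show "AE x in lborel. norm (f (N + N0) x) \<le> indicator ?S x *\<^sub>R (K * (K0 + 2))" for N
    proof (rule AE_I2)
      fix x :: "real \<times> real"
      show "norm (f (N + N0) x) \<le> indicator ?S x *\<^sub>R (K * (K0 + 2))"
      proof (cases "x \<in> ?S")
        case True
        hence "norm (H (fst x) (snd x)) \<le> K" "norm (F (N + N0) (fst x) (snd x)) \<le> K0 + 2"
          using K(2) FB[of "N + N0" "fst x" "snd x"] by auto
        hence "\<bar>sin (fst x)\<bar> * (norm (H (fst x) (snd x)) * norm (F (N + N0) (fst x) (snd x))) \<le> 1 * (K * (K0 + 2))"
          using K K0 by (intro mult_mono) auto
        thus ?thesis using True by (simp add: f_def norm_mult)
      qed (simp add: f_def)
    qed
  qed
  hence "(\<lambda>N. integral\<^sup>L lborel (f N)) \<longlonglongrightarrow> integral\<^sup>L lborel g"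
    by (rule LIMSEQ_offset)
  thus ?thesis
    by (simp add: sphere_integral_def set_lebesgue_integral_def f_def[abs_def] g_def[abs_def])
qed

subsection \<open>The modes of a Maxwell field\<close>

lemma jet_on_fps_const: "fps_deriv c = 0 \<Longrightarrow> jet_on S (\<lambda>_. c)"
  by (metis fps_deriv_eq_0_iff jet_on_const)

lemma jet_on_diff:
  assumes "jet_on S F" "jet_on S G"
  shows "jet_on S (\<lambda>x. F x - G x)"
  using jet_on_add[OF assms(1) jet_on_mult[OF jet_on_const[of S "-1"] assms(2)]]
  by (simp flip: fps_const_neg)

lemma fps_nth_X_power_mult_2_minus_X_power:
  assumes "j + k < n"
  shows "fps_nth (fps_X ^ j * (2 - fps_X) ^ k :: complex fps) n = 0"
proof -
  have "fps_nth ((2 - fps_X) ^ k :: complex fps) i = 0" if "k < i" for i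
    using that
  proof (induction k arbitrary: i)
    case (Suc k)
    obtain i' where i: "i = Suc i'" using Suc.prems by (cases i) auto
    have eq: "((2 - fps_X) ^ Suc k :: complex fps) = fps_const 2 * (2 - fps_X) ^ k - fps_X * (2 - fps_X) ^ k"
      by (simp add: algebra_simps numeral_fps_const)
    show ?case unfolding eq using Suc.IH[of i] Suc.IH[of i'] Suc.prems i by simp
  qed simp
  thus ?thesis using assms by (simp add: fps_X_power_mult_nth)
qed

text \<open>At \<open>x = -1\<close> the local variable is \<open>X = 1 + x\<close>, so
  \<open>2 - X\<close> is \<open>1 - x\<close> and multiplication by
  \<open>geometric_jet (-1)\<close> undoes it.\<close>

lemma two_minus_X_times_geometric_jet:
  "(2 - fps_X) ^ k * geometric_jet (-1) ^ k = 1"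
proof -
  have "(2 - fps_X) * geometric_jet (-1) = (fps_const (of_real (1 - (-1))) - fps_X) * geometric_jet (-1)"
    by (simp add: numeral_fps_const)
  also have "\<dots> = 1" by (rule geometric_jet_inverse) simp
  finally show ?thesis by (simp flip: power_mult_distrib)
qed

context expansion
begin

definition coeff_jet :: "nat \<Rightarrow> nat \<Rightarrow> nat \<Rightarrow> int \<Rightarrow> real \<Rightarrow> complex fps" where
  "coeff_jet n p l m x = Abs_fps (\<lambda>i. (d1_tau ^^ i) (a n p l m) x / fact i)"

lemma coeff_jet_nth_0 [simp]: "fps_nth (coeff_jet n p l m x) 0 = a n p l m x"
  and coeff_jet_nth_1: "fps_nth (coeff_jet n p l m x) 1 = d1_tau (a n p l m) x"
  by (simp_all add: coeff_jet_def)

lemma jet_on_coeff: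
  assumes "n \<le> 2" "(l, m) \<in> modes (nat \<bar>spin n\<bar>) p"
  shows "jet_on {-1..1} (coeff_jet n p l m)"
  unfolding jet_on_def coeffs_have_derivative_def
proof (intro ballI allI)
  fix x :: real and i
  assume x: "x \<in> {-1..1}"
  from has_vector_derivative_mult_left[OF coeff_has_derivative[OF assms x, of i], of "1 / fact i"]
  show "((\<lambda>x. fps_nth (coeff_jet n p l m x) i) has_vector_derivative
      fps_nth (fps_deriv (coeff_jet n p l m x)) i) (at x within {-1..1})"
    by (simp add: coeff_jet_def field_simps del: of_nat_Suc)
qed

context
  fixes p l :: nat and m :: int and M :: "complex fps" and A :: "nat \<Rightarrow> real \<Rightarrow> complex fps"
  assumes maxwell: "maxwell \<phi>" and lp: "1 \<le> l" "l \<le> p" and m: "\<bar>m\<bar> \<le> int l"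
  defines "M \<equiv> fps_const (of_real (eth_factor 0 l))" and "A \<equiv> \<lambda>n. coeff_jet n p l m"
begin

lemma M_squared: "M * M = of_nat l * (of_nat l + 1)" and M_deriv: "fps_deriv M = 0"
proof -
  have "eth_factor 0 l * eth_factor 0 l = real (l * (l + 1))"
    by (simp add: eth_factor_def algebra_simps)
  hence "complex_of_real (eth_factor 0 l) * of_real (eth_factor 0 l) = of_nat (l * (l + 1))"
    by (simp only: of_real_mult [symmetric] of_real_of_nat_eq)
  thus "M * M = of_nat l * (of_nat l + 1)"
    by (simp add: M_def) (simp flip: fps_of_nat add: algebra_simps)
qed (simp add: M_def)

lemma jet_on_A: "n \<le> 2 \<Longrightarrow> jet_on {-1..1} (A n)"
  unfolding A_def by (rule jet_on_coeff) (use lp m in \<open>auto simp: spin_def\<close>)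

text \<open>The left sides are jets, \<open>T\<close> being that of \<open>1 + x\<close>, and their
  constant coefficients are the projected Maxwell equations; \<open>jet_on_eq_0\<close> supplies all
  the others, at \<open>x = -1\<close> as well.\<close>

lemma
  assumes x: "x \<in> {-1..1}"
  defines "T \<equiv> 1 + (fps_const (of_real x) + fps_X)"
  shows jet_equation_0: "T * fps_deriv (A 0 x) - of_nat p * A 0 x + M * A 1 x + A 0 x = 0"
    and jet_equation_1: "2 * fps_deriv (A 1 x) + M * (A 2 x - A 0 x) = 0"
    and jet_equation_2: "2 * (T - 1) * fps_deriv (A 1 x) - 2 * of_nat p * A 1 x + M * (A 2 x + A 0 x) = 0"
proof -
  note A = jet_on_A[of 0] jet_on_A[of 1] jet_on_A[of 2]
  note jets = jet_on_add jet_on_diff jet_on_mult jet_on_deriv jet_on_X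
  have c: "jet_on S (\<lambda>_. M)" "jet_on S (\<lambda>_. of_nat k)" "jet_on S (\<lambda>_. 1)" "jet_on S (\<lambda>_. 2)" for S k
    by (auto intro!: jet_on_fps_const simp: M_deriv)
  define T' where "T' x = 1 + (fps_const (complex_of_real x) + fps_X)" for x
  have T: "jet_on S T'" for S unfolding T'_def[abs_def] by (intro jets c)
  note mode = maxwell_mode_0[OF maxwell lp m] maxwell_mode_1[OF maxwell lp m] maxwell_mode_3[OF maxwell lp m]
  have nth1: "fps_nth (A n x) (Suc 0) = d1_tau (a n p l m) x" for n x
    using coeff_jet_nth_1 by (simp add: A_def)
  have "T' x * fps_deriv (A 0 x) - of_nat p * A 0 x + M * A 1 x + A 0 x = 0"
  proof (rule jet_on_eq_0[OF _ _ _ x])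
    show "jet_on {-1..1} (\<lambda>x. T' x * fps_deriv (A 0 x) - of_nat p * A 0 x + M * A 1 x + A 0 x)"
      by (intro jets c T) (use A in auto)
    show "fps_nth (T' x * fps_deriv (A 0 x) - of_nat p * A 0 x + M * A 1 x + A 0 x) 0 = 0"
      if "x \<in> {-1..1}" for x
      using mode(1)[OF that] nth1 by (simp add: T'_def A_def M_def)
  qed simp
  thus "T * fps_deriv (A 0 x) - of_nat p * A 0 x + M * A 1 x + A 0 x = 0"
    by (simp add: T_def T'_def)
  show "2 * fps_deriv (A 1 x) + M * (A 2 x - A 0 x) = 0"
  proof (rule jet_on_eq_0[OF _ _ _ x])
    show "jet_on {-1..1} (\<lambda>x. 2 * fps_deriv (A 1 x) + M * (A 2 x - A 0 x))"
      by (intro jets c T) (use A in auto)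
    show "fps_nth (2 * fps_deriv (A 1 x) + M * (A 2 x - A 0 x)) 0 = 0" if "x \<in> {-1..1}" for x
      using mode(2)[OF that] nth1 by (simp add: A_def M_def)
  qed simp
  have "2 * (T' x - 1) * fps_deriv (A 1 x) - 2 * of_nat p * A 1 x + M * (A 2 x + A 0 x) = 0"
  proof (rule jet_on_eq_0[OF _ _ _ x])
    show "jet_on {-1..1} (\<lambda>x. 2 * (T' x - 1) * fps_deriv (A 1 x) - 2 * of_nat p * A 1 x + M * (A 2 x + A 0 x))"
      by (intro jets c T) (use A in auto)
    show "fps_nth (2 * (T' x - 1) * fps_deriv (A 1 x) - 2 * of_nat p * A 1 x + M * (A 2 x + A 0 x)) 0 = 0"
      if "x \<in> {-1..1}" for x
      using mode(3)[OF that] nth1 by (simp add: T'_def A_def M_def)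
  qed simp
  thus "2 * (T - 1) * fps_deriv (A 1 x) - 2 * of_nat p * A 1 x + M * (A 2 x + A 0 x) = 0"
    by (simp add: T_def T'_def)
qed

lemma mode_vanishes:
  assumes "p \<noteq> l + 1"
  shows "fps_nth (A 0 (-1) * geometric_jet (-1) ^ (p + 1)) l = 0"
proof -
  have T: "1 + (fps_const (complex_of_real (-1)) + fps_X) = fps_X"
    by (simp flip: fps_const_neg)
  have x: "-1 \<in> {-1..1::real}" by simp
  have "A 0 (-1) = ((2 - fps_X) ^ (p + 1) * geometric_jet (-1) ^ (p + 1)) * A 0 (-1)"
    unfolding two_minus_X_times_geometric_jet by simp
  hence A: "A 0 (-1) = (2 - fps_X) ^ (p + 1) * (A 0 (-1) * geometric_jet (-1) ^ (p + 1))"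
    by (simp only: mult_ac)
  show ?thesis
    by (rule fps_mode_vanishes[OF jet_equation_0[OF x, unfolded T] jet_equation_1[OF x]
          jet_equation_2[OF x, unfolded T] M_deriv M_squared _ A])
      (use lp assms in auto)
qed

end

text \<open>At \<open>\<tau> = 0\<close> the arguments \<open>\<tau>\<close> and
  \<open>- \<tau>\<close> coincide, and the signs in \<open>X_matrix\<close> absorb those of
  \<open>Q3\<close>. With \<open>q = binomial_tail n 0\<close> the matrix has \<open>q\<close> on
  and \<open>1 - q\<close> off the diagonal; its determinant is \<open>- (1 - 2 q)\<close>, which is
  not zero by \<open>binomial_tail_0\<close>.\<close>

lemma CD_vector_equations:
  fixes n :: nat and m :: int
  assumes n: "n \<ge> 1"
  defines "v \<equiv> CD_vector a (n + 1) n m"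
  shows "of_real (binomial_tail n 0) * v $ 1 + of_real (1 - binomial_tail n 0) * v $ 2 = a 0 (n + 1) n m 0"
    and "of_real (1 - binomial_tail n 0) * v $ 1 + of_real (binomial_tail n 0) * v $ 2 = a 2 (n + 1) n m 0"
proof -
  define q where "q = binomial_tail n 0"
  define X where "X = X_matrix (n + 1) n 0"
  define b :: "complex^2" where "b = vector [a 0 (n + 1) n m 0, a 2 (n + 1) n m 0]"
  have X: "X $ 1 $ 1 = of_real q" "X $ 1 $ 2 = of_real (1 - q)" "X $ 2 $ 1 = of_real (1 - q)" "X $ 2 $ 2 = of_real q"
    using Q1_eq_binomial_tail[OF n, of 0] Q3_eq_binomial_tail[OF n, of 0]
    by (simp_all add: X_def X_matrix_def q_def)
  have "det X = of_real (q * q - (1 - q) * (1 - q))" by (simp add: det_2 X)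
  also have "q * q - (1 - q) * (1 - q) = - (1 - 2 * q)" by (simp add: algebra_simps)
  also have "\<dots> = - (real (2 * n + 1 choose n) / 4 ^ n)" unfolding q_def binomial_tail_0 ..
  finally have "det X = - of_real (real (2 * n + 1 choose n) / 4 ^ n)" by simp
  hence "det X \<noteq> 0" by simp
  hence "invertible X" by (simp add: invertible_det_nz)
  hence "X ** matrix_inv X = mat 1"
    unfolding invertible_def matrix_inv_def by (rule someI2_ex) simp
  hence "X *v v = b"
    unfolding v_def CD_vector_def X_def [symmetric] b_def [symmetric] by (simp add: matrix_vector_mul_assoc)
  hence "(X *v v) $ 1 = b $ 1" "(X *v v) $ 2 = b $ 2" by simp_all
  thus "of_real (binomial_tail n 0) * v $ 1 + of_real (1 - binomial_tail n 0) * v $ 2 = a 0 (n + 1) n m 0"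
    "of_real (1 - binomial_tail n 0) * v $ 1 + of_real (binomial_tail n 0) * v $ 2 = a 2 (n + 1) n m 0"
    by (simp_all add: matrix_vector_mult_def sum_2 X b_def q_def)
qed

lemma critical_mode:
  assumes maxwell: "maxwell \<phi>" and n: "n \<ge> 1" and m: "\<bar>m\<bar> \<le> int n" and x: "x \<in> {-1..1}"
  shows "a 0 (n + 1) n m x = D_const a (n + 1) n m
    + (CD_vector a (n + 1) n m $ 1 - D_const a (n + 1) n m) * of_real (binomial_tail n x)"
proof (rule critical_mode_solution[OF n])
  let ?A = "\<lambda>n'. coeff_jet n' (n + 1) n m"
  note prems = maxwell n le_add1[of n 1] m
  show "(a 0 (n + 1) n m has_vector_derivative d1_tau (a 0 (n + 1) n m) x) (at x within {-1..1})"
    "(a 2 (n + 1) n m has_vector_derivative d1_tau (a 2 (n + 1) n m) x) (at x within {-1..1})"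
    if "x \<in> {-1..1}" for x
    using coeff_has_derivative[of 0 n m "n + 1" x 0] coeff_has_derivative[of 2 n m "n + 1" x 0] n m that
    by (simp_all add: spin_def)
  have eqs: "2 * (1 + (fps_const (of_real x) + fps_X)) * fps_deriv (?A 0 x)
      = of_nat n * (2 - (1 + (fps_const (of_real x) + fps_X))) * (?A 0 x - ?A 2 x)"
    "2 * (2 - (1 + (fps_const (of_real x) + fps_X))) * fps_deriv (?A 2 x)
      = of_nat n * (1 + (fps_const (of_real x) + fps_X)) * (?A 0 x - ?A 2 x)" if x: "x \<in> {-1..1}" for x
    by (rule fps_critical_mode[OF jet_equation_0[OF prems x] jet_equation_1[OF prems x]
          jet_equation_2[OF prems x] M_deriv[OF prems] M_squared[OF prems] n]; simp)+
  show "2 * of_real (1 + x) * d1_tau (a 0 (n + 1) n m) x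
      = of_nat n * of_real (1 - x) * (a 0 (n + 1) n m x - a 2 (n + 1) n m x)"
    "2 * of_real (1 - x) * d1_tau (a 2 (n + 1) n m) x
      = of_nat n * of_real (1 + x) * (a 0 (n + 1) n m x - a 2 (n + 1) n m x)" if "x \<in> {-1..1}" for x
    using eqs[OF that, THEN arg_cong[of _ _ "\<lambda>f. fps_nth f 0"]] coeff_jet_nth_1[of _ "n + 1" n m x]
    by simp_all
qed (use CD_vector_equations[OF n] x in \<open>simp_all add: D_const_def\<close>)

lemma critical_mode_nth:
  assumes maxwell: "maxwell \<phi>" and n: "n \<ge> 1" and m: "\<bar>m\<bar> \<le> int n"
  shows "fps_nth (coeff_jet 0 (n + 1) n m (-1) * geometric_jet (-1) ^ (n + 2)) n
    = D_const a (n + 1) n m * of_real (real (2 * n + 1 choose n) / 2 ^ (2 * n + 2))"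
proof -
  define C where "C = CD_vector a (n + 1) n m $ 1"
  define D where "D = D_const a (n + 1) n m"
  define u where "u x = fps_const (1/2) * (1 + (fps_const (complex_of_real x) + fps_X))" for x
  define w where "w x = fps_const (1/2) * (1 - (fps_const (complex_of_real x) + fps_X))" for x
  define q where "q x = (\<Sum>j<n. of_nat (2 * n + 1 choose j) * u x ^ j * w x ^ (2 * n + 1 - j))" for x
  note jets = jet_on_add jet_on_diff jet_on_mult jet_on_power jet_on_sum jet_on_X jet_on_const
  have c: "jet_on S (\<lambda>_. 1)" "jet_on S (\<lambda>_. of_nat k)" for S k by (auto intro!: jet_on_fps_const)
  have q: "jet_on S q" for S
    unfolding q_def[abs_def] u_def w_def by (intro jets c)
  have pw0: "fps_nth (F ^ k) 0 = fps_nth F 0 ^ k" for F :: "complex fps" and k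
    by (induction k) simp_all
  have q0: "fps_nth (q x) 0 = of_real (binomial_tail n x)" for x
    by (simp add: q_def binomial_tail_def fps_sum_nth pw0 u_def w_def field_simps del: binomial_Suc_Suc)
  have "coeff_jet 0 (n + 1) n m (-1) - (fps_const D + fps_const (C - D) * q (-1)) = 0"
  proof (rule jet_on_eq_0[of "-1" 1])
    show "jet_on {-1..1} (\<lambda>x. coeff_jet 0 (n + 1) n m x - (fps_const D + fps_const (C - D) * q x))"
      by (intro jets q jet_on_coeff) (use n m in \<open>auto simp: spin_def\<close>)
    show "fps_nth (coeff_jet 0 (n + 1) n m x - (fps_const D + fps_const (C - D) * q x)) 0 = 0"
      if "x \<in> {-1..1}" for x
      using critical_mode[OF maxwell n m that] by (simp add: q0 C_def D_def)
  qed simp_all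
  hence A: "coeff_jet 0 (n + 1) n m (-1) = fps_const D + fps_const (C - D) * q (-1)" by simp
  have u1: "u (-1) = fps_const (1/2) * fps_X"
    unfolding u_def by (simp flip: fps_const_neg)
  have w1: "w (-1) = fps_const (1/2) * (2 - fps_X)"
    unfolding w_def by (simp flip: fps_const_neg)
  have "q (-1) * geometric_jet (-1) ^ (n + 2)
      = (\<Sum>j<n. fps_const (of_nat (2 * n + 1 choose j) * (1/2) ^ j * (1/2) ^ (2 * n + 1 - j)) * (fps_X ^ j * (2 - fps_X) ^ (n - 1 - j)))"
    unfolding q_def sum_distrib_right
  proof (intro sum.cong refl)
    fix j assume "j \<in> {..<n}"
    \<comment> \<open>As \<open>j < n\<close>, each summand of \<open>q\<close> contains the full
      factor \<open>(2 - X) ^ (n + 2)\<close>; what remains after division is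
      \<open>X ^ j (2 - X) ^ (n - 1 - j)\<close>, of degree \<open>n - 1\<close>.\<close>
    hence e: "2 * n + 1 - j = (n + 2) + (n - 1 - j)" by auto
    have "of_nat (2 * n + 1 choose j) * u (-1) ^ j * w (-1) ^ (2 * n + 1 - j) * geometric_jet (-1) ^ (n + 2)
        = fps_const (of_nat (2 * n + 1 choose j) * (1/2) ^ j * (1/2) ^ (2 * n + 1 - j))
          * (fps_X ^ j * (2 - fps_X) ^ (2 * n + 1 - j)) * geometric_jet (-1) ^ (n + 2)"
      unfolding u1 w1 power_mult_distrib fps_const_power
      by (simp only: fps_of_nat [symmetric] fps_const_mult [symmetric] mult_ac)
    also have "(2 - fps_X) ^ (2 * n + 1 - j) = (2 - fps_X) ^ (n + 2) * (2 - fps_X) ^ (n - 1 - j)"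
      unfolding e power_add ..
    also have "fps_const c * (fps_X ^ j * ((2 - fps_X) ^ (n + 2) * (2 - fps_X) ^ (n - 1 - j))) * geometric_jet (-1) ^ (n + 2)
        = fps_const c * (fps_X ^ j * (2 - fps_X) ^ (n - 1 - j)) * ((2 - fps_X) ^ (n + 2) * geometric_jet (-1) ^ (n + 2))" for c
      by (simp only: mult_ac)
    finally show "of_nat (2 * n + 1 choose j) * u (-1) ^ j * w (-1) ^ (2 * n + 1 - j) * geometric_jet (-1) ^ (n + 2)
        = fps_const (of_nat (2 * n + 1 choose j) * (1/2) ^ j * (1/2) ^ (2 * n + 1 - j)) * (fps_X ^ j * (2 - fps_X) ^ (n - 1 - j))"
      unfolding two_minus_X_times_geometric_jet mult_1_right .
  qed
  hence "fps_nth (q (-1) * geometric_jet (-1) ^ (n + 2)) n = 0"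
    by (simp add: fps_sum_nth fps_nth_X_power_mult_2_minus_X_power)
  moreover have "coeff_jet 0 (n + 1) n m (-1) * geometric_jet (-1) ^ (n + 2)
      = fps_const D * geometric_jet (-1) ^ (n + 2) + fps_const (C - D) * (q (-1) * geometric_jet (-1) ^ (n + 2))"
    unfolding A by (simp add: algebra_simps)
  ultimately have "fps_nth (coeff_jet 0 (n + 1) n m (-1) * geometric_jet (-1) ^ (n + 2)) n
      = D * fps_nth (geometric_jet (-1) ^ (n + 1 + 1)) n"
    by (simp only: fps_add_nth fps_mult_left_const_nth) simp
  \<comment> \<open>The exponent \<open>n + 2\<close> is \<open>k + 1\<close> with
    \<open>k = n + 1\<close>, and \<open>1 - x = 2\<close>: this gives
    \<open>2 n + 1 choose n\<close> over \<open>2 ^ (2 n + 2)\<close>.\<close>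
  also have "\<dots> = D * (of_nat (n + 1 + n choose n) * of_real (1 / (1 - -1)) ^ (n + 1 + n + 1))"
    by (subst geometric_jet_power_nth) simp_all
  also have "n + 1 + n = 2 * n + 1" by simp
  finally show ?thesis by (simp add: D_def power_divide)
qed

end

subsection \<open>The field along an ingoing ray\<close>

lemma uniformly_convergent_on_sum:
  fixes f :: "'i \<Rightarrow> nat \<Rightarrow> 'a \<Rightarrow> 'b::real_normed_vector"
  assumes "\<And>i. i \<in> I \<Longrightarrow> uniformly_convergent_on S (f i)"
  shows "uniformly_convergent_on S (\<lambda>N x. \<Sum>i\<in>I. f i N x)"
  using assms
proof (induction I rule: infinite_finite_induct)
  case (insert i I)
  thus ?case by (simp add: uniformly_convergent_on_add)
qed simp_all

text \<open>The chain rule for \<open>\<rho> ^ p / (1 - x)\<close> along the ray in closed form,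
  with \<open>g = 1 / (1 - x)\<close> and \<open>\<rho> = g / v\<close>. The last factor is the
  \<open>t\<close>-th derivative of \<open>\<rho> ^ p\<close>, and the weight in front of it does
  not depend on \<open>p\<close>, so that series over \<open>p\<close> can be combined without loss
  of uniform convergence.\<close>

lemma vandermonde_ray_coefficient:
  fixes g v :: real
  assumes "v \<noteq> 0"
  shows "real (p + j choose j) * g ^ (p + j + 1) / v ^ p
    = (\<Sum>t\<le>j. real (j choose t) / fact t * g ^ (j + 1) * (g / v) ^ t * (fact t * real (p choose t) * (g / v) ^ (p - t)))"
proof -
  have "(p + j choose j) = (\<Sum>t\<le>j. (p choose t) * (j choose (j - t)))"
    by (rule vandermonde [symmetric])
  also have "\<dots> = (\<Sum>t\<le>j. (p choose t) * (j choose t))"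
    by (intro sum.cong refl) (simp add: binomial_symmetric [symmetric])
  finally have "real (p + j choose j) = (\<Sum>t\<le>j. real (p choose t) * real (j choose t))"
    by simp
  moreover have "g ^ (p + j + 1) / v ^ p = g ^ (j + 1) * (g / v) ^ p"
    by (simp add: power_add power_divide)
  ultimately have "real (p + j choose j) * g ^ (p + j + 1) / v ^ p
      = (\<Sum>t\<le>j. real (p choose t) * real (j choose t) * (g ^ (j + 1) * (g / v) ^ p))"
    unfolding sum_distrib_right [symmetric] by (metis times_divide_eq_right)
  also have "\<dots> = (\<Sum>t\<le>j. real (j choose t) / fact t * g ^ (j + 1) * (g / v) ^ t * (fact t * real (p choose t) * (g / v) ^ (p - t)))"
  proof (intro sum.cong refl)
    fix t
    show "real (p choose t) * real (j choose t) * (g ^ (j + 1) * (g / v) ^ p)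
       = real (j choose t) / fact t * g ^ (j + 1) * (g / v) ^ t * (fact t * real (p choose t) * (g / v) ^ (p - t))"
    proof (cases "t \<le> p")
      case True
      hence "(g / v) ^ p = (g / v) ^ t * (g / v) ^ (p - t)" by (simp flip: power_add)
      thus ?thesis by simp
    qed simp
  qed
  finally show ?thesis .
qed

context expansion
begin

context
  fixes \<rho>\<^sub>s v R x1 :: real
  assumes rho_s: "0 < \<rho>\<^sub>s" "\<rho>\<^sub>s < \<rho>\<^sub>0"
  defines "v \<equiv> 1 / (2 * \<rho>\<^sub>s)" and "R \<equiv> (\<rho>\<^sub>s + \<rho>\<^sub>0) / 2" and "x1 \<equiv> 1 - 1 / (v * R)"
begin

text \<open>The ray starts at the cut \<open>x = -1\<close> with
  \<open>\<rho> = \<rho>\<^sub>s\<close>, and \<open>\<rho>\<close> grows along it;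
  \<open>x1\<close> is where it reaches \<open>R\<close>, the midpoint between
  \<open>\<rho>\<^sub>s\<close> and \<open>\<rho>\<^sub>0\<close>. Up to there the expansion
  converges uniformly.\<close>

lemma v_pos: "v > 0" and R: "0 < R" "R < \<rho>\<^sub>0" and x1: "-1 < x1" "x1 < 1"
proof -
  show "v > 0" "0 < R" "R < \<rho>\<^sub>0" using rho_s by (simp_all add: v_def R_def)
  have "1 / (v * R) = 2 * \<rho>\<^sub>s / R" by (simp add: v_def)
  moreover have "2 * \<rho>\<^sub>s / R < 2" "2 * \<rho>\<^sub>s / R > 0" using rho_s by (simp_all add: R_def field_simps)
  ultimately show "-1 < x1" "x1 < 1" unfolding x1_def by simp_all
qed

lemma ray_rho:
  assumes "x \<in> {-1..x1}"
  shows "1 / (v * (1 - x)) \<in> {0..R}" "1 / (v * (1 - x)) \<in> {0..<\<rho>\<^sub>0}" "x \<in> {-1..1}" "x \<noteq> 1"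
proof -
  have "1 / (v * R) \<le> 1 - x" using assms by (simp add: x1_def)
  hence "1 / R \<le> v * (1 - x)" using v_pos R by (simp add: field_simps)
  moreover have "1 - x > 0" using assms x1 by auto
  ultimately have "1 / (v * (1 - x)) \<le> R" using v_pos R by (simp add: field_simps)
  thus "1 / (v * (1 - x)) \<in> {0..R}" "1 / (v * (1 - x)) \<in> {0..<\<rho>\<^sub>0}" "x \<in> {-1..1}" "x \<noteq> 1"
    using v_pos R assms x1 \<open>1 - x > 0\<close> by auto
qed

text \<open>The jet along the ingoing ray \<open>\<rho> = 1 / (v (1 - x))\<close> of the order \<open>p\<close> part of \<open>\<phi> 0 / (1 - x)\<close>.\<close>

definition ray_jet :: "real \<Rightarrow> real \<Rightarrow> nat \<Rightarrow> real \<Rightarrow> complex fps" where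
  "ray_jet \<theta> \<alpha> p x = (\<Sum>(l, m)\<in>modes 1 p. fps_const (Y 1 l m \<theta> \<alpha> / of_real (fact p * v ^ p))
      * (coeff_jet 0 p l m x * geometric_jet x ^ (p + 1)))"

lemma jet_on_ray_jet: "jet_on {-1..x1} (ray_jet \<theta> \<alpha> p)"
proof -
  have "jet_on {-1..x1} (coeff_jet 0 p l m)" if "(l, m) \<in> modes 1 p" for l m
    by (rule jet_on_subset[OF jet_on_coeff]) (use that x1 in \<open>auto simp: spin_def\<close>)
  thus ?thesis
    unfolding ray_jet_def[abs_def] case_prod_beta
    by (intro jet_on_sum jet_on_mult jet_on_const jet_on_power jet_on_geometric) (use x1 in auto)
qed

text \<open>What multiplies the term with \<open>k\<close> derivatives in \<open>\<tau>\<close> and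
  \<open>t\<close> in \<open>\<rho>\<close> in the \<open>i\<close>-th Taylor coefficient along the
  ray. It combines Leibniz' rule in \<open>k\<close> with the chain rule in
  \<open>t\<close>.\<close>

definition ray_weight :: "nat \<Rightarrow> nat \<Rightarrow> nat \<Rightarrow> real \<Rightarrow> real" where
  "ray_weight i k t x = real (i - k choose t) / (fact k * fact t) * (1 / (1 - x)) ^ (i - k + 1) * (1 / (v * (1 - x))) ^ t"

lemma ray_jet_nth:
  assumes x: "x \<noteq> 1"
  shows "fps_nth (ray_jet \<theta> \<alpha> p x) i = (\<Sum>k\<le>i. \<Sum>t\<le>i - k. of_real (ray_weight i k t x)
     * expansion_term a 0 k t [] p x (1 / (v * (1 - x))) \<theta> \<alpha>)"
proof -
  define g where "g = 1 / (1 - x)"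
  have gv: "1 / (v * (1 - x)) = g / v" by (simp add: g_def)
  define c where "c k l m = Y 1 l m \<theta> \<alpha> * (d1_tau ^^ k) (a 0 p l m) x / fact p" for k l m
  define e where "e k t = fact t * real (p choose t) * (g / v) ^ (p - t)" for k t :: nat
  have sum: "real (p + j choose j) * g ^ (p + j + 1) / (v ^ p * fact k) = (\<Sum>t\<le>j. ray_weight i k t x * e k t)"
    if "j = i - k" for j k
    using vandermonde_ray_coefficient[of v p j g] v_pos
    unfolding ray_weight_def that gv g_def [symmetric] e_def
    by (simp add: sum_distrib_left sum_divide_distrib field_simps)
  have "fps_nth (coeff_jet 0 p l m x * geometric_jet x ^ (p + 1)) i
      = (\<Sum>k\<le>i. (d1_tau ^^ k) (a 0 p l m) x / fact k * (of_nat (p + (i - k) choose (i - k)) * of_real g ^ (p + (i - k) + 1)))" for l m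
    unfolding fps_mult_nth geometric_jet_power_nth[OF x] g_def atLeast0AtMost by (simp add: coeff_jet_def)
  hence "fps_nth (ray_jet \<theta> \<alpha> p x) i = (\<Sum>(l, m)\<in>modes 1 p. Y 1 l m \<theta> \<alpha> / of_real (fact p * v ^ p) *
      (\<Sum>k\<le>i. (d1_tau ^^ k) (a 0 p l m) x / fact k * (of_nat (p + (i - k) choose (i - k)) * of_real g ^ (p + (i - k) + 1))))"
    unfolding ray_jet_def fps_sum_nth case_prod_beta fps_mult_left_const_nth by simp
  also have "\<dots> = (\<Sum>(l, m)\<in>modes 1 p. \<Sum>k\<le>i. c k l m
      * of_real (real (p + (i - k) choose (i - k)) * g ^ (p + (i - k) + 1) / (v ^ p * fact k)))"
    unfolding case_prod_beta sum_distrib_left c_def by (intro sum.cong refl) (simp add: mult.assoc)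
  also have "\<dots> = (\<Sum>(l, m)\<in>modes 1 p. \<Sum>k\<le>i. c k l m * of_real (\<Sum>t\<le>i - k. ray_weight i k t x * e k t))"
    unfolding sum[OF refl] ..
  also have "\<dots> = (\<Sum>k\<le>i. \<Sum>(l, m)\<in>modes 1 p. c k l m * of_real (\<Sum>t\<le>i - k. ray_weight i k t x * e k t))"
    unfolding case_prod_beta by (rule sum.swap)
  also have "\<dots> = (\<Sum>k\<le>i. \<Sum>t\<le>i - k. \<Sum>(l, m)\<in>modes 1 p. c k l m * of_real (ray_weight i k t x * e k t))"
    unfolding case_prod_beta of_real_sum sum_distrib_left by (intro sum.cong refl sum.swap)
  also have "\<dots> = (\<Sum>k\<le>i. \<Sum>t\<le>i - k. of_real (ray_weight i k t x)
     * expansion_term a 0 k t [] p x (1 / (v * (1 - x))) \<theta> \<alpha>)"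
    unfolding expansion_term_eq gv
    by (intro sum.cong refl) (simp add: sum_distrib_left case_prod_beta c_def e_def spin_def mult_ac)
  finally show ?thesis .
qed

text \<open>A finite combination of the series assumed to converge uniformly; the weights are free
  of \<open>p\<close> and bounded because \<open>x1 < 1\<close>.\<close>

lemma uniformly_convergent_ray_jet:
  "uniformly_convergent_on ({-1..x1} \<times> {0<..<pi} \<times> UNIV)
     (\<lambda>N (x, \<theta>, \<alpha>). \<Sum>p<N. fps_nth (ray_jet \<theta> \<alpha> p x) i)"
proof -
  let ?S = "{-1..x1} \<times> {0<..<pi} \<times> UNIV :: (real \<times> real \<times> real) set"
  have u: "uniformly_convergent_on ?S (\<lambda>N y. \<Sum>k\<le>i. \<Sum>t\<le>i - k. of_real (ray_weight i k t (fst y)) *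
    (case (fst y, 1 / (v * (1 - fst y)), snd y) of (\<tau>, \<rho>, \<theta>, \<alpha>) \<Rightarrow>
      \<Sum>p<N. expansion_term a 0 k t [] p \<tau> \<rho> \<theta> \<alpha>))"
  proof (intro uniformly_convergent_on_sum uniformly_convergent_on_bounded_mult)
    fix k t
    show "uniformly_convergent_on ?S (\<lambda>N y. case (fst y, 1 / (v * (1 - fst y)), snd y) of (\<tau>, \<rho>, \<theta>, \<alpha>) \<Rightarrow>
      \<Sum>p<N. expansion_term a 0 k t [] p \<tau> \<rho> \<theta> \<alpha>)"
    proof (rule uniformly_convergent_expansion)
      show "(\<lambda>y. (fst y, 1 / (v * (1 - fst y)), snd y)) ` ?S \<subseteq> {-1..1} \<times> {0..R} \<times> {0<..<pi} \<times> UNIV"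
        using ray_rho by auto
    qed (use R in auto)
    have "continuous_on {-1..x1} (\<lambda>x. complex_of_real (ray_weight i k t x))"
      unfolding ray_weight_def by (intro continuous_intros) (use x1 v_pos in auto)
    hence "bounded ((\<lambda>x. complex_of_real (ray_weight i k t x)) ` {-1..x1})"
      by (intro compact_imp_bounded compact_continuous_image) auto
    thus "bounded ((\<lambda>y. complex_of_real (ray_weight i k t (fst y))) ` ?S)"
      by (rule bounded_subset) auto
  qed
  have eq: "(\<Sum>k\<le>i. \<Sum>t\<le>i - k. of_real (ray_weight i k t (fst y)) *
    (case (fst y, 1 / (v * (1 - fst y)), snd y) of (\<tau>, \<rho>, \<theta>, \<alpha>) \<Rightarrow>
      \<Sum>p<N. expansion_term a 0 k t [] p \<tau> \<rho> \<theta> \<alpha>)) = (case y of (x, \<theta>, \<alpha>) \<Rightarrow> \<Sum>p<N. fps_nth (ray_jet \<theta> \<alpha> p x) i)"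
    if "y \<in> ?S" for y N
  proof -
    obtain x \<theta> \<alpha> where y: "y = (x, \<theta>, \<alpha>)" by (cases y) auto
    have x: "x \<noteq> 1" using that ray_rho(4) y by auto
    have "(\<Sum>p<N. fps_nth (ray_jet \<theta> \<alpha> p x) i) = (\<Sum>k\<le>i. \<Sum>p<N. \<Sum>t\<le>i - k. of_real (ray_weight i k t x)
     * expansion_term a 0 k t [] p x (1 / (v * (1 - x))) \<theta> \<alpha>)"
      unfolding ray_jet_nth[OF x] by (rule sum.swap)
    also have "\<dots> = (\<Sum>k\<le>i. \<Sum>t\<le>i - k. \<Sum>p<N. of_real (ray_weight i k t x)
     * expansion_term a 0 k t [] p x (1 / (v * (1 - x))) \<theta> \<alpha>)"
      by (intro sum.cong refl sum.swap)
    finally show ?thesis by (simp add: y sum_distrib_left)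
  qed
  from u obtain L where "uniform_limit ?S (\<lambda>N y. \<Sum>k\<le>i. \<Sum>t\<le>i - k. of_real (ray_weight i k t (fst y)) *
    (case (fst y, 1 / (v * (1 - fst y)), snd y) of (\<tau>, \<rho>, \<theta>, \<alpha>) \<Rightarrow>
      \<Sum>p<N. expansion_term a 0 k t [] p \<tau> \<rho> \<theta> \<alpha>)) L sequentially"
    unfolding uniformly_convergent_on_def by blast
  hence "uniform_limit ?S (\<lambda>N (x, \<theta>, \<alpha>). \<Sum>p<N. fps_nth (ray_jet \<theta> \<alpha> p x) i) L sequentially"
    by (rule uniform_limit_cong'[THEN iffD1, rotated -1]) (use eq in auto)
  thus ?thesis unfolding uniformly_convergent_on_def by blast
qed

text \<open>Summed coefficient by coefficient. Uniform convergence makes it a jet again, namely the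
  Taylor series of \<open>\<phi> 0 / (1 - x)\<close> along the ray.\<close>

definition total_jet :: "real \<Rightarrow> real \<Rightarrow> real \<Rightarrow> complex fps" where
  "total_jet \<theta> \<alpha> x = Abs_fps (\<lambda>i. \<Sum>p. fps_nth (ray_jet \<theta> \<alpha> p x) i)"

lemma ray_jet_sums:
  assumes "x \<in> {-1..x1}" "\<theta> \<in> {0<..<pi}"
  shows "(\<lambda>p. fps_nth (ray_jet \<theta> \<alpha> p x) i) sums fps_nth (total_jet \<theta> \<alpha> x) i"
proof -
  obtain L where L: "uniform_limit ({-1..x1} \<times> {0<..<pi} \<times> UNIV)
     (\<lambda>N (x, \<theta>, \<alpha>). \<Sum>p<N. fps_nth (ray_jet \<theta> \<alpha> p x) i) L sequentially"
    using uniformly_convergent_ray_jet unfolding uniformly_convergent_on_def by blast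
  have "(\<lambda>p. fps_nth (ray_jet \<theta> \<alpha> p x) i) sums L (x, \<theta>, \<alpha>)"
    using tendsto_uniform_limitI[OF L, of "(x, \<theta>, \<alpha>)"] assms by (simp add: sums_def)
  thus ?thesis by (simp add: total_jet_def sums_iff)
qed

lemma jet_on_total_jet:
  assumes \<theta>: "\<theta> \<in> {0<..<pi}"
  shows "jet_on {-1..x1} (total_jet \<theta> \<alpha>)"
  unfolding jet_on_def coeffs_have_derivative_def
proof (intro ballI allI)
  fix x i assume x: "x \<in> {-1..x1}"
  have "uniformly_convergent_on {-1..x1} (\<lambda>N x. case (x, \<theta>, \<alpha>) of (x, \<theta>, \<alpha>) \<Rightarrow> \<Sum>p<N. fps_nth (ray_jet \<theta> \<alpha> p x) (i + 1))"
    by (rule uniformly_convergent_on_compose_set[OF uniformly_convergent_ray_jet]) (use \<theta> in auto)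
  hence "uniformly_convergent_on {-1..x1} (\<lambda>N x. of_nat (i + 1) * (\<Sum>p<N. fps_nth (ray_jet \<theta> \<alpha> p x) (i + 1)))"
    by (intro uniformly_convergent_on_bounded_mult) (auto simp: image_constant_conv)
  hence u: "uniformly_convergent_on {-1..x1} (\<lambda>N x. \<Sum>p<N. of_nat (i + 1) * fps_nth (ray_jet \<theta> \<alpha> p x) (i + 1))"
    by (simp only: sum_distrib_left)
  have s: "(\<lambda>p. of_nat (i + 1) * fps_nth (ray_jet \<theta> \<alpha> p x) (i + 1)) sums (of_nat (i + 1) * fps_nth (total_jet \<theta> \<alpha> x) (i + 1))"
    by (intro sums_mult ray_jet_sums x \<theta>)
  have "((\<lambda>x. fps_nth (total_jet \<theta> \<alpha> x) i) has_vector_derivative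
      (\<Sum>p. of_nat (i + 1) * fps_nth (ray_jet \<theta> \<alpha> p x) (i + 1))) (at x within {-1..x1})"
    by (rule sums_has_vector_derivative(1)[OF convex_real_interval(5) jet_onD[OF jet_on_ray_jet] u
          ray_jet_sums[OF _ \<theta>] x])
  thus "((\<lambda>x. fps_nth (total_jet \<theta> \<alpha> x) i) has_vector_derivative
      fps_nth (fps_deriv (total_jet \<theta> \<alpha> x)) i) (at x within {-1..x1})"
    unfolding sums_unique[OF s, symmetric] by simp
qed

lemma total_jet_nth_0:
  assumes x: "x \<in> {-1..x1}" and \<theta>: "\<theta> \<in> {0<..<pi}"
  shows "fps_nth (total_jet \<theta> \<alpha> x) 0 = of_real (1 / (1 - x)) * \<phi> 0 x (1 / (v * (1 - x))) \<theta> \<alpha>"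
proof -
  have "(\<lambda>p. of_real (1 / (1 - x)) * expansion_term a 0 0 0 [] p x (1 / (v * (1 - x))) \<theta> \<alpha>) sums
      (of_real (1 / (1 - x)) * \<phi> 0 x (1 / (v * (1 - x))) \<theta> \<alpha>)"
    by (intro sums_mult sums_phi ray_rho x \<theta>) simp
  moreover have "fps_nth (ray_jet \<theta> \<alpha> p x) 0 = of_real (1 / (1 - x)) * expansion_term a 0 0 0 [] p x (1 / (v * (1 - x))) \<theta> \<alpha>" for p
    unfolding ray_jet_nth[OF ray_rho(4)[OF x]] by (simp add: ray_weight_def)
  ultimately show ?thesis using ray_jet_sums[OF x \<theta>, of \<alpha> 0] by (simp only: sums_unique2)
qed

lemma phi2_coeff_eq:
  assumes \<theta>: "\<theta> \<in> {0<..<pi}"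
  shows "phi2_coeff \<phi> k v \<theta> \<alpha> = 4 * of_real v ^ (k + 1) * fps_nth (total_jet \<theta> \<alpha> (-1)) k"
proof (rule phi2_coeff_eqI, rule is_radial_expansionI)
  show "of_real (1 / (1 - x)) * \<phi> 0 x (1 / (v * (1 - x))) \<theta> \<alpha> = fps_nth (total_jet \<theta> \<alpha> x) 0"
    if "x \<in> {-1<..x1}" for x
    using that by (intro total_jet_nth_0 [symmetric] \<theta>) auto
  show "\<exists>B. \<forall>x\<in>{-1..x1}. norm (fps_nth (total_jet \<theta> \<alpha> x) 0
      - (\<Sum>k\<le>N. fps_nth (total_jet \<theta> \<alpha> (-1)) k * of_real ((x + 1) ^ k))) \<le> B * (x + 1) ^ (N + 1)" for N
    by (rule jet_taylor_bound[OF jet_on_total_jet[OF \<theta>, of \<alpha>], of N])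
      (unfold diff_minus_eq_add, blast)
qed (use v_pos x1 in auto)

text \<open>Uniform convergence on the sphere at \<open>x = -1\<close> makes the integral the limit
  of the integrals over partial sums in \<open>p\<close>. These are constant as soon as the order
  \<open>n + 1\<close> is included, since no other order contributes to the mode
  \<open>l = n\<close>.\<close>

lemma NP_const_eq:
  assumes maxwell: "maxwell \<phi>" and n: "n \<ge> 1" and m: "\<bar>m\<bar> \<le> int n"
  shows "NP_const \<phi> \<rho>\<^sub>s (n - 1) m
    = of_real (real (2 * n + 1 choose n) / (4 ^ n * fact (n + 1))) * D_const a (n + 1) n m"
proof -
  define c where "c p l m = fps_nth (coeff_jet 0 p l m (-1) * geometric_jet (-1) ^ (p + 1)) n / of_real (fact p * v ^ p)" for p l m
  have nth: "fps_nth (ray_jet \<theta> \<alpha> p (-1)) n = (\<Sum>(l, m)\<in>modes 1 p. c p l m * Y 1 l m \<theta> \<alpha>)" for \<theta> \<alpha> p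
    unfolding ray_jet_def fps_sum_nth case_prod_beta fps_mult_left_const_nth c_def
    by (intro sum.cong refl) simp
  define F where "F N \<theta> \<alpha> = (\<Sum>p<N. fps_nth (ray_jet \<theta> \<alpha> p (-1)) n)" for N \<theta> \<alpha>
  define G where "G \<theta> \<alpha> = fps_nth (total_jet \<theta> \<alpha> (-1)) n" for \<theta> \<alpha>
  define H where "H \<theta> \<alpha> = cnj (Y 1 n m \<theta> \<alpha>)" for \<theta> \<alpha>
  have cY: "continuous_on S (\<lambda>x. Y 1 l m (fst x) (snd x))" if "(l, m) \<in> modes 1 p" for l m p and S :: "(real \<times> real) set"
  proof -
    have lm: "\<bar>1 :: int\<bar> \<le> int l" "\<bar>m\<bar> \<le> int l" using that by auto
    show ?thesis
      unfolding Y_eq[OF lm] cis_conv_exp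
      by (intro continuous_intros continuous_on_compose2[OF continuous_Y_theta[of UNIV]]) auto
  qed
  have "(n, m) \<in> modes 1 n" using n m by simp
  hence H: "sphere_continuous H"
    unfolding sphere_continuous_def H_def by (intro continuous_intros cY)
  have R: "sphere_continuous (\<lambda>\<theta> \<alpha>. fps_nth (ray_jet \<theta> \<alpha> p (-1)) n)" for p
    unfolding sphere_continuous_def nth case_prod_beta by (intro continuous_intros cY[of _ _ p]) auto
  have F: "sphere_continuous (F N)" for N
    using R unfolding sphere_continuous_def F_def by (intro continuous_intros)
  have x: "-1 \<in> {-1..x1}" using x1 by simp
  have "uniform_limit ({0<..<pi} \<times> UNIV) (\<lambda>N (\<theta>, \<alpha>). F N \<theta> \<alpha>) (\<lambda>(\<theta>, \<alpha>). G \<theta> \<alpha>) sequentially"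
  proof -
    have "uniformly_convergent_on ({0<..<pi} \<times> UNIV)
        (\<lambda>N y. case (-1, y) of (x, \<theta>, \<alpha>) \<Rightarrow> \<Sum>p<N. fps_nth (ray_jet \<theta> \<alpha> p x) n)"
      by (rule uniformly_convergent_on_compose_set[OF uniformly_convergent_ray_jet]) (use x in auto)
    then obtain L where L: "uniform_limit ({0<..<pi} \<times> UNIV) (\<lambda>N (\<theta>, \<alpha>). F N \<theta> \<alpha>) L sequentially"
      unfolding uniformly_convergent_on_def F_def by auto
    have Leq: "L y = (case y of (\<theta>, \<alpha>) \<Rightarrow> G \<theta> \<alpha>)" if "y \<in> {0<..<pi} \<times> UNIV" for y
    proof -
      obtain \<theta> \<alpha> where y: "y = (\<theta>, \<alpha>)" by (cases y) auto
      have "(\<lambda>N. F N \<theta> \<alpha>) \<longlonglongrightarrow> L y" using tendsto_uniform_limitI[OF L that] by (simp add: y)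
      moreover have "(\<lambda>N. F N \<theta> \<alpha>) \<longlonglongrightarrow> G \<theta> \<alpha>"
        using ray_jet_sums[OF x, of \<theta> \<alpha> n] that y by (simp add: sums_def F_def G_def)
      ultimately show ?thesis using LIMSEQ_unique y by auto
    qed
    from L show ?thesis by (rule uniform_limit_cong'[THEN iffD1, rotated -1]) (use Leq in auto)
  qed
  from sphere_integral_uniform_limit[OF F H this]
  have lim: "(\<lambda>N. sphere_integral (\<lambda>\<theta> \<alpha>. H \<theta> \<alpha> * F N \<theta> \<alpha>)) \<longlonglongrightarrow> sphere_integral (\<lambda>\<theta> \<alpha>. H \<theta> \<alpha> * G \<theta> \<alpha>)" .
  have int: "sphere_integral (\<lambda>\<theta> \<alpha>. H \<theta> \<alpha> * F N \<theta> \<alpha>) = c (n + 1) n m" if N: "N > n + 1" for N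
  proof -
    have HR: "sphere_continuous (\<lambda>\<theta> \<alpha>. H \<theta> \<alpha> * fps_nth (ray_jet \<theta> \<alpha> p (-1)) n)" for p
      using H R[of p] unfolding sphere_continuous_def by (intro continuous_intros)
    have "sphere_integral (\<lambda>\<theta> \<alpha>. H \<theta> \<alpha> * F N \<theta> \<alpha>)
        = sphere_integral (\<lambda>\<theta> \<alpha>. \<Sum>p<N. 1 * (H \<theta> \<alpha> * fps_nth (ray_jet \<theta> \<alpha> p (-1)) n))"
      by (simp add: F_def sum_distrib_left)
    also have "\<dots> = (\<Sum>p<N. 1 * sphere_integral (\<lambda>\<theta> \<alpha>. H \<theta> \<alpha> * fps_nth (ray_jet \<theta> \<alpha> p (-1)) n))"
      by (rule sphere_integral_sum) (use HR in auto)
    also have "\<dots> = (\<Sum>p<N. if p = n + 1 then c (n + 1) n m else 0)"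
    proof (intro sum.cong refl)
      fix p
      have "sphere_integral (\<lambda>\<theta> \<alpha>. H \<theta> \<alpha> * fps_nth (ray_jet \<theta> \<alpha> p (-1)) n)
          = (if (n, m) \<in> modes 1 p then c p n m else 0)"
        unfolding nth H_def by (rule sphere_integral_Y_sum) (use n m in auto)
      \<comment> \<open>For \<open>p < n\<close> there is no mode \<open>l = n\<close>; for
        \<open>p = n\<close> and for \<open>p > n + 1\<close> its coefficient is zero by
        \<open>mode_vanishes\<close>.\<close>
      also have "\<dots> = (if p = n + 1 then c (n + 1) n m else 0)"
        using mode_vanishes[OF maxwell, of n p m] n m by (auto simp: c_def)
      finally show "1 * sphere_integral (\<lambda>\<theta> \<alpha>. H \<theta> \<alpha> * fps_nth (ray_jet \<theta> \<alpha> p (-1)) n)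
          = (if p = n + 1 then c (n + 1) n m else 0)" by simp
    qed
    also have "\<dots> = c (n + 1) n m" using N by simp
    finally show ?thesis .
  qed
  have "(\<lambda>N. sphere_integral (\<lambda>\<theta> \<alpha>. H \<theta> \<alpha> * F N \<theta> \<alpha>)) \<longlonglongrightarrow> c (n + 1) n m"
    by (rule tendsto_eventually, rule eventually_mono[OF eventually_gt_at_top[of "n + 1"]], rule int)
  with lim have HG: "sphere_integral (\<lambda>\<theta> \<alpha>. H \<theta> \<alpha> * G \<theta> \<alpha>) = c (n + 1) n m" by (rule LIMSEQ_unique)
  have "NP_const \<phi> \<rho>\<^sub>s (n - 1) m = sphere_integral (\<lambda>\<theta> \<alpha>. H \<theta> \<alpha> * phi2_coeff \<phi> n v \<theta> \<alpha>)"
    using n by (simp add: NP_const_def H_def v_def)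
  also have "\<dots> = sphere_integral (\<lambda>\<theta> \<alpha>. 4 * of_real v ^ (n + 1) * (H \<theta> \<alpha> * G \<theta> \<alpha>))"
    by (rule sphere_integral_cong) (simp add: phi2_coeff_eq G_def)
  also have "\<dots> = 4 * of_real v ^ (n + 1) * sphere_integral (\<lambda>\<theta> \<alpha>. H \<theta> \<alpha> * G \<theta> \<alpha>)"
    by (rule sphere_integral_cmult)
  also have "\<dots> = 4 * of_real v ^ (n + 1) * (D_const a (n + 1) n m
      * of_real (real (2 * n + 1 choose n) / 2 ^ (2 * n + 2)) / of_real (fact (n + 1) * v ^ (n + 1)))"
    unfolding HG c_def using critical_mode_nth[OF maxwell n m] by simp
  also have "\<dots> = of_real (4 * v ^ (n + 1) * (real (2 * n + 1 choose n) / 2 ^ (2 * n + 2)) / (fact (n + 1) * v ^ (n + 1)))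
      * D_const a (n + 1) n m"
    by (simp add: mult_ac)
  \<comment> \<open>The power of \<open>v\<close> from the radial coefficient cancels the one from
    \<open>\<rho> ^ (n + 1)\<close> on the ray: the value is the same on every cut.\<close>
  also have "4 * v ^ (n + 1) * (real (2 * n + 1 choose n) / 2 ^ (2 * n + 2)) / (fact (n + 1) * v ^ (n + 1))
      = real (2 * n + 1 choose n) / (4 ^ n * fact (n + 1))"
  proof -
    have "(2 :: real) ^ (2 * n + 2) = 4 * 4 ^ n" by (simp add: power_mult)
    thus ?thesis using v_pos by (simp add: field_simps del: fact_Suc)
  qed
  finally show ?thesis .
qed

end

end

theorem proposition8:
  shows "\<exists>Q :: nat \<Rightarrow> real. \<forall>n\<ge>1.
    \<forall>(\<phi> :: field) (\<rho>\<^sub>0 :: real) (a :: coeffs).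
      \<rho>\<^sub>0 > 0 \<longrightarrow> smooth_field \<phi> \<longrightarrow> maxwell \<phi> \<longrightarrow> has_expansion \<phi> \<rho>\<^sub>0 a \<longrightarrow>
      regularity_condition a \<longrightarrow>
      (\<forall>m \<rho>\<^sub>s. \<bar>m\<bar> \<le> int n \<longrightarrow> 0 < \<rho>\<^sub>s \<longrightarrow> \<rho>\<^sub>s < \<rho>\<^sub>0 \<longrightarrow>
         NP_const \<phi> \<rho>\<^sub>s (n - 1) m = of_real (Q n) * D_const a (n + 1) n m)"
proof (intro exI allI impI)
  fix n :: nat and \<phi> \<rho>\<^sub>0 a m \<rho>\<^sub>s
  assume *: "n \<ge> 1" "\<rho>\<^sub>0 > 0" "maxwell \<phi>" "has_expansion \<phi> \<rho>\<^sub>0 a" "\<bar>m\<bar> \<le> int n" "0 < \<rho>\<^sub>s" "\<rho>\<^sub>s < \<rho>\<^sub>0"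
  then interpret expansion \<phi> \<rho>\<^sub>0 a by unfold_locales
  \<comment> \<open>The witness for \<open>Q\<close>, left open by \<open>exI\<close>, is fixed
    here. It was introduced before the other quantifiers, so it can depend on \<open>n\<close>
    only.\<close>
  show "NP_const \<phi> \<rho>\<^sub>s (n - 1) m
      = of_real (real (2 * n + 1 choose n) / (4 ^ n * fact (n + 1))) * D_const a (n + 1) n m"
    using * by (intro NP_const_eq)
qed

end
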